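(* Let $k$ be a noetherian commutative $\mathbb{Q}$-algebra, let $W\in k[x]$, $V\in k[y]=k[y_1,\dots,y_m]$ and $U\in k[z]$ be potentials, let $X$ be a finite rank matrix factorisation of $V-W$ over $k[x,y]$ and $Y$ a finite rank matrix factorisation of $U-V$ over $k[y,z]$. Let $\Phi=\pi\exp(-\delta)\epsilon: S_m\otimes_k(Y\otimes X)\to Y\mid X$ be the homotopy equivalence described in the context, and let $\gamma_i,\gamma_i^\dagger$ be the odd closed operators on $Y\mid X$ described there. Then $\Phi$ is an isomorphism of $C_m$-representations in the homotopy category; that is, there are $k[x,z]$-linear homotopies for $1\le i\le m$ $$\gamma_i^\dagger\,\Phi\simeq\Phi\,\theta_i,\qquad \gamma_i\,\Phi\simeq\Phi\,\theta_i^*.$$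
   Context: **Conventions.** Commutators are graded, $[a,b]=ab-(-1)^{|a||b|}ba$; operators on tensor products act with Koszul signs, $(f\otimes g)(a\otimes b)=(-1)^{|g||a|}f(a)\otimes g(b)$. A potential $W\in k[x_1,\dots,x_n]$ is a polynomial such that $\partial_{x_1}W,\dots,\partial_{x_n}W$ is quasi-regular, $J_W=k[x]/(\partial_{x_1}W,\dots,\partial_{x_n}W)$ is a finitely generated free $k$-module, and the Koszul complex of the partial derivatives is exact except in degree zero. A matrix factorisation of $W\in R$ is a free $\mathbb{Z}_2$-graded $R$-module with an odd $R$-linear $d$ with $d^2=W$; finite rank means finitely generated. Two closed linear maps $f,g$ of the same parity are homotopic, $f\simeq g$, if $f-g=[d,h]$ for some linear $h$ of the opposite parity. $C_m$ is the $\mathbb{Z}_2$-graded $k$-algebra with odd generators $\gamma_i,\gamma_i^\dagger$ ($1\le i\le m$) and relations $[\gamma_i,\gamma_j]=0=[\gamma_i^\dagger,\gamma_j^\dagger]$, $[\gamma_i,\gamma_j^\dagger]=\delta_{ij}$. **Objects.** $Y\otimes X=Y\otimes_{k[y]}X$ with $d_{Y\otimes X}=d_Y\otimes1+1\otimes d_X$; $Y\mid X=Y\otimes_{k[y]}J_V\otimes_{k[y]}X$ with the induced differential; both are matrix factorisations of $U-W$ over $k[x,z]$. $S_m=\bigwedge(k\theta_1\oplus\cdots\oplus k\theta_m)$ with $\theta_i$ odd; $\theta_i$ also denotes left wedge multiplication and $\theta_i^*$ contraction from the left, and $C_m$ acts on $S_m\otimes_k(Y\otimes X)$ (differential $1\otimes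 d_{Y\otimes X}$) by $\gamma_i^\dagger\mapsto\theta_i$, $\gamma_i\mapsto\theta_i^*$. **Connection and Clifford operators.** $t_i=\partial_{y_i}V$; $\widehat{k[y]}$ is the $(t_1,\dots,t_m)$-adic completion of $k[y]$; $Y\widehat\otimes X=Y\otimes_{k[y]}\widehat{k[y]}\otimes_{k[y]}X$. Fix a $k$-linear section $\sigma:J_V\to\widehat{k[y]}$ of the quotient map. Every $h\in\widehat{k[y]}$ is uniquely a series $\sum_u\sigma(r_u)t^u$ with $r_u\in J_V$; put $\partial_{t_i}h=\sum_u u_i\sigma(r_u)t^{u-\epsilon_i}$, with $\epsilon_i$ the $i$th unit vector (components of a flat $k$-linear connection over $k[t]$). Using homogeneous bases of $Y$ and $X$ extend $\partial_{t_i}$ to a $k[x,z]$-linear operator on $Y\widehat\otimes X$. The commutator $[d_{Y\otimes X},\partial_{t_i}]$ is $k[t]$-linear and induces an operator $\mathrm{At}_i$ on $Y\mid X$. Write $\lambda_i=\partial_{y_i}(d_X)$ (entrywise derivative in the chosen basis, acting as $1\otimes\partial_{y_i}(d_X)$). On $Y\mid X$: $$\gamma_i=\mathrm{At}_i,\qquad\gamma_i^\dagger=-\partial_{y_i}(d_X)-\tfrac12\sum_q\partial_{y_q}\partial_{y_i}(V)\,\mathrm{At}_q .$$ **The map $\Phi$.** $\epsilon:Y\otimes X\to Y\widehat\otimes X$ is the canonical map (also $1\otimes\epsilon$ on $S_m\otimes_k-$); $\delta=\sum_i\lambda_i\theta_i^*$ is a nilpotent operator on $S_m\otimes_k(Y\widehat\otimes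 X)$, $\exp(-\delta)=\sum_n\frac{(-1)^n}{n!}\delta^n$; $\pi:S_m\otimes_k(Y\widehat\otimes X)\to Y\mid X$ is zero on terms of positive $\theta$-degree and the quotient map $Y\widehat\otimes X\to Y\mid X$ in $\theta$-degree zero. $\Phi=\pi\exp(-\delta)\epsilon$ is a homotopy equivalence over $k[x,z]$. *)

theory Defs
  imports "HOL-Library.Poly_Mapping" "HOL-Algebra.Ideal_Product" "HOL-Algebra.Ring_Divisibility"
begin

section \<open>Polynomial rings\<close>

datatype var = VX nat | VY nat | VZ nat

type_synonym mono = "var \<Rightarrow>\<^sub>0 nat"
type_synonym 'k pol = "mono \<Rightarrow>\<^sub>0 'k"

text \<open>All polynomials live in one type, whose multiplication is the convolution product of
  \<^theory>\<open>HOL-Library.Poly_Mapping\<close>. The ring \<open>poly_ring A\<close> is the subring of those involving only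
  variables from \<open>A\<close>.\<close>

definition poly_ring :: "var set \<Rightarrow> 'k::comm_ring_1 pol ring" where
  "poly_ring A = \<lparr>carrier = {f. \<forall>\<mu>\<in>Poly_Mapping.keys f. Poly_Mapping.keys \<mu> \<subseteq> A},
     monoid.mult = (*), one = 1, ring.zero = 0, add = (+)\<rparr>"

definition const :: "'k::comm_ring_1 \<Rightarrow> 'k pol" where
  "const c = Poly_Mapping.single 0 c"

definition pdiff :: "var \<Rightarrow> 'k::comm_ring_1 pol \<Rightarrow> 'k pol" where
  "pdiff v f = (\<Sum>\<mu>\<in>Poly_Mapping.keys f.
     Poly_Mapping.single (\<mu> - Poly_Mapping.single v 1)
       (of_nat (Poly_Mapping.lookup \<mu> v) * Poly_Mapping.lookup f \<mu>))"

definition sgn_pol :: "bool \<Rightarrow> 'k::comm_ring_1 pol" where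
  "sgn_pol s = (if s then - 1 else 1)"

definition type_ring :: "'k::comm_ring_1 ring" where
  "type_ring = \<lparr>carrier = UNIV, monoid.mult = (*), one = 1, ring.zero = 0, add = (+)\<rparr>"

text \<open>The structure map of a \<open>\<rat>\<close>-algebra.\<close>

definition rat_algebra :: "(rat \<Rightarrow> 'k::comm_ring_1) \<Rightarrow> bool" where
  "rat_algebra \<iota> \<longleftrightarrow> \<iota> 1 = 1 \<and> (\<forall>a b. \<iota> (a + b) = \<iota> a + \<iota> b) \<and> (\<forall>a b. \<iota> (a * b) = \<iota> a * \<iota> b)"


section \<open>Quotients and adic completions\<close>

definition self_module :: "'r ring \<Rightarrow> ('r, 'r) module" where
  "self_module R = ring.extend R \<lparr>smult = monoid.mult R\<rparr>"

definition quot_module :: "'r ring \<Rightarrow> 'r set \<Rightarrow> ('r, 'r set) module" where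
  "quot_module R I = ring.extend (R Quot I)
     \<lparr>smult = (\<lambda>r q. (I +>\<^bsub>R\<^esub> r) \<otimes>\<^bsub>R Quot I\<^esub> q)\<rparr>"

primrec ideal_pow :: "'r ring \<Rightarrow> 'r set \<Rightarrow> nat \<Rightarrow> 'r set" where
  "ideal_pow R I 0 = carrier R"
| "ideal_pow R I (Suc n) = ideal_prod R I (ideal_pow R I n)"

text \<open>The inverse limit of the rings \<open>R/I\<^sup>n\<close>. The class \<open>h n\<close> is the image of the class \<open>h (Suc n)\<close>
  exactly when \<open>h (Suc n) \<subseteq> h n\<close> as cosets.\<close>

definition completion :: "'r ring \<Rightarrow> 'r set \<Rightarrow> ('r, nat \<Rightarrow> 'r set) module" where
  "completion R I =
     \<lparr>carrier = {h. (\<forall>n. h n \<in> carrier (R Quot ideal_pow R I n)) \<and> (\<forall>n. h (Suc n) \<subseteq> h n)},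
      monoid.mult = (\<lambda>g h n. g n \<otimes>\<^bsub>R Quot ideal_pow R I n\<^esub> h n),
      one = (\<lambda>n. \<one>\<^bsub>R Quot ideal_pow R I n\<^esub>),
      ring.zero = (\<lambda>n. \<zero>\<^bsub>R Quot ideal_pow R I n\<^esub>),
      add = (\<lambda>g h n. g n \<oplus>\<^bsub>R Quot ideal_pow R I n\<^esub> h n),
      smult = (\<lambda>r h n. (ideal_pow R I n +>\<^bsub>R\<^esub> r) \<otimes>\<^bsub>R Quot ideal_pow R I n\<^esub> h n)\<rparr>"

definition to_completion :: "'r ring \<Rightarrow> 'r set \<Rightarrow> 'r \<Rightarrow> nat \<Rightarrow> 'r set" where
  "to_completion R I r = (\<lambda>n. ideal_pow R I n +>\<^bsub>R\<^esub> r)"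

definition from_completion :: "(nat \<Rightarrow> 'r set) \<Rightarrow> 'r set" where
  "from_completion h = h 1"


section \<open>Exterior algebra and Koszul complex\<close>

text \<open>An element of \<open>S\<^sub>m \<otimes>\<^sub>k N\<close> is a function \<open>w\<close> on subsets of \<open>{..<m}\<close>: it stands for the sum over \<open>A\<close>
  of \<open>\<theta>\<^sub>A \<otimes> w A\<close>, where \<open>\<theta>\<^sub>A\<close> is the wedge product of the \<open>\<theta>\<^sub>j\<close>, \<open>j \<in> A\<close>, in increasing order.\<close>

definition wedge :: "('k::comm_ring_1 pol, 'e, 'z) module_scheme \<Rightarrow> nat \<Rightarrow>
    (nat set \<Rightarrow> 'e) \<Rightarrow> nat set \<Rightarrow> 'e" where
  "wedge N i w A = (if i \<in> A
     then sgn_pol (odd (card {j\<in>A. j < i})) \<odot>\<^bsub>N\<^esub> w (A - {i}) else \<zero>\<^bsub>N\<^esub>)"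

definition contract :: "('k::comm_ring_1 pol, 'e, 'z) module_scheme \<Rightarrow> nat \<Rightarrow>
    (nat set \<Rightarrow> 'e) \<Rightarrow> nat set \<Rightarrow> 'e" where
  "contract N i w A = (if i \<notin> A
     then sgn_pol (odd (card {j\<in>A. j < i})) \<odot>\<^bsub>N\<^esub> w (insert i A) else \<zero>\<^bsub>N\<^esub>)"

definition koszul_chains :: "'k::comm_ring_1 pol ring \<Rightarrow> nat \<Rightarrow> nat \<Rightarrow> (nat set \<Rightarrow> 'k pol) set" where
  "koszul_chains R n d = {w. (\<forall>A. w A \<in> carrier R) \<and>
     (\<forall>A. w A \<noteq> 0 \<longrightarrow> A \<subseteq> {..<n} \<and> card A = d)}"

definition koszul_diff :: "'k::comm_ring_1 pol ring \<Rightarrow> nat \<Rightarrow> (nat \<Rightarrow> 'k pol) \<Rightarrow>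
    (nat set \<Rightarrow> 'k pol) \<Rightarrow> nat set \<Rightarrow> 'k pol" where
  "koszul_diff R n t w A = (\<Sum>i<n. t i * contract (self_module R) i w A)"

definition koszul_acyclic :: "'k::comm_ring_1 pol ring \<Rightarrow> nat \<Rightarrow> (nat \<Rightarrow> 'k pol) \<Rightarrow> bool" where
  "koszul_acyclic R n t \<longleftrightarrow> (\<forall>d>0. \<forall>w\<in>koszul_chains R n d.
     koszul_diff R n t w = (\<lambda>A. 0) \<longrightarrow>
     (\<exists>v\<in>koszul_chains R n (Suc d). koszul_diff R n t v = w))"


section \<open>Potentials\<close>

definition multi_indices :: "nat \<Rightarrow> (nat \<Rightarrow> nat) set" where
  "multi_indices m = {u. \<forall>i\<ge>m. u i = 0}"

definition tpow :: "nat \<Rightarrow> (nat \<Rightarrow> 'k::comm_ring_1 pol) \<Rightarrow> (nat \<Rightarrow> nat) \<Rightarrow> 'k pol" where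
  "tpow m t u = (\<Prod>i<m. t i ^ u i)"

text \<open>Quasi-regularity: the surjection \<open>(R/I)[T\<^sub>1,\<dots>,T\<^sub>m] \<rightarrow> gr\<^sub>I R\<close>, for \<open>I = (t\<^sub>1,\<dots>,t\<^sub>m)\<close>, is injective.\<close>

definition quasi_regular :: "'k::comm_ring_1 pol ring \<Rightarrow> nat \<Rightarrow> (nat \<Rightarrow> 'k pol) \<Rightarrow> bool" where
  "quasi_regular R m t \<longleftrightarrow> (\<forall>d c.
     let E = {u\<in>multi_indices m. (\<Sum>i<m. u i) = d}; I = Idl\<^bsub>R\<^esub> (t ` {..<m}) in
     (\<forall>u\<in>E. c u \<in> carrier R) \<longrightarrow> (\<Sum>u\<in>E. c u * tpow m t u) \<in> ideal_pow R I (Suc d) \<longrightarrow>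
     (\<forall>u\<in>E. c u \<in> I))"

definition fg_free_over_constants :: "('k::comm_ring_1 pol, 'e) module \<Rightarrow> bool" where
  "fg_free_over_constants M \<longleftrightarrow> (\<exists>(N::nat) e. (\<forall>i<N. e i \<in> carrier M) \<and>
     (\<forall>q\<in>carrier M. \<exists>!c::nat \<Rightarrow> 'k. (\<forall>i\<ge>N. c i = 0) \<and>
        q = (\<Oplus>\<^bsub>M\<^esub>i\<in>{..<N}. const (c i) \<odot>\<^bsub>M\<^esub> e i)))"

text \<open>In the following the \<open>n\<close> variables are \<open>v 0, \<dots>, v (n - 1)\<close>, with \<open>v\<close> one of \<open>VX\<close>, \<open>VY\<close>, \<open>VZ\<close>.\<close>

definition jacobi_ideal :: "(nat \<Rightarrow> var) \<Rightarrow> nat \<Rightarrow> 'k::comm_ring_1 pol \<Rightarrow> 'k pol set" where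
  "jacobi_ideal v n W = Idl\<^bsub>poly_ring (v ` {..<n})\<^esub> ((\<lambda>i. pdiff (v i) W) ` {..<n})"

definition jacobi_ring ::
    "(nat \<Rightarrow> var) \<Rightarrow> nat \<Rightarrow> 'k::comm_ring_1 pol \<Rightarrow> ('k pol, 'k pol set) module" where
  "jacobi_ring v n W = quot_module (poly_ring (v ` {..<n})) (jacobi_ideal v n W)"

definition potential :: "(nat \<Rightarrow> var) \<Rightarrow> nat \<Rightarrow> 'k::comm_ring_1 pol \<Rightarrow> bool" where
  "potential v n W \<longleftrightarrow>
     W \<in> carrier (poly_ring (v ` {..<n})) \<and>
     quasi_regular (poly_ring (v ` {..<n})) n (\<lambda>i. pdiff (v i) W) \<and>
     fg_free_over_constants (jacobi_ring v n W) \<and>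
     koszul_acyclic (poly_ring (v ` {..<n})) n (\<lambda>i. pdiff (v i) W)"


section \<open>Matrix factorisations of finite rank\<close>

text \<open>A free \<open>\<int>\<^sub>2\<close>-graded module of finite rank with a chosen homogeneous basis; \<open>bodd\<close> is the
  parity of a basis element, and \<open>d e\<^sub>b\<close> is the sum over \<open>a\<close> of \<open>mat a b\<close> times \<open>e\<^sub>a\<close>.\<close>

record ('p, 'b) mfact =
  basis :: "'b set"
  bodd :: "'b \<Rightarrow> bool"
  mat :: "'b \<Rightarrow> 'b \<Rightarrow> 'p"

definition matrix_factorisation ::
    "'k::comm_ring_1 pol ring \<Rightarrow> 'k pol \<Rightarrow> ('k pol, 'b) mfact \<Rightarrow> bool" where
  "matrix_factorisation R w Q \<longleftrightarrow>
     finite (basis Q) \<and>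
     (\<forall>a\<in>basis Q. \<forall>b\<in>basis Q. mat Q a b \<in> carrier R) \<and>
     (\<forall>a\<in>basis Q. \<forall>b\<in>basis Q. mat Q a b \<noteq> 0 \<longrightarrow> bodd Q a \<noteq> bodd Q b) \<and>
     (\<forall>a\<in>basis Q. \<forall>b\<in>basis Q. (\<Sum>c\<in>basis Q. mat Q a c * mat Q c b) = (if a = b then w else 0))"


section \<open>Graded modules with an odd operator, and homotopy\<close>

text \<open>\<open>hpart N s\<close> is the homogeneous part of even (\<open>s = False\<close>) or odd (\<open>s = True\<close>) degree.\<close>

record ('r, 'e) gmodule = "('r, 'e) module" +
  hpart :: "bool \<Rightarrow> 'e set"
  dif :: "'e \<Rightarrow> 'e"

definition graded_linear ::
    "'r ring \<Rightarrow> ('r, 'e) gmodule \<Rightarrow> ('r, 'f) gmodule \<Rightarrow> bool \<Rightarrow> ('e \<Rightarrow> 'f) \<Rightarrow> bool" where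
  "graded_linear R M N s f \<longleftrightarrow>
     f \<in> carrier M \<rightarrow> carrier N \<and>
     (\<forall>v\<in>carrier M. \<forall>w\<in>carrier M. f (v \<oplus>\<^bsub>M\<^esub> w) = f v \<oplus>\<^bsub>N\<^esub> f w) \<and>
     (\<forall>r\<in>carrier R. \<forall>v\<in>carrier M. f (r \<odot>\<^bsub>M\<^esub> v) = r \<odot>\<^bsub>N\<^esub> f v) \<and>
     (\<forall>p. \<forall>v\<in>hpart M p. f v \<in> hpart N (p \<noteq> s))"

text \<open>The graded commutator \<open>[d, f] = d f - (-1)\<^sup>|\<^sup>f\<^sup>| f d\<close> of the differentials with \<open>f\<close> of parity \<open>s\<close>.\<close>

definition dcomm ::
    "('r, 'e) gmodule \<Rightarrow> ('r, 'f) gmodule \<Rightarrow> bool \<Rightarrow> ('e \<Rightarrow> 'f) \<Rightarrow> 'e \<Rightarrow> 'f" where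
  "dcomm M N s f v = (if s then dif N (f v) \<oplus>\<^bsub>N\<^esub> f (dif M v) else dif N (f v) \<ominus>\<^bsub>N\<^esub> f (dif M v))"

definition closed_linear ::
    "'r ring \<Rightarrow> ('r, 'e) gmodule \<Rightarrow> ('r, 'f) gmodule \<Rightarrow> bool \<Rightarrow> ('e \<Rightarrow> 'f) \<Rightarrow> bool" where
  "closed_linear R M N s f \<longleftrightarrow>
     graded_linear R M N s f \<and> (\<forall>v\<in>carrier M. dcomm M N s f v = \<zero>\<^bsub>N\<^esub>)"

definition homotopic ::
    "'r ring \<Rightarrow> ('r, 'e) gmodule \<Rightarrow> ('r, 'f) gmodule \<Rightarrow> bool \<Rightarrow> ('e \<Rightarrow> 'f) \<Rightarrow> ('e \<Rightarrow> 'f) \<Rightarrow> bool"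
  where
  "homotopic R M N s f g \<longleftrightarrow>
     closed_linear R M N s f \<and> closed_linear R M N s g \<and>
     (\<exists>h. graded_linear R M N (\<not> s) h \<and>
        (\<forall>v\<in>carrier M. f v \<ominus>\<^bsub>N\<^esub> g v = dcomm M N (\<not> s) h v))"


section \<open>The modules \<open>Y \<otimes> M \<otimes> X\<close> over \<open>k[x,z]\<close>\<close>

text \<open>Let \<open>M\<close> be a \<open>k[y]\<close>-module. In the chosen homogeneous bases, \<open>Y\<close> is free over \<open>k[y]\<close> on the
  elements \<open>z\<^sup>\<beta> e\<^sub>a\<close> and \<open>X\<close> is free over \<open>k[y]\<close> on the elements \<open>x\<^sup>\<alpha> e\<^sub>b\<close>. Hence an element of
  \<open>Y \<otimes>\<^bsub>k[y]\<^esub> M \<otimes>\<^bsub>k[y]\<^esub> X\<close> is a finitely supported family of elements of \<open>M\<close>, indexed by pairs \<open>(a,b)\<close>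
  of basis elements and monomials \<open>\<mu>\<close> in the variables \<open>x\<close> and \<open>z\<close>. Taking \<open>M\<close> to be \<open>k[y]\<close>, its completion
  and \<open>J\<^sub>V\<close> gives \<open>Y \<otimes> X\<close>, its completed version, and \<open>Y | X\<close> respectively. A monomial in all
  variables is split into its part in \<open>y\<close> and its part in \<open>x\<close> and \<open>z\<close>.\<close>

definition ypart :: "mono \<Rightarrow> mono" where
  "ypart \<mu> = (\<Sum>v\<in>Poly_Mapping.keys \<mu> \<inter> range VY. Poly_Mapping.single v (Poly_Mapping.lookup \<mu> v))"

definition xzpart :: "mono \<Rightarrow> mono" where
  "xzpart \<mu> = (\<Sum>v\<in>Poly_Mapping.keys \<mu> - range VY. Poly_Mapping.single v (Poly_Mapping.lookup \<mu> v))"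

definition pol_act :: "('k::comm_ring_1 pol, 'e) module \<Rightarrow> 'k pol \<Rightarrow> (mono \<Rightarrow> 'e) \<Rightarrow> mono \<Rightarrow> 'e" where
  "pol_act M p f \<mu> = (\<Oplus>\<^bsub>M\<^esub>\<kappa>\<in>{\<kappa>\<in>Poly_Mapping.keys p. \<exists>\<nu>. \<mu> = xzpart \<kappa> + \<nu>}.
     Poly_Mapping.single (ypart \<kappa>) (Poly_Mapping.lookup p \<kappa>) \<odot>\<^bsub>M\<^esub> f (\<mu> - xzpart \<kappa>))"

text \<open>For an odd matrix \<open>A\<close> the operators \<open>A \<otimes> 1\<close> and \<open>1 \<otimes> A\<close>; the latter acquires the Koszul sign
  from passing the basis element of \<open>Y\<close>.\<close>

definition left_act :: "('k::comm_ring_1 pol, 'e) module \<Rightarrow> ('k pol, 'a) mfact \<Rightarrow> ('k pol, 'b) mfact \<Rightarrow>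
    ('a \<Rightarrow> 'a \<Rightarrow> 'k pol) \<Rightarrow> ('a \<times> 'b \<Rightarrow> mono \<Rightarrow> 'e) \<Rightarrow> 'a \<times> 'b \<Rightarrow> mono \<Rightarrow> 'e" where
  "left_act M Y X A v = (\<lambda>(a, b) \<mu>. if a \<in> basis Y \<and> b \<in> basis X
     then (\<Oplus>\<^bsub>M\<^esub>c\<in>basis Y. pol_act M (A a c) (v (c, b)) \<mu>) else \<zero>\<^bsub>M\<^esub>)"

definition right_act :: "('k::comm_ring_1 pol, 'e) module \<Rightarrow> ('k pol, 'a) mfact \<Rightarrow> ('k pol, 'b) mfact \<Rightarrow>
    ('b \<Rightarrow> 'b \<Rightarrow> 'k pol) \<Rightarrow> ('a \<times> 'b \<Rightarrow> mono \<Rightarrow> 'e) \<Rightarrow> 'a \<times> 'b \<Rightarrow> mono \<Rightarrow> 'e" where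
  "right_act M Y X A v = (\<lambda>(a, b) \<mu>. if a \<in> basis Y \<and> b \<in> basis X
     then (\<Oplus>\<^bsub>M\<^esub>c\<in>basis X. pol_act M (sgn_pol (bodd Y a) * A b c) (v (a, c)) \<mu>) else \<zero>\<^bsub>M\<^esub>)"

definition xz_vars :: "nat \<Rightarrow> nat \<Rightarrow> var set" where
  "xz_vars n l = VX ` {..<n} \<union> VZ ` {..<l}"

definition tensor_carrier :: "nat \<Rightarrow> nat \<Rightarrow> ('k::comm_ring_1 pol, 'e) module \<Rightarrow>
    ('k pol, 'a) mfact \<Rightarrow> ('k pol, 'b) mfact \<Rightarrow> ('a \<times> 'b \<Rightarrow> mono \<Rightarrow> 'e) set" where
  "tensor_carrier n l M Y X = {v. (\<forall>e \<mu>. v e \<mu> \<in> carrier M) \<and>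
     (\<forall>e \<mu>. v e \<mu> \<noteq> \<zero>\<^bsub>M\<^esub> \<longrightarrow> e \<in> basis Y \<times> basis X \<and> Poly_Mapping.keys \<mu> \<subseteq> xz_vars n l) \<and>
     finite {(e, \<mu>). v e \<mu> \<noteq> \<zero>\<^bsub>M\<^esub>}}"

definition tensor :: "nat \<Rightarrow> nat \<Rightarrow> ('k::comm_ring_1 pol, 'e) module \<Rightarrow>
    ('k pol, 'a) mfact \<Rightarrow> ('k pol, 'b) mfact \<Rightarrow> ('k pol, 'a \<times> 'b \<Rightarrow> mono \<Rightarrow> 'e) gmodule" where
  "tensor n l M Y X =
     \<lparr>carrier = tensor_carrier n l M Y X,
      monoid.mult = undefined, one = undefined,
      ring.zero = (\<lambda>e \<mu>. \<zero>\<^bsub>M\<^esub>),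
      add = (\<lambda>v w e \<mu>. v e \<mu> \<oplus>\<^bsub>M\<^esub> w e \<mu>),
      smult = (\<lambda>p v e. pol_act M p (v e)),
      hpart = (\<lambda>s. {v\<in>tensor_carrier n l M Y X.
        \<forall>a b \<mu>. v (a, b) \<mu> \<noteq> \<zero>\<^bsub>M\<^esub> \<longrightarrow> (bodd Y a \<noteq> bodd X b) = s}),
      dif = (\<lambda>v e \<mu>. left_act M Y X (mat Y) v e \<mu> \<oplus>\<^bsub>M\<^esub> right_act M Y X (mat X) v e \<mu>)\<rparr>"

text \<open>The operator \<open>\<lambda>\<^sub>i = 1 \<otimes> \<partial>\<^bsub>y\<^sub>i\<^esub>(d\<^sub>X)\<close>.\<close>

definition lam :: "('k::comm_ring_1 pol, 'e) module \<Rightarrow> ('k pol, 'a) mfact \<Rightarrow> ('k pol, 'b) mfact \<Rightarrow> nat \<Rightarrow>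
    ('a \<times> 'b \<Rightarrow> mono \<Rightarrow> 'e) \<Rightarrow> 'a \<times> 'b \<Rightarrow> mono \<Rightarrow> 'e" where
  "lam M Y X i = right_act M Y X (\<lambda>b c. pdiff (VY i) (mat X b c))"

text \<open>The map \<open>1 \<otimes> f \<otimes> 1\<close>; for \<open>f\<close> merely additive this depends on the chosen bases.\<close>

definition coeffwise :: "('e \<Rightarrow> 'f) \<Rightarrow> ('a \<times> 'b \<Rightarrow> mono \<Rightarrow> 'e) \<Rightarrow> 'a \<times> 'b \<Rightarrow> mono \<Rightarrow> 'f" where
  "coeffwise f v = (\<lambda>e \<mu>. f (v e \<mu>))"

text \<open>For \<open>f\<close> odd, the operator \<open>1 \<otimes> f\<close> on \<open>S\<^sub>m \<otimes>\<^sub>k N\<close>.\<close>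

definition ext_odd :: "('k::comm_ring_1 pol, 'e, 'z) module_scheme \<Rightarrow> ('e \<Rightarrow> 'e) \<Rightarrow>
    (nat set \<Rightarrow> 'e) \<Rightarrow> nat set \<Rightarrow> 'e" where
  "ext_odd N f w A = sgn_pol (odd (card A)) \<odot>\<^bsub>N\<^esub> f (w A)"

definition ext_carrier :: "nat \<Rightarrow> ('k::comm_ring_1 pol, 'e, 'z) module_scheme \<Rightarrow>
    (nat set \<Rightarrow> 'e) set" where
  "ext_carrier m N = {w. (\<forall>A. w A \<in> carrier N) \<and> (\<forall>A. \<not> A \<subseteq> {..<m} \<longrightarrow> w A = \<zero>\<^bsub>N\<^esub>)}"

definition ext_tensor ::
    "nat \<Rightarrow> ('k::comm_ring_1 pol, 'e) gmodule \<Rightarrow> ('k pol, nat set \<Rightarrow> 'e) gmodule" where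
  "ext_tensor m N =
     \<lparr>carrier = ext_carrier m N,
      monoid.mult = undefined, one = undefined,
      ring.zero = (\<lambda>A. \<zero>\<^bsub>N\<^esub>),
      add = (\<lambda>v w A. v A \<oplus>\<^bsub>N\<^esub> w A),
      smult = (\<lambda>p w A. p \<odot>\<^bsub>N\<^esub> w A),
      hpart = (\<lambda>s. {w\<in>ext_carrier m N. \<forall>A\<subseteq>{..<m}. w A \<in> hpart N (odd (card A) \<noteq> s)}),
      dif = ext_odd N (dif N)\<rparr>"


section \<open>The connection and the Clifford operators\<close>

abbreviation ky :: "nat \<Rightarrow> 'k::comm_ring_1 pol ring" where
  "ky m \<equiv> poly_ring (VY ` {..<m})"

abbreviation ky_module :: "nat \<Rightarrow> ('k::comm_ring_1 pol, 'k pol) module" where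
  "ky_module m \<equiv> self_module (ky m)"

abbreviation ky_hat :: "nat \<Rightarrow> 'k::comm_ring_1 pol \<Rightarrow> ('k pol, nat \<Rightarrow> 'k pol set) module" where
  "ky_hat m V \<equiv> completion (ky m) (jacobi_ideal VY m V)"

abbreviation JV :: "nat \<Rightarrow> 'k::comm_ring_1 pol \<Rightarrow> ('k pol, 'k pol set) module" where
  "JV m V \<equiv> jacobi_ring VY m V"

abbreviation tensor_YX :: "nat \<Rightarrow> nat \<Rightarrow> nat \<Rightarrow> ('k::comm_ring_1 pol, 'a) mfact \<Rightarrow> ('k pol, 'b) mfact \<Rightarrow>
    ('k pol, 'a \<times> 'b \<Rightarrow> mono \<Rightarrow> 'k pol) gmodule" where
  "tensor_YX n m l Y X \<equiv> tensor n l (ky_module m) Y X"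

abbreviation cut_module :: "nat \<Rightarrow> nat \<Rightarrow> nat \<Rightarrow> 'k::comm_ring_1 pol \<Rightarrow> ('k pol, 'a) mfact \<Rightarrow> ('k pol, 'b) mfact \<Rightarrow>
    ('k pol, 'a \<times> 'b \<Rightarrow> mono \<Rightarrow> 'k pol set) gmodule" where
  "cut_module n m l V Y X \<equiv> tensor n l (JV m V) Y X"

definition linear_section ::
    "nat \<Rightarrow> 'k::comm_ring_1 pol \<Rightarrow> ('k pol set \<Rightarrow> nat \<Rightarrow> 'k pol set) \<Rightarrow> bool" where
  "linear_section m V \<sigma> \<longleftrightarrow>
     \<sigma> \<in> carrier (JV m V) \<rightarrow> carrier (ky_hat m V) \<and>
     (\<forall>q\<in>carrier (JV m V). \<forall>r\<in>carrier (JV m V).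
        \<sigma> (q \<oplus>\<^bsub>JV m V\<^esub> r) = \<sigma> q \<oplus>\<^bsub>ky_hat m V\<^esub> \<sigma> r) \<and>
     (\<forall>c. \<forall>q\<in>carrier (JV m V). \<sigma> (const c \<odot>\<^bsub>JV m V\<^esub> q) = const c \<odot>\<^bsub>ky_hat m V\<^esub> \<sigma> q) \<and>
     (\<forall>q\<in>carrier (JV m V). from_completion (\<sigma> q) = q)"

text \<open>Convergence of a series indexed by multi-indices \<open>u\<close>, summed by total degree, in the
  inverse limit topology.\<close>

definition series_sums ::
    "nat \<Rightarrow> 'k::comm_ring_1 pol \<Rightarrow> ((nat \<Rightarrow> nat) \<Rightarrow> nat \<Rightarrow> 'k pol set) \<Rightarrow> (nat \<Rightarrow> 'k pol set) \<Rightarrow> bool"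
  where
  "series_sums m V a h \<longleftrightarrow> h \<in> carrier (ky_hat m V) \<and>
     (\<forall>n. \<forall>\<^sub>F N in sequentially.
        (\<Oplus>\<^bsub>ky_hat m V\<^esub>u\<in>{u\<in>multi_indices m. (\<Sum>i<m. u i) < N}. a u) n = h n)"

definition tmon :: "nat \<Rightarrow> 'k::comm_ring_1 pol \<Rightarrow> (nat \<Rightarrow> nat) \<Rightarrow> 'k pol" where
  "tmon m V = tpow m (\<lambda>i. pdiff (VY i) V)"

text \<open>If \<open>h\<close> is the sum of the \<open>\<sigma>(r\<^sub>u) t\<^sup>u\<close>, then \<open>\<partial>\<^bsub>t\<^sub>i\<^esub> h\<close> is the sum of the \<open>u\<^sub>i \<sigma>(r\<^sub>u) t\<^bsup>u-\<epsilon>\<^sub>i\<^esup>\<close>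
  (the truncated subtraction is harmless, as the coefficient vanishes for \<open>u\<^sub>i = 0\<close>).\<close>

definition conn :: "nat \<Rightarrow> 'k::comm_ring_1 pol \<Rightarrow> ('k pol set \<Rightarrow> nat \<Rightarrow> 'k pol set) \<Rightarrow> nat \<Rightarrow>
    (nat \<Rightarrow> 'k pol set) \<Rightarrow> nat \<Rightarrow> 'k pol set" where
  "conn m V \<sigma> i h = (THE g. \<exists>r. (\<forall>u. r u \<in> carrier (JV m V)) \<and>
     series_sums m V (\<lambda>u. tmon m V u \<odot>\<^bsub>ky_hat m V\<^esub> \<sigma> (r u)) h \<and>
     series_sums m V (\<lambda>u. (of_nat (u i) * tmon m V (u(i := u i - 1))) \<odot>\<^bsub>ky_hat m V\<^esub> \<sigma> (r u)) g)"

text \<open>The operator induced on \<open>Y | X\<close> by the commutator of \<open>d\<close> with \<open>\<partial>\<^bsub>t\<^sub>i\<^esub>\<close>: apply the latter to any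
  preimage in the completed tensor product and project.\<close>

definition atiyah :: "nat \<Rightarrow> nat \<Rightarrow> nat \<Rightarrow> 'k::comm_ring_1 pol \<Rightarrow>
    ('k pol, 'a) mfact \<Rightarrow> ('k pol, 'b) mfact \<Rightarrow> ('k pol set \<Rightarrow> nat \<Rightarrow> 'k pol set) \<Rightarrow> nat \<Rightarrow>
    ('a \<times> 'b \<Rightarrow> mono \<Rightarrow> 'k pol set) \<Rightarrow> 'a \<times> 'b \<Rightarrow> mono \<Rightarrow> 'k pol set" where
  "atiyah n m l V Y X \<sigma> i q =
     (let T = tensor n l (ky_hat m V) Y X in
      THE r. \<exists>v\<in>carrier T. coeffwise from_completion v = q \<and>
        r = coeffwise from_completion (dcomm T T False (coeffwise (conn m V \<sigma> i)) v))"

definition gam :: "nat \<Rightarrow> nat \<Rightarrow> nat \<Rightarrow> 'k::comm_ring_1 pol \<Rightarrow>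
    ('k pol, 'a) mfact \<Rightarrow> ('k pol, 'b) mfact \<Rightarrow> ('k pol set \<Rightarrow> nat \<Rightarrow> 'k pol set) \<Rightarrow> nat \<Rightarrow>
    ('a \<times> 'b \<Rightarrow> mono \<Rightarrow> 'k pol set) \<Rightarrow> 'a \<times> 'b \<Rightarrow> mono \<Rightarrow> 'k pol set" where
  "gam n m l V Y X \<sigma> i = atiyah n m l V Y X \<sigma> i"

definition gam_dag :: "(rat \<Rightarrow> 'k::comm_ring_1) \<Rightarrow> nat \<Rightarrow> nat \<Rightarrow> nat \<Rightarrow> 'k pol \<Rightarrow>
    ('k pol, 'a) mfact \<Rightarrow> ('k pol, 'b) mfact \<Rightarrow> ('k pol set \<Rightarrow> nat \<Rightarrow> 'k pol set) \<Rightarrow> nat \<Rightarrow>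
    ('a \<times> 'b \<Rightarrow> mono \<Rightarrow> 'k pol set) \<Rightarrow> 'a \<times> 'b \<Rightarrow> mono \<Rightarrow> 'k pol set" where
  "gam_dag \<iota> n m l V Y X \<sigma> i w =
     (let N = tensor n l (JV m V) Y X in
      \<ominus>\<^bsub>N\<^esub> lam (JV m V) Y X i w \<ominus>\<^bsub>N\<^esub>
      const (\<iota> (1 / 2)) \<odot>\<^bsub>N\<^esub>
        (\<Oplus>\<^bsub>N\<^esub>q\<in>{..<m}. pdiff (VY q) (pdiff (VY i) V) \<odot>\<^bsub>N\<^esub> atiyah n m l V Y X \<sigma> q w))"


section \<open>The map \<open>\<Phi>\<close>\<close>

definition delta :: "nat \<Rightarrow> nat \<Rightarrow> nat \<Rightarrow> 'k::comm_ring_1 pol \<Rightarrow> ('k pol, 'a) mfact \<Rightarrow> ('k pol, 'b) mfact \<Rightarrow>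
    (nat set \<Rightarrow> 'a \<times> 'b \<Rightarrow> mono \<Rightarrow> nat \<Rightarrow> 'k pol set) \<Rightarrow>
    nat set \<Rightarrow> 'a \<times> 'b \<Rightarrow> mono \<Rightarrow> nat \<Rightarrow> 'k pol set" where
  "delta n m l V Y X w =
     (let N = tensor n l (ky_hat m V) Y X in
      \<Oplus>\<^bsub>ext_tensor m N\<^esub>i\<in>{..<m}. ext_odd N (lam (ky_hat m V) Y X i) (contract N i w))"

text \<open>As \<open>\<delta>\<close> lowers the \<open>\<theta>\<close>-degree by one, \<open>\<delta>\<^sup>j = 0\<close> for \<open>j > m\<close>, so the exponential series stops there.\<close>

definition exp_minus_delta :: "(rat \<Rightarrow> 'k::comm_ring_1) \<Rightarrow> nat \<Rightarrow> nat \<Rightarrow> nat \<Rightarrow> 'k pol \<Rightarrow>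
    ('k pol, 'a) mfact \<Rightarrow> ('k pol, 'b) mfact \<Rightarrow>
    (nat set \<Rightarrow> 'a \<times> 'b \<Rightarrow> mono \<Rightarrow> nat \<Rightarrow> 'k pol set) \<Rightarrow>
    nat set \<Rightarrow> 'a \<times> 'b \<Rightarrow> mono \<Rightarrow> nat \<Rightarrow> 'k pol set" where
  "exp_minus_delta \<iota> n m l V Y X w =
     (let E = ext_tensor m (tensor n l (ky_hat m V) Y X) in
      \<Oplus>\<^bsub>E\<^esub>j\<in>{..m}. const (\<iota> ((- 1) ^ j / fact j)) \<odot>\<^bsub>E\<^esub> (delta n m l V Y X ^^ j) w)"

definition epsilon :: "nat \<Rightarrow> 'k::comm_ring_1 pol \<Rightarrow> (nat set \<Rightarrow> 'a \<times> 'b \<Rightarrow> mono \<Rightarrow> 'k pol) \<Rightarrow>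
    nat set \<Rightarrow> 'a \<times> 'b \<Rightarrow> mono \<Rightarrow> nat \<Rightarrow> 'k pol set" where
  "epsilon m V w A = coeffwise (to_completion (ky m) (jacobi_ideal VY m V)) (w A)"

definition proj :: "(nat set \<Rightarrow> 'a \<times> 'b \<Rightarrow> mono \<Rightarrow> nat \<Rightarrow> 'k pol set) \<Rightarrow>
    'a \<times> 'b \<Rightarrow> mono \<Rightarrow> 'k pol set" where
  "proj w = coeffwise from_completion (w {})"

definition Phi :: "(rat \<Rightarrow> 'k::comm_ring_1) \<Rightarrow> nat \<Rightarrow> nat \<Rightarrow> nat \<Rightarrow> 'k pol \<Rightarrow>
    ('k pol, 'a) mfact \<Rightarrow> ('k pol, 'b) mfact \<Rightarrow>
    (nat set \<Rightarrow> 'a \<times> 'b \<Rightarrow> mono \<Rightarrow> 'k pol) \<Rightarrow> 'a \<times> 'b \<Rightarrow> mono \<Rightarrow> 'k pol set" where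
  "Phi \<iota> n m l V Y X = proj \<circ> exp_minus_delta \<iota> n m l V Y X \<circ> epsilon m V"

end

theory Submission
  imports Defs "HOL-Library.Function_Algebras"
begin

text \<open>Every operator in sight is lifted to \<open>Y \<otimes> X\<close>, where it is a matrix of polynomials or the coefficientwise
  derivative along \<open>t\<^sub>i\<close>, and is compared modulo \<open>t = (t\<^sub>1, \<dots>, t\<^sub>m)\<close>. Let \<open>\<phi> w\<close> be the part of \<open>\<theta>\<close>-degree zero
  of \<open>exp(-\<delta>) w\<close>, a lift of \<open>\<Phi> w\<close>. Since \<open>[d, \<delta>] = \<Sum>\<^sub>j t\<^sub>j \<theta>\<^sub>j\<^sup>*\<close>, one has \<open>\<phi> d = d \<phi> + \<Sum>\<^sub>j t\<^sub>j \<phi> \<theta>\<^sub>j\<^sup>*\<close>; applying the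
  derivative along \<open>t\<^sub>i\<close> and reducing modulo \<open>t\<close> shows that this derivative, composed with \<open>\<phi>\<close>, is a homotopy
  \<open>At\<^sub>i \<Phi> \<simeq> \<Phi> \<theta>\<^sub>i\<^sup>*\<close>. For \<open>\<gamma>\<^sub>i\<^sup>\<dagger>\<close>, differentiating \<open>d\<^sub>X\<^sup>2 = V - W\<close> twice shows that \<open>[\<lambda>\<^sub>i, \<lambda>\<^sub>j]\<close> is homotopic to
  \<open>\<partial>\<^sub>i\<partial>\<^sub>j V\<close>. With \<open>[\<delta>, \<theta>\<^sub>i] = \<lambda>\<^sub>i\<close> it follows that \<open>exp(-\<delta>) \<theta>\<^sub>i\<close> is homotopic modulo \<open>t\<close> to
  \<open>(\<theta>\<^sub>i - \<lambda>\<^sub>i - 1/2 \<Sum>\<^sub>j \<partial>\<^sub>i\<partial>\<^sub>j V \<theta>\<^sub>j\<^sup>*) exp(-\<delta>)\<close>. Taking \<open>\<theta>\<close>-degree zero and replacing \<open>\<Phi> \<theta>\<^sub>j\<^sup>*\<close> by \<open>At\<^sub>j \<Phi>\<close>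
  gives \<open>\<Phi> \<theta>\<^sub>i \<simeq> \<gamma>\<^sub>i\<^sup>\<dagger> \<Phi>\<close>.\<close>

section \<open>Polynomials\<close>

text \<open>The derivative along \<open>t\<^sub>i\<close> lives on power series and, since the
  section is only k-linear, is not k[y]-linear. What saves the comparison is that, reduced modulo
  the Jacobi ideal I, the derivative of h depends only on h modulo I^2. Polynomial representatives
  therefore suffice; but chosen representatives need not add up, so linearity and commutation of the
  lifted operators are congruences modulo the kernel of the quotient map. The factor 1/2 comes from
  the exponential: moving \<open>\<theta>\<^sub>i\<close> past j copies of \<delta> puts the
  binomial coefficient (j choose 2) in front of the Hessian, and c(j+2) (j+2 choose 2) = c(j)/2 for
  c(j) = (-1)^j/j!. As the anticommutators of the operators \<lambda> are Hessian entries only up to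
  homotopy, that homotopy must be carried through all powers of \<delta>; whenever d passes a
  \<delta>, a Koszul term appears, which vanishes modulo t. Closedness of the left-hand sides comes
  for free: G + [d,H] with G closed is closed, because d^2 is multiplication by U - W, an element of
  k[x,z].\<close>

lemma poly_mapping_sum_singles:
  fixes p :: "'a \<Rightarrow>\<^sub>0 'b::comm_monoid_add"
  assumes "finite S" and "Poly_Mapping.keys p \<subseteq> S"
  shows "(\<Sum>\<kappa>\<in>S. Poly_Mapping.single \<kappa> (Poly_Mapping.lookup p \<kappa>)) = p"
proof (rule poly_mapping_eqI)
  fix x
  show "Poly_Mapping.lookup (\<Sum>\<kappa>\<in>S. Poly_Mapping.single \<kappa> (Poly_Mapping.lookup p \<kappa>)) x
      = Poly_Mapping.lookup p x"
    using assms by (auto simp: lookup_sum lookup_single when_def sum.delta in_keys_iff)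
qed

lemma poly_mapping_additive_induct [case_names zero single add]:
  fixes p :: "'a \<Rightarrow>\<^sub>0 'b::comm_monoid_add"
  assumes "P 0" and "\<And>\<kappa> c. P (Poly_Mapping.single \<kappa> c)"
    and "\<And>p q. P p \<Longrightarrow> P q \<Longrightarrow> P (p + q)"
  shows "P p"
proof -
  have "P (\<Sum>\<kappa>\<in>S. Poly_Mapping.single \<kappa> (Poly_Mapping.lookup p \<kappa>))" if "finite S" for S
    using that by induction (auto intro: assms)
  from this[OF finite_keys, of p] show ?thesis
    by (simp add: poly_mapping_sum_singles)
qed

section \<open>Partial derivatives of polynomials\<close>

lemma pdiff_eq_sum:
  assumes "finite S" and "Poly_Mapping.keys f \<subseteq> S"
  shows "pdiff v f = (\<Sum>\<mu>\<in>S. Poly_Mapping.single (\<mu> - Poly_Mapping.single v 1)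
       (of_nat (Poly_Mapping.lookup \<mu> v) * Poly_Mapping.lookup f \<mu>))"
  unfolding pdiff_def using assms
  by (intro sum.mono_neutral_left) (auto simp: in_keys_iff)

lemma pdiff_add: "pdiff v (f + g) = pdiff v f + pdiff v g"
proof -
  let ?S = "Poly_Mapping.keys f \<union> Poly_Mapping.keys g"
  have "Poly_Mapping.keys (f + g) \<subseteq> ?S" by (rule keys_add)
  then show ?thesis
    by (simp add: pdiff_eq_sum[of ?S] lookup_add distrib_left single_add sum.distrib)
qed

lemma pdiff_zero [simp]: "pdiff v 0 = 0"
  by (simp add: pdiff_def)

lemma pdiff_uminus: "pdiff v (- f) = - pdiff v f"
  using pdiff_add[of v f "- f"] by (simp add: eq_neg_iff_add_eq_0 add.commute)

lemma pdiff_diff: "pdiff v (f - g) = pdiff v f - pdiff v g"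
  using pdiff_add[of v f "- g"] by (simp add: pdiff_uminus)

lemma pdiff_sum: "pdiff v (\<Sum>i\<in>S. f i) = (\<Sum>i\<in>S. pdiff v (f i))"
  by (induction S rule: infinite_finite_induct) (auto simp: pdiff_add)

lemma pdiff_single: "pdiff v (Poly_Mapping.single \<mu> c)
    = Poly_Mapping.single (\<mu> - Poly_Mapping.single v 1) (of_nat (Poly_Mapping.lookup \<mu> v) * c)"
  by (cases "c = 0") (simp_all add: pdiff_def)

lemma pdiff_single_mult:
  "pdiff v (Poly_Mapping.single \<mu> c * Poly_Mapping.single \<nu> e)
   = pdiff v (Poly_Mapping.single \<mu> c) * Poly_Mapping.single \<nu> e
     + Poly_Mapping.single \<mu> c * pdiff v (Poly_Mapping.single \<nu> e)"
proof -
  \<comment> \<open>Subtraction of exponents is truncated, so the shift needs a positive exponent of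
    \<open>v\<close>; otherwise the coefficient \<open>of_nat 0\<close> kills the term.\<close>
  have shift: "\<mu> - Poly_Mapping.single v 1 + \<nu> = \<mu> + \<nu> - Poly_Mapping.single v 1"
    if "Poly_Mapping.lookup \<mu> v \<noteq> 0" for \<mu> \<nu> :: mono
    using that by (intro poly_mapping_eqI) (auto simp: lookup_add lookup_minus lookup_single when_def)
  show ?thesis
    using shift[of \<mu> \<nu>] shift[of \<nu> \<mu>]
    by (cases "Poly_Mapping.lookup \<mu> v = 0"; cases "Poly_Mapping.lookup \<nu> v = 0")
       (simp_all add: pdiff_single mult_single lookup_add algebra_simps flip: single_add)
qed

lemma pdiff_mult: "pdiff v (f * g) = pdiff v f * g + f * pdiff v g"
proof (induction f rule: poly_mapping_additive_induct)
  case (single \<kappa> c)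
  show ?case
    by (induction g rule: poly_mapping_additive_induct)
       (simp_all add: pdiff_single_mult distrib_left distrib_right pdiff_add)
qed (simp_all add: distrib_right pdiff_add)

section \<open>The subrings of polynomials in a given set of variables\<close>

lemma in_poly_ring: "f \<in> carrier (poly_ring A) \<longleftrightarrow>
    (\<forall>\<mu>. Poly_Mapping.lookup f \<mu> \<noteq> 0 \<longrightarrow> Poly_Mapping.keys \<mu> \<subseteq> A)"
  by (auto simp: poly_ring_def in_keys_iff)

lemma poly_ring_simps [simp]:
  "(\<otimes>\<^bsub>poly_ring A\<^esub>) = (*)" "\<one>\<^bsub>poly_ring A\<^esub> = 1" "\<zero>\<^bsub>poly_ring A\<^esub> = 0" "(\<oplus>\<^bsub>poly_ring A\<^esub>) = (+)"
  by (simp_all add: poly_ring_def)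

lemma poly_ring_add: "f \<in> carrier (poly_ring A) \<Longrightarrow> g \<in> carrier (poly_ring A) \<Longrightarrow> f + g \<in> carrier (poly_ring A)"
  using keys_add[of f g] by (auto simp: poly_ring_def)

lemma poly_ring_zero: "0 \<in> carrier (poly_ring A)"
  by (simp add: poly_ring_def)

lemma poly_ring_uminus: "f \<in> carrier (poly_ring A) \<Longrightarrow> - f \<in> carrier (poly_ring A)"
  by (simp add: in_poly_ring)

lemma poly_ring_diff: "f \<in> carrier (poly_ring A) \<Longrightarrow> g \<in> carrier (poly_ring A) \<Longrightarrow> f - g \<in> carrier (poly_ring A)"
  using poly_ring_add[of f A "- g"] poly_ring_uminus[of g A] by simp

lemma poly_ring_mult: "f \<in> carrier (poly_ring A) \<Longrightarrow> g \<in> carrier (poly_ring A) \<Longrightarrow> f * g \<in> carrier (poly_ring A)"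
proof -
  assume fg: "f \<in> carrier (poly_ring A)" "g \<in> carrier (poly_ring A)"
  have "Poly_Mapping.keys \<mu> \<subseteq> A" if "\<mu> \<in> Poly_Mapping.keys (f * g)" for \<mu>
  proof -
    from that obtain a b where ab: "a \<in> Poly_Mapping.keys f" "b \<in> Poly_Mapping.keys g" "\<mu> = a + b"
      using keys_mult[of f g] by blast
    with fg have "Poly_Mapping.keys a \<union> Poly_Mapping.keys b \<subseteq> A" by (auto simp: poly_ring_def)
    with keys_add[of a b] ab show ?thesis by blast
  qed
  then show ?thesis by (simp add: poly_ring_def)
qed

lemma poly_ring_sum: "(\<And>i. i \<in> S \<Longrightarrow> f i \<in> carrier (poly_ring A)) \<Longrightarrow> (\<Sum>i\<in>S. f i) \<in> carrier (poly_ring A)"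
  by (induction S rule: infinite_finite_induct) (auto simp: poly_ring_add poly_ring_zero)

lemma poly_ring_single: "Poly_Mapping.keys \<mu> \<subseteq> A \<Longrightarrow> Poly_Mapping.single \<mu> c \<in> carrier (poly_ring A)"
  by (auto simp: poly_ring_def split: if_splits)

lemma poly_ring_one: "1 \<in> carrier (poly_ring A)"
  using poly_ring_single[of 0 A 1] by simp

lemma poly_ring_const: "const c \<in> carrier (poly_ring A)"
  by (simp add: const_def poly_ring_single)

lemma poly_ring_mono: "f \<in> carrier (poly_ring A) \<Longrightarrow> A \<subseteq> B \<Longrightarrow> f \<in> carrier (poly_ring B)"
  by (auto simp: poly_ring_def)

lemma poly_ring_of_nat: "of_nat j \<in> carrier (poly_ring A)"
  by (induction j) (auto simp: poly_ring_add poly_ring_zero poly_ring_one)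

lemma poly_ring_power: "f \<in> carrier (poly_ring A) \<Longrightarrow> f ^ j \<in> carrier (poly_ring A)"
  by (induction j) (auto simp: poly_ring_mult poly_ring_one)

lemma poly_ring_prod: "(\<And>i. i \<in> S \<Longrightarrow> f i \<in> carrier (poly_ring A)) \<Longrightarrow> (\<Prod>i\<in>S. f i) \<in> carrier (poly_ring A)"
  by (induction S rule: infinite_finite_induct) (auto simp: poly_ring_mult poly_ring_one)

lemma poly_ring_sgn_pol: "sgn_pol s \<in> carrier (poly_ring A)"
  by (simp add: sgn_pol_def poly_ring_one poly_ring_uminus)

lemmas poly_ring_intros = poly_ring_add poly_ring_zero poly_ring_uminus poly_ring_diff poly_ring_mult
  poly_ring_sum poly_ring_one poly_ring_const poly_ring_of_nat poly_ring_power poly_ring_prod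
  poly_ring_sgn_pol

lemma poly_ring_pdiff: "f \<in> carrier (poly_ring A) \<Longrightarrow> pdiff v f \<in> carrier (poly_ring A)"
proof -
  assume f: "f \<in> carrier (poly_ring A)"
  have "Poly_Mapping.keys (\<mu> - Poly_Mapping.single v 1) \<subseteq> Poly_Mapping.keys \<mu>" for \<mu> :: mono
    by (auto simp: in_keys_iff lookup_minus)
  with f show ?thesis
    unfolding pdiff_def by (intro poly_ring_sum poly_ring_single) (auto simp: poly_ring_def)
qed

lemma pdiff_eq_zero: "f \<in> carrier (poly_ring A) \<Longrightarrow> v \<notin> A \<Longrightarrow> pdiff v f = 0"
  unfolding pdiff_def
proof (intro sum.neutral ballI)
  fix \<mu> assume f: "f \<in> carrier (poly_ring A)" and v: "v \<notin> A" and \<mu>: "\<mu> \<in> Poly_Mapping.keys f"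
  then have "v \<notin> Poly_Mapping.keys \<mu>" by (auto simp: poly_ring_def)
  then have "Poly_Mapping.lookup \<mu> v = 0" by (simp add: in_keys_iff)
  then show "Poly_Mapping.single (\<mu> - Poly_Mapping.single v 1)
      (of_nat (Poly_Mapping.lookup \<mu> v) * Poly_Mapping.lookup f \<mu>) = 0" by simp
qed

lemma cring_poly_ring: "cring (poly_ring A :: 'a::comm_ring_1 pol ring)"
proof (rule cringI)
  show "abelian_group (poly_ring A :: 'a pol ring)"
  proof (rule abelian_groupI)
    fix x :: "'a pol"
    assume "x \<in> carrier (poly_ring A)"
    then show "\<exists>y\<in>carrier (poly_ring A). y \<oplus>\<^bsub>poly_ring A\<^esub> x = \<zero>\<^bsub>poly_ring A\<^esub>"
      by (intro bexI[of _ "- x"]) (auto intro: poly_ring_uminus)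
  qed (auto simp: poly_ring_intros ac_simps)
  show "Group.comm_monoid (poly_ring A :: 'a pol ring)"
    by (rule comm_monoidI) (auto simp: poly_ring_intros ac_simps)
qed (auto simp: algebra_simps)

lemma poly_ring_a_inv: "f \<in> carrier (poly_ring A) \<Longrightarrow> \<ominus>\<^bsub>poly_ring A\<^esub> f = - f"
proof -
  interpret cring "poly_ring A :: 'a pol ring" by (rule cring_poly_ring)
  assume "f \<in> carrier (poly_ring A)"
  then show ?thesis
    by (intro minus_equality) (auto intro: poly_ring_uminus)
qed

section \<open>The y-part and the xz-part of a monomial\<close>

lemma lookup_ypart: "Poly_Mapping.lookup (ypart \<mu>) v = (if v \<in> range VY then Poly_Mapping.lookup \<mu> v else 0)"
  by (auto simp: ypart_def lookup_sum lookup_single when_def sum.delta in_keys_iff)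

lemma lookup_xzpart: "Poly_Mapping.lookup (xzpart \<mu>) v = (if v \<in> range VY then 0 else Poly_Mapping.lookup \<mu> v)"
  by (auto simp: xzpart_def lookup_sum lookup_single when_def sum.delta in_keys_iff)

lemma ypart_add: "ypart (\<mu> + \<nu>) = ypart \<mu> + ypart \<nu>"
  by (rule poly_mapping_eqI) (simp add: lookup_ypart lookup_add)

lemma xzpart_add: "xzpart (\<mu> + \<nu>) = xzpart \<mu> + xzpart \<nu>"
  by (rule poly_mapping_eqI) (simp add: lookup_xzpart lookup_add)

lemma ypart_zero [simp]: "ypart 0 = 0" and xzpart_zero [simp]: "xzpart 0 = 0"
  by (simp_all add: ypart_def xzpart_def)

lemma keys_ypart: "Poly_Mapping.keys (ypart \<mu>) = Poly_Mapping.keys \<mu> \<inter> range VY"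
  by (auto simp: in_keys_iff lookup_ypart split: if_splits)

lemma keys_xzpart: "Poly_Mapping.keys (xzpart \<mu>) = Poly_Mapping.keys \<mu> - range VY"
  by (auto simp: in_keys_iff lookup_xzpart split: if_splits)

lemma ypart_ident: "Poly_Mapping.keys \<mu> \<subseteq> range VY \<Longrightarrow> ypart \<mu> = \<mu>"
  by (rule poly_mapping_eqI) (auto simp: lookup_ypart in_keys_iff)

lemma xzpart_null: "Poly_Mapping.keys \<mu> \<subseteq> range VY \<Longrightarrow> xzpart \<mu> = 0"
  by (rule poly_mapping_eqI) (auto simp: lookup_xzpart in_keys_iff)

lemma ypart_null: "Poly_Mapping.keys \<mu> \<inter> range VY = {} \<Longrightarrow> ypart \<mu> = 0"
  by (rule poly_mapping_eqI) (auto simp: lookup_ypart in_keys_iff)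

subsection \<open>The action of a polynomial on families indexed by monomials\<close>

lemma sum_fun_apply: "(\<Sum>i\<in>S. f i) x = (\<Sum>i\<in>S. f i x)"
  for f :: "'i \<Rightarrow> 'x \<Rightarrow> 'g::comm_monoid_add"
  by (induction S rule: infinite_finite_induct) auto

definition mono_act :: "mono \<Rightarrow> 'k::comm_ring_1 \<Rightarrow> (mono \<Rightarrow> 'k pol) \<Rightarrow> mono \<Rightarrow> 'k pol" where
  "mono_act \<kappa> c f \<mu> = (if \<exists>\<nu>. \<mu> = xzpart \<kappa> + \<nu>
     then Poly_Mapping.single (ypart \<kappa>) c * f (\<mu> - xzpart \<kappa>) else 0)"

text \<open>The action \<open>pol_act\<close> for the coefficient module k[y], but written with
  ordinary addition and total in both arguments; the module laws then hold without membership
  hypotheses.\<close>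

definition mact :: "'k::comm_ring_1 pol \<Rightarrow> (mono \<Rightarrow> 'k pol) \<Rightarrow> mono \<Rightarrow> 'k pol" where
  "mact p f = (\<Sum>\<kappa>\<in>Poly_Mapping.keys p. mono_act \<kappa> (Poly_Mapping.lookup p \<kappa>) f)"

lemma mono_act_zero [simp]: "mono_act \<kappa> 0 f = 0"
  by (auto simp: mono_act_def)

lemma mono_act_zero_right: "mono_act \<kappa> c 0 = 0"
  by (auto simp: mono_act_def)

lemma mono_act_add_left: "mono_act \<kappa> (c + e) f = mono_act \<kappa> c f + mono_act \<kappa> e f"
  by (rule ext) (simp add: mono_act_def single_add distrib_right)

lemma mono_act_add: "mono_act \<kappa> c (f + g) = mono_act \<kappa> c f + mono_act \<kappa> c g"
  by (rule ext) (simp add: mono_act_def distrib_left)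

text \<open>Divisibility by a product of monomials can be tested one factor after the other, and the
  y-parts multiply as scalars.\<close>

lemma mono_act_mono_act: "mono_act \<kappa> c (mono_act \<kappa>' e f) = mono_act (\<kappa> + \<kappa>') (c * e) f"
proof (rule ext)
  fix \<mu>
  show "mono_act \<kappa> c (mono_act \<kappa>' e f) \<mu> = mono_act (\<kappa> + \<kappa>') (c * e) f \<mu>"
  proof (cases "\<exists>\<nu>. \<mu> = xzpart \<kappa> + \<nu>")
    case True
    then obtain \<nu> where \<nu>: "\<mu> = xzpart \<kappa> + \<nu>" by blast
    have "(\<exists>\<nu>'. \<mu> = xzpart (\<kappa> + \<kappa>') + \<nu>') \<longleftrightarrow> (\<exists>\<nu>'. \<nu> = xzpart \<kappa>' + \<nu>')"
      by (simp add: \<nu> xzpart_add add.assoc)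
    moreover have "\<mu> - xzpart (\<kappa> + \<kappa>') = \<nu> - xzpart \<kappa>'"
      by (rule poly_mapping_eqI) (simp add: \<nu> xzpart_add lookup_add lookup_minus)
    moreover have "\<mu> - xzpart \<kappa> = \<nu>" by (simp add: \<nu>)
    ultimately show ?thesis
      using True by (simp add: mono_act_def ypart_add mult.assoc flip: mult_single)
  next
    case False
    then have "\<nexists>\<nu>. \<mu> = xzpart (\<kappa> + \<kappa>') + \<nu>"
      by (metis xzpart_add add.assoc)
    with False show ?thesis by (simp add: mono_act_def)
  qed
qed

lemma mact_eq_sum:
  assumes "finite S" and "Poly_Mapping.keys p \<subseteq> S"
  shows "mact p f = (\<Sum>\<kappa>\<in>S. mono_act \<kappa> (Poly_Mapping.lookup p \<kappa>) f)"
  unfolding mact_def using assms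
  by (intro sum.mono_neutral_left) (auto simp: in_keys_iff)

lemma mact_add_left: "mact (p + q) f = mact p f + mact q f"
proof -
  let ?S = "Poly_Mapping.keys p \<union> Poly_Mapping.keys q"
  have "Poly_Mapping.keys (p + q) \<subseteq> ?S" by (rule keys_add)
  then show ?thesis
    by (simp add: mact_eq_sum[of ?S] lookup_add mono_act_add_left sum.distrib)
qed

lemma mact_zero_left [simp]: "mact 0 f = 0"
  by (simp add: mact_def)

lemma mact_single: "mact (Poly_Mapping.single \<kappa> c) f = mono_act \<kappa> c f"
  by (cases "c = 0") (simp_all add: mact_def)

lemma mact_add: "mact p (f + g) = mact p f + mact p g"
  by (simp add: mact_def mono_act_add sum.distrib)

lemma mact_zero [simp]: "mact p 0 = 0"
  using mact_add[of p 0 0] by simp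

lemma mact_mact: "mact p (mact q f) = mact (p * q) f"
proof (induction p rule: poly_mapping_additive_induct)
  case (single \<kappa> c)
  show ?case
    by (induction q rule: poly_mapping_additive_induct)
       (simp_all only: mact_single mono_act_mono_act mult_single distrib_left mact_add_left mono_act_add
         mono_act_zero_right mult_zero_right mact_zero_left)
qed (simp_all add: distrib_right mact_add_left)

lemma mact_one [simp]: "mact 1 f = f"
  unfolding single_one[symmetric] mact_single by (rule ext) (simp add: mono_act_def)

lemma mact_uminus_left: "mact (- p) f = - mact p f"
  using mact_add_left[of p "- p" f] by (simp add: eq_neg_iff_add_eq_0 add.commute)

lemma mact_sum_left: "mact (\<Sum>i\<in>S. p i) f = (\<Sum>i\<in>S. mact (p i) f)"
  by (induction S rule: infinite_finite_induct)
    (simp_all only: sum.infinite sum.empty sum.insert mact_zero_left mact_add_left not_False_eq_True)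

lemma mact_sum: "mact p (\<Sum>i\<in>S. f i) = (\<Sum>i\<in>S. mact p (f i))"
  by (induction S rule: infinite_finite_induct)
    (simp_all only: sum.infinite sum.empty sum.insert mact_zero mact_add not_False_eq_True)

lemma mact_commute: "mact p (mact q f) = mact q (mact p f)"
  by (simp add: mact_mact mult.commute)

text \<open>A polynomial in y alone shifts no xz-monomial, so it multiplies each coefficient
  separately. This is how the \<open>t\<^sub>j\<close> act.\<close>

lemma mact_ky:
  assumes "p \<in> carrier (poly_ring (VY ` A))"
  shows "mact p f \<mu> = p * f \<mu>"
proof -
  have "mact p f \<mu> = (\<Sum>\<kappa>\<in>Poly_Mapping.keys p. Poly_Mapping.single \<kappa> (Poly_Mapping.lookup p \<kappa>)) * f \<mu>"
    unfolding mact_def sum_fun_apply sum_distrib_right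
  proof (rule sum.cong)
    fix \<kappa> assume "\<kappa> \<in> Poly_Mapping.keys p"
    with assms have "Poly_Mapping.keys \<kappa> \<subseteq> VY ` A" by (auto simp: poly_ring_def)
    then have "Poly_Mapping.keys \<kappa> \<subseteq> range VY" by blast
    then show "mono_act \<kappa> (Poly_Mapping.lookup p \<kappa>) f \<mu>
        = Poly_Mapping.single \<kappa> (Poly_Mapping.lookup p \<kappa>) * f \<mu>"
      by (simp add: mono_act_def ypart_ident xzpart_null)
  qed simp
  then show ?thesis by (simp add: poly_mapping_sum_singles)
qed

section \<open>Groups determined by evaluation maps\<close>

lemma finsum_hom:
  assumes G: "abelian_monoid G" and H: "abelian_monoid H"
    and \<phi>: "\<And>a. a \<in> carrier G \<Longrightarrow> \<phi> a \<in> carrier H"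
    and add: "\<And>a b. a \<in> carrier G \<Longrightarrow> b \<in> carrier G \<Longrightarrow> \<phi> (a \<oplus>\<^bsub>G\<^esub> b) = \<phi> a \<oplus>\<^bsub>H\<^esub> \<phi> b"
    and zero: "\<phi> \<zero>\<^bsub>G\<^esub> = \<zero>\<^bsub>H\<^esub>"
    and f: "\<And>i. i \<in> S \<Longrightarrow> f i \<in> carrier G"
  shows "\<phi> (\<Oplus>\<^bsub>G\<^esub>i\<in>S. f i) = (\<Oplus>\<^bsub>H\<^esub>i\<in>S. \<phi> (f i))"
proof -
  interpret G: abelian_monoid G by (rule G)
  interpret H: abelian_monoid H by (rule H)
  show ?thesis using f
    by (induction S rule: infinite_finite_induct) (simp_all add: zero add \<phi> Pi_def)
qed

text \<open>Additive, jointly injective evaluations pull back the group laws. This serves the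
  completion (evaluated at levels), the tensor products (at coefficients) and the exterior algebra
  (at \<theta>-components). Negatives enter through an existence statement because
  \<open>a_inv\<close> of \<open>G\<close> has no meaning before \<open>G\<close> is known to be a
  group.\<close>

lemma abelian_group_by_evaluation:
  fixes ev :: "'x \<Rightarrow> 'g \<Rightarrow> 'e"
  assumes M: "\<And>x. abelian_group (M x)"
    and ev: "\<And>x a. a \<in> carrier G \<Longrightarrow> ev x a \<in> carrier (M x)"
    and inj: "\<And>a b. a \<in> carrier G \<Longrightarrow> b \<in> carrier G \<Longrightarrow> (\<And>x. ev x a = ev x b) \<Longrightarrow> a = b"
    and zero: "\<zero>\<^bsub>G\<^esub> \<in> carrier G" "\<And>x. ev x \<zero>\<^bsub>G\<^esub> = \<zero>\<^bsub>M x\<^esub>"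
    and add: "\<And>a b. a \<in> carrier G \<Longrightarrow> b \<in> carrier G \<Longrightarrow> a \<oplus>\<^bsub>G\<^esub> b \<in> carrier G"
      "\<And>x a b. a \<in> carrier G \<Longrightarrow> b \<in> carrier G \<Longrightarrow> ev x (a \<oplus>\<^bsub>G\<^esub> b) = ev x a \<oplus>\<^bsub>M x\<^esub> ev x b"
    and inv: "\<And>a. a \<in> carrier G \<Longrightarrow> \<exists>b\<in>carrier G. \<forall>x. ev x b = \<ominus>\<^bsub>M x\<^esub> ev x a"
  shows "abelian_group G"
proof (rule abelian_groupI)
  fix a assume a: "a \<in> carrier G"
  from inv[OF a] obtain b where b: "b \<in> carrier G" "\<And>x. ev x b = \<ominus>\<^bsub>M x\<^esub> ev x a" by blast
  have "b \<oplus>\<^bsub>G\<^esub> a = \<zero>\<^bsub>G\<^esub>"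
    by (rule inj) (use a b in \<open>simp_all add: add zero ev abelian_group.l_neg[OF M]\<close>)
  with b show "\<exists>y\<in>carrier G. y \<oplus>\<^bsub>G\<^esub> a = \<zero>\<^bsub>G\<^esub>" by blast
next
  fix a b c assume "a \<in> carrier G" "b \<in> carrier G" "c \<in> carrier G"
  then show "a \<oplus>\<^bsub>G\<^esub> b \<oplus>\<^bsub>G\<^esub> c = a \<oplus>\<^bsub>G\<^esub> (b \<oplus>\<^bsub>G\<^esub> c)"
    by (intro inj) (simp_all add: add ev abelian_monoid.a_assoc[OF abelian_group.axioms(1)[OF M]])
next
  fix a b assume "a \<in> carrier G" "b \<in> carrier G"
  then show "a \<oplus>\<^bsub>G\<^esub> b = b \<oplus>\<^bsub>G\<^esub> a"
    by (intro inj) (simp_all add: add ev abelian_monoid.a_comm[OF abelian_group.axioms(1)[OF M]])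
next
  fix a assume "a \<in> carrier G"
  then show "\<zero>\<^bsub>G\<^esub> \<oplus>\<^bsub>G\<^esub> a = a"
    by (intro inj) (simp_all add: add zero ev abelian_monoid.l_zero[OF abelian_group.axioms(1)[OF M]])
qed (simp_all add: add zero)

lemma additive_zero_minus:
  assumes G: "abelian_group G" and H: "abelian_group H"
    and \<phi>: "\<And>a. a \<in> carrier G \<Longrightarrow> \<phi> a \<in> carrier H"
    and add: "\<And>a b. a \<in> carrier G \<Longrightarrow> b \<in> carrier G \<Longrightarrow> \<phi> (a \<oplus>\<^bsub>G\<^esub> b) = \<phi> a \<oplus>\<^bsub>H\<^esub> \<phi> b"
  shows additive_zero: "\<phi> \<zero>\<^bsub>G\<^esub> = \<zero>\<^bsub>H\<^esub>"
    and additive_minus: "a \<in> carrier G \<Longrightarrow> b \<in> carrier G \<Longrightarrow> \<phi> (a \<ominus>\<^bsub>G\<^esub> b) = \<phi> a \<ominus>\<^bsub>H\<^esub> \<phi> b"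
proof -
  interpret G: abelian_group G by (rule G)
  interpret H: abelian_group H by (rule H)
  have "\<phi> \<zero>\<^bsub>G\<^esub> \<oplus>\<^bsub>H\<^esub> \<phi> \<zero>\<^bsub>G\<^esub> = \<phi> \<zero>\<^bsub>G\<^esub>" using add[of "\<zero>\<^bsub>G\<^esub>" "\<zero>\<^bsub>G\<^esub>"] by simp
  then show z: "\<phi> \<zero>\<^bsub>G\<^esub> = \<zero>\<^bsub>H\<^esub>" by (metis G.zero_closed H.add.l_cancel_one' \<phi>)
  have i: "\<phi> (\<ominus>\<^bsub>G\<^esub> a) = \<ominus>\<^bsub>H\<^esub> \<phi> a" if "a \<in> carrier G" for a
    using add[of "\<ominus>\<^bsub>G\<^esub> a" a] that by (intro H.minus_equality[symmetric]) (simp_all add: \<phi> G.l_neg z)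
  show "\<phi> (a \<ominus>\<^bsub>G\<^esub> b) = \<phi> a \<ominus>\<^bsub>H\<^esub> \<phi> b" if "a \<in> carrier G" "b \<in> carrier G"
    using that by (simp add: a_minus_def add i)
qed

lemma abelian_group_cong:
  assumes "abelian_group G" and "carrier H = carrier G" "\<zero>\<^bsub>H\<^esub> = \<zero>\<^bsub>G\<^esub>" "(\<oplus>\<^bsub>H\<^esub>) = (\<oplus>\<^bsub>G\<^esub>)"
  shows "abelian_group H"
proof -
  interpret abelian_group G by fact
  show ?thesis
    by (rule abelian_groupI) (auto simp: assms a_ac l_neg intro: bexI[of _ "\<ominus>\<^bsub>G\<^esub> _"])
qed

lemma module_self: "cring R \<Longrightarrow> module R (self_module R)"
proof -
  assume "cring R"
  then interpret cring R .
  have "abelian_group (self_module R)"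
    by (rule abelian_group_cong[of R]) (simp_all add: self_module_def ring.defs is_abelian_group)
  then show ?thesis
    by (intro moduleI is_cring)
      (simp_all add: self_module_def ring.defs l_distr r_distr m_assoc)
qed

section \<open>Ideals and cosets in polynomial rings\<close>

locale poly_ideal =
  fixes A :: "var set" and I :: "'k::comm_ring_1 pol set"
  assumes ideal: "ideal I (poly_ring A)"
begin

abbreviation R where "R \<equiv> (poly_ring A :: 'k pol ring)"

sublocale I: ideal I R by (rule ideal)

lemma subset: "x \<in> I \<Longrightarrow> x \<in> carrier R" by (rule I.Icarr)
lemma zero: "0 \<in> I" using additive_subgroup.zero_closed[OF I.is_additive_subgroup] unfolding poly_ring_simps .
lemma add: "x \<in> I \<Longrightarrow> y \<in> I \<Longrightarrow> x + y \<in> I" using additive_subgroup.a_closed[OF I.is_additive_subgroup, of x y] unfolding poly_ring_simps .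
lemma mult: "r \<in> carrier R \<Longrightarrow> x \<in> I \<Longrightarrow> r * x \<in> I" using I.I_l_closed[of x r] unfolding poly_ring_simps by blast
lemma uminus: "x \<in> I \<Longrightarrow> - x \<in> I" using mult[of "- 1" x] by (simp add: poly_ring_intros)
lemma diff: "x \<in> I \<Longrightarrow> y \<in> I \<Longrightarrow> x - y \<in> I" using add[of x "- y"] uminus[of y] by simp
lemma sum: "(\<And>i. i \<in> S \<Longrightarrow> f i \<in> I) \<Longrightarrow> (\<Sum>i\<in>S. f i) \<in> I"
  by (induction S rule: infinite_finite_induct) (auto simp: zero add)
lemma minus_commute: "x - y \<in> I \<Longrightarrow> y - x \<in> I" using uminus[of "x - y"] by simp

abbreviation Q where "Q \<equiv> R Quot I"
abbreviation cls where "cls x \<equiv> I +>\<^bsub>R\<^esub> x"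

lemma mem_cls: "y \<in> cls x \<longleftrightarrow> y - x \<in> I"
  by (auto simp: a_r_coset_def' image_iff) (metis diff_add_cancel)

lemma cls_eq: "x \<in> carrier R \<Longrightarrow> y \<in> carrier R \<Longrightarrow> cls x = cls y \<longleftrightarrow> x - y \<in> I"
proof
  assume "cls x = cls y"
  moreover have "x \<in> cls x" by (simp add: mem_cls zero)
  ultimately show "x - y \<in> I" by (simp add: mem_cls)
next
  assume *: "x - y \<in> I"
  have "z - x \<in> I \<longleftrightarrow> z - y \<in> I" for z
    using add[of "z - x", OF _ *] diff[of "z - y", OF _ *] by auto
  then show "cls x = cls y" by (auto simp: mem_cls set_eq_iff)
qed

lemma in_Q: "q \<in> carrier Q \<longleftrightarrow> (\<exists>x\<in>carrier R. q = cls x)"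
  by (auto simp: FactRing_def A_RCOSETS_def')

lemma cls_closed: "x \<in> carrier R \<Longrightarrow> cls x \<in> carrier Q"
  by (auto simp: in_Q)

lemma mem_Q_carrier: "q \<in> carrier Q \<Longrightarrow> x \<in> q \<Longrightarrow> x \<in> carrier R"
  by (auto simp: in_Q mem_cls) (metis diff_add_cancel poly_ring_add subset)

lemma mem_Q_eq: "q \<in> carrier Q \<Longrightarrow> x \<in> q \<Longrightarrow> q = cls x"
proof -
  assume q: "q \<in> carrier Q" and x: "x \<in> q"
  then obtain y where "y \<in> carrier R" "q = cls y" by (auto simp: in_Q)
  with x mem_Q_carrier[OF q x] show ?thesis using cls_eq[of x y] by (simp add: mem_cls)
qed

lemma Q_nonempty: "q \<in> carrier Q \<Longrightarrow> \<exists>x. x \<in> q"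
  by (auto simp: in_Q mem_cls intro: exI[of _ "_ :: 'k pol"]) (metis cancel_comm_monoid_add_class.diff_cancel mem_cls zero)

lemma cls_add: "x \<in> carrier R \<Longrightarrow> y \<in> carrier R \<Longrightarrow> cls x \<oplus>\<^bsub>Q\<^esub> cls y = cls (x + y)"
  using I.a_rcos_sum[of x y] by (simp add: FactRing_def)

lemma cls_mult: "x \<in> carrier R \<Longrightarrow> y \<in> carrier R \<Longrightarrow> cls x \<otimes>\<^bsub>Q\<^esub> cls y = cls (x * y)"
  using I.rcoset_mult_add[of x y] by (simp add: FactRing_def)

lemma cls_zero: "\<zero>\<^bsub>Q\<^esub> = cls 0"
  using mem_cls[of _ 0] by (auto simp: FactRing_def)

lemma cls_eq_zero: "x \<in> carrier R \<Longrightarrow> cls x = \<zero>\<^bsub>Q\<^esub> \<longleftrightarrow> x \<in> I"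
  by (simp add: cls_zero cls_eq poly_ring_zero)

lemma cring_Q: "cring Q"
  by (rule I.quotient_is_cring) (rule cring_poly_ring)

lemma abelian_group_Q: "abelian_group Q"
  using cring_Q by (simp add: cring_def ring_def)

lemma cls_uminus: "x \<in> carrier R \<Longrightarrow> \<ominus>\<^bsub>Q\<^esub> cls x = cls (- x)"
proof -
  assume x: "x \<in> carrier R"
  interpret Q: cring Q by (rule cring_Q)
  show ?thesis
    by (rule Q.minus_equality) (simp_all add: x cls_closed poly_ring_uminus cls_add cls_zero)
qed

lemma finsum_cls:
  "(\<And>i. i \<in> S \<Longrightarrow> f i \<in> carrier R) \<Longrightarrow> (\<Oplus>\<^bsub>Q\<^esub>i\<in>S. cls (f i)) = cls (\<Sum>i\<in>S. f i)"
proof -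
  interpret Q: cring Q by (rule cring_Q)
  show "(\<And>i. i \<in> S \<Longrightarrow> f i \<in> carrier R) \<Longrightarrow> ?thesis"
    by (induction S rule: infinite_finite_induct)
      (simp_all add: cls_zero cls_closed cls_add poly_ring_sum Pi_def)
qed

lemma quot_module_simps [simp]:
  "carrier (quot_module R I) = carrier Q" "(\<oplus>\<^bsub>quot_module R I\<^esub>) = (\<oplus>\<^bsub>Q\<^esub>)"
  "\<zero>\<^bsub>quot_module R I\<^esub> = \<zero>\<^bsub>Q\<^esub>"
  by (simp_all add: quot_module_def ring.defs)

lemma quot_module_smult:
  "r \<in> carrier R \<Longrightarrow> x \<in> carrier R \<Longrightarrow> r \<odot>\<^bsub>quot_module R I\<^esub> cls x = cls (r * x)"
  by (simp add: quot_module_def ring.defs cls_mult)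

lemma module_quot: "module R (quot_module R I)"
proof (rule moduleI)
  show "abelian_group (quot_module R I)"
    by (rule abelian_group_cong[OF abelian_group_Q]) simp_all
qed (auto simp: cring_poly_ring in_Q quot_module_smult cls_add poly_ring_intros algebra_simps
      intro!: bexI[of _ "_ * _"])

end

section \<open>The adic completion\<close>

declare ideal_pow.simps [simp del]

locale poly_completion = poly_ideal A I for A :: "var set" and I :: "'k::comm_ring_1 pol set"
begin

abbreviation pow where "pow n \<equiv> ideal_pow R I n"

lemma ideal_pow: "ideal (pow n) R"
proof (induction n)
  case 0
  show ?case by (simp add: I.oneideal ideal_pow.simps)
next
  case (Suc n)
  show ?case using I.ideal_prod_is_ideal[OF ideal Suc] by (simp add: ideal_pow.simps)
qed

sublocale P: poly_ideal A "pow n" for n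
  by (rule poly_ideal.intro) (rule ideal_pow)

abbreviation K where "K \<equiv> completion R I"

lemma pow_Suc_mult: "x \<in> I \<Longrightarrow> y \<in> pow n \<Longrightarrow> x * y \<in> pow (Suc n)"
  using ideal_prod.prod[of x I y "pow n" R] by (simp add: ideal_pow.simps)

text \<open>Identifies level 1 of the completion with the quotient by \<open>I\<close>, the target
  of \<open>from_completion\<close>.\<close>

lemma pow_1: "pow (Suc 0) = I"
proof
  show "pow (Suc 0) \<subseteq> I"
    using I.ideal_prod_inter[OF ideal I.oneideal] by (auto simp: ideal_pow.simps)
  show "I \<subseteq> pow (Suc 0)"
    using pow_Suc_mult[of _ 1 0] by (auto simp: poly_ring_one ideal_pow.simps(1))
qed

lemma pow_Suc_subset: "pow (Suc n) \<subseteq> pow n"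
  using I.ideal_prod_inter[OF ideal ideal_pow[of n]] by (auto simp: ideal_pow.simps)

lemma pow_antimono: "n \<le> k \<Longrightarrow> pow k \<subseteq> pow n"
  by (rule lift_Suc_antimono_le[of pow]) (rule pow_Suc_subset)

lemma cls_pow_subset: "x \<in> carrier R \<Longrightarrow> y \<in> carrier R \<Longrightarrow> y - x \<in> pow n \<Longrightarrow> P.cls (Suc n) y \<subseteq> P.cls n x"
proof
  fix z assume *: "y - x \<in> pow n" and "z \<in> P.cls (Suc n) y"
  then have "z - y \<in> pow n" using pow_Suc_subset by (auto simp: P.mem_cls)
  from P.add[OF this *] show "z \<in> P.cls n x" by (simp add: P.mem_cls)
qed

lemma in_K: "h \<in> carrier K \<longleftrightarrow> (\<forall>n. h n \<in> carrier (P.Q n)) \<and> (\<forall>n. h (Suc n) \<subseteq> h n)"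
  by (simp add: completion_def)

lemma K_comp: "h \<in> carrier K \<Longrightarrow> h n \<in> carrier (P.Q n)"
  by (simp add: in_K)

lemma K_antimono: "h \<in> carrier K \<Longrightarrow> n \<le> k \<Longrightarrow> h k \<subseteq> h n"
  by (rule lift_Suc_antimono_le[of h]) (auto simp: in_K)

text \<open>The cosets of an element are nested, so a representative at level n represents every
  lower level as well.\<close>

lemma K_rep:
  assumes h: "h \<in> carrier K"
  obtains x where "x \<in> carrier R" "x \<in> h n" "\<And>k. k \<le> n \<Longrightarrow> h k = P.cls k x"
proof -
  from P.Q_nonempty[OF K_comp[OF h]] obtain x where x: "x \<in> h n" by blast
  show ?thesis
  proof
    show "x \<in> carrier R" using P.mem_Q_carrier[OF K_comp[OF h] x] .
    show "x \<in> h n" by fact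
    show "h k = P.cls k x" if "k \<le> n" for k
      using K_antimono[OF h that] x by (intro P.mem_Q_eq K_comp h) auto
  qed
qed

lemma K_agree:
  assumes "g \<in> carrier K" "h \<in> carrier K" "g n = h n" "k \<le> n" shows "g k = h k"
proof -
  from P.Q_nonempty[OF K_comp[OF assms(1)]] obtain x where x: "x \<in> g n" by blast
  with assms have "x \<in> g k" "x \<in> h k" using K_antimono[of g k n] K_antimono[of h k n] by auto
  with P.mem_Q_eq[OF K_comp] assms(1,2) show ?thesis by metis
qed

lemma in_K_seq:
  assumes "\<And>n. x n \<in> carrier R" and "\<And>n. x (Suc n) - x n \<in> pow n"
  shows "(\<lambda>n. P.cls n (x n)) \<in> carrier K"
  using assms by (auto simp: in_K P.cls_closed intro: cls_pow_subset[THEN subsetD])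

text \<open>Together with \<open>in_K_seq\<close> this presents the completion by adic Cauchy
  sequences of polynomials, on which the module laws are those of polynomials.\<close>

lemma in_K_obtain:
  assumes h: "h \<in> carrier K"
  obtains x where "\<And>n. x n \<in> carrier R" "\<And>n. x (Suc n) - x n \<in> pow n" "h = (\<lambda>n. P.cls n (x n))"
proof -
  define x where "x n = (SOME y. y \<in> h n)" for n
  have x2: "x n \<in> h n" for n
    unfolding x_def using P.Q_nonempty[OF K_comp[OF h], of n] by (rule someI_ex)
  have x: "x n \<in> carrier R" "x n \<in> h n" for n
    using P.mem_Q_carrier[OF K_comp[OF h] x2] x2 .
  show ?thesis
  proof
    show "h = (\<lambda>n. P.cls n (x n))" using P.mem_Q_eq[OF K_comp[OF h] x(2)] by blast
    show "x (Suc n) - x n \<in> pow n" for n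
      using K_antimono[OF h, of n "Suc n"] x(2)[of "Suc n"] P.mem_Q_eq[OF K_comp[OF h] x(2)[of n]]
      by (auto simp: P.mem_cls)
  qed (rule x(1))
qed

lemma K_simps: "\<zero>\<^bsub>K\<^esub> = (\<lambda>n. \<zero>\<^bsub>P.Q n\<^esub>)" "g \<oplus>\<^bsub>K\<^esub> h = (\<lambda>n. g n \<oplus>\<^bsub>P.Q n\<^esub> h n)"
  "r \<odot>\<^bsub>K\<^esub> h = (\<lambda>n. P.cls n r \<otimes>\<^bsub>P.Q n\<^esub> h n)"
  by (simp_all add: completion_def)

lemma K_zero: "\<zero>\<^bsub>K\<^esub> \<in> carrier K"
  using in_K_seq[of "\<lambda>n. 0"] by (simp add: K_simps P.cls_zero poly_ring_zero P.zero)

lemma K_add: "g \<in> carrier K \<Longrightarrow> h \<in> carrier K \<Longrightarrow> g \<oplus>\<^bsub>K\<^esub> h \<in> carrier K"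
proof -
  assume "g \<in> carrier K" "h \<in> carrier K"
  note gh = this
  obtain x where x: "\<And>n. x n \<in> carrier R" "\<And>n. x (Suc n) - x n \<in> pow n" "g = (\<lambda>n. P.cls n (x n))"
    by (rule in_K_obtain[OF gh(1)]) (rule that)
  obtain y where y: "\<And>n. y n \<in> carrier R" "\<And>n. y (Suc n) - y n \<in> pow n" "h = (\<lambda>n. P.cls n (y n))"
    by (rule in_K_obtain[OF gh(2)]) (rule that)
  have "x (Suc n) + y (Suc n) - (x n + y n) \<in> pow n" for n
    using P.add[OF x(2)[of n] y(2)[of n]] by (simp add: algebra_simps)
  then show ?thesis
    using in_K_seq[of "\<lambda>n. x n + y n"] by (simp add: K_simps x y P.cls_add poly_ring_add)
qed

lemma K_smult: "r \<in> carrier R \<Longrightarrow> h \<in> carrier K \<Longrightarrow> r \<odot>\<^bsub>K\<^esub> h \<in> carrier K"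
proof -
  assume r: "r \<in> carrier R" and h: "h \<in> carrier K"
  obtain x where x: "\<And>n. x n \<in> carrier R" "\<And>n. x (Suc n) - x n \<in> pow n" "h = (\<lambda>n. P.cls n (x n))"
    by (rule in_K_obtain[OF h]) (rule that)
  have "r * x (Suc n) - r * x n \<in> pow n" for n
    using P.mult[OF r x(2)[of n]] by (simp add: algebra_simps)
  then show ?thesis
    using in_K_seq[of "\<lambda>n. r * x n"] r by (simp add: K_simps x P.cls_mult poly_ring_mult)
qed

lemma abelian_group_K: "abelian_group K"
proof (rule abelian_group_by_evaluation[where ev = "\<lambda>n h. h n" and M = "\<lambda>n. P.Q n"])
  fix h assume h: "h \<in> carrier K"
  obtain x where x: "\<And>n. x n \<in> carrier R" "h = (\<lambda>n. P.cls n (x n))"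
    by (rule in_K_obtain[OF h]) (rule that)
  show "\<exists>b\<in>carrier K. \<forall>n. b n = \<ominus>\<^bsub>P.Q n\<^esub> h n"
  \<comment> \<open>The negative is taken as the multiple by -1, which is already known to lie in
    the completion.\<close>
  proof (intro bexI[of _ "(- 1) \<odot>\<^bsub>K\<^esub> h"] allI)
    fix n
    have "- 1 \<in> carrier R" by (simp add: poly_ring_intros)
    then show "((- 1) \<odot>\<^bsub>K\<^esub> h) n = \<ominus>\<^bsub>P.Q n\<^esub> h n"
      by (simp add: K_simps x(2) P.cls_mult x(1) P.cls_uminus)
  qed (simp add: K_smult h poly_ring_intros)
next
  fix a b assume "\<And>n. a n = (b n :: 'k pol set)"
  then show "a = b" by blast
qed (simp_all add: P.abelian_group_Q K_comp K_zero K_add, simp_all add: K_simps)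

lemma module_K: "module R K"
proof (rule moduleI)
  fix a b h assume ab: "a \<in> carrier R" "b \<in> carrier R" and h: "h \<in> carrier K"
  obtain x where x: "\<And>n. x n \<in> carrier R" "h = (\<lambda>n. P.cls n (x n))"
    by (rule in_K_obtain[OF h]) (rule that)
  show "(a \<oplus>\<^bsub>R\<^esub> b) \<odot>\<^bsub>K\<^esub> h = a \<odot>\<^bsub>K\<^esub> h \<oplus>\<^bsub>K\<^esub> b \<odot>\<^bsub>K\<^esub> h"
    and "(a \<otimes>\<^bsub>R\<^esub> b) \<odot>\<^bsub>K\<^esub> h = a \<odot>\<^bsub>K\<^esub> (b \<odot>\<^bsub>K\<^esub> h)"
    using ab x
    by (simp_all add: K_simps P.cls_mult P.cls_add poly_ring_mult poly_ring_add distrib_right mult.assoc)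
next
  fix a g h assume a: "a \<in> carrier R" and gh: "g \<in> carrier K" "h \<in> carrier K"
  obtain x where x: "\<And>n. x n \<in> carrier R" "g = (\<lambda>n. P.cls n (x n))"
    by (rule in_K_obtain[OF gh(1)]) (rule that)
  obtain y where y: "\<And>n. y n \<in> carrier R" "h = (\<lambda>n. P.cls n (y n))"
    by (rule in_K_obtain[OF gh(2)]) (rule that)
  show "a \<odot>\<^bsub>K\<^esub> (g \<oplus>\<^bsub>K\<^esub> h) = a \<odot>\<^bsub>K\<^esub> g \<oplus>\<^bsub>K\<^esub> a \<odot>\<^bsub>K\<^esub> h"
    using a x y
    by (simp add: K_simps P.cls_mult P.cls_add poly_ring_mult poly_ring_add distrib_left)
next
  fix h assume h: "h \<in> carrier K"
  obtain x where "\<And>n. x n \<in> carrier R" "h = (\<lambda>n. P.cls n (x n))"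
    by (rule in_K_obtain[OF h]) (rule that)
  then show "\<one>\<^bsub>R\<^esub> \<odot>\<^bsub>K\<^esub> h = h"
    by (simp add: K_simps P.cls_mult poly_ring_one)
qed (auto simp: cring_poly_ring abelian_group_K K_smult)

abbreviation \<epsilon> where "\<epsilon> \<equiv> to_completion R I"

lemma \<epsilon>_comp: "\<epsilon> r n = P.cls n r"
  by (simp add: to_completion_def)

lemma \<epsilon>_closed: "r \<in> carrier R \<Longrightarrow> \<epsilon> r \<in> carrier K"
  using in_K_seq[of "\<lambda>n. r"] by (simp add: to_completion_def P.zero)

lemma \<epsilon>_add: "r \<in> carrier R \<Longrightarrow> s \<in> carrier R \<Longrightarrow> \<epsilon> (r + s) = \<epsilon> r \<oplus>\<^bsub>K\<^esub> \<epsilon> s"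
  by (simp add: K_simps to_completion_def P.cls_add)

lemma \<epsilon>_zero: "\<epsilon> 0 = \<zero>\<^bsub>K\<^esub>"
  by (simp add: K_simps to_completion_def P.cls_zero)

lemma \<epsilon>_smult: "r \<in> carrier R \<Longrightarrow> s \<in> carrier R \<Longrightarrow> \<epsilon> (r * s) = r \<odot>\<^bsub>K\<^esub> \<epsilon> s"
  by (simp add: K_simps to_completion_def P.cls_mult)

lemma finsum_K_comp:
  assumes "\<And>i. i \<in> S \<Longrightarrow> f i \<in> carrier K"
  shows "(\<Oplus>\<^bsub>K\<^esub>i\<in>S. f i) n = (\<Oplus>\<^bsub>P.Q n\<^esub>i\<in>S. f i n)"
  by (rule finsum_hom[where \<phi> = "\<lambda>h. h n"])
    (use assms abelian_group.axioms(1)[OF abelian_group_K] abelian_group.axioms(1)[OF P.abelian_group_Q]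
      in \<open>auto simp: K_comp\<close>, auto simp: K_simps)

lemma K_minus_comp:
  assumes "g \<in> carrier K" "h \<in> carrier K"
  shows "(g \<ominus>\<^bsub>K\<^esub> h) n = g n \<ominus>\<^bsub>P.Q n\<^esub> h n"
  by (rule additive_minus[where \<phi> = "\<lambda>h. h n", OF abelian_group_K P.abelian_group_Q])
    (use assms in \<open>auto simp: K_comp\<close>, auto simp: K_simps)

end

section \<open>Power series expansions in the completion\<close>

locale expansion =
  fixes m :: nat and V :: "'k::comm_ring_1 pol" and \<sigma> :: "'k pol set \<Rightarrow> nat \<Rightarrow> 'k pol set"
  assumes V: "V \<in> carrier (ky m)"
    and qr: "quasi_regular (ky m) m (\<lambda>i. pdiff (VY i) V)"
    and sec: "linear_section m V \<sigma>"
begin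

abbreviation t where "t i \<equiv> pdiff (VY i) V"

lemma t_closed: "t i \<in> carrier (ky m)"
  using V by (rule poly_ring_pdiff)

end

sublocale expansion \<subseteq> poly_completion "VY ` {..<m}" "jacobi_ideal VY m V"
proof (intro poly_completion.intro poly_ideal.intro)
  show "ideal (jacobi_ideal VY m V) (ky m)"
    unfolding jacobi_ideal_def
    by (rule ring.genideal_ideal[OF cring.axioms(1)[OF cring_poly_ring]]) (auto intro: t_closed)
qed

context expansion
begin

abbreviation I where "I \<equiv> jacobi_ideal VY m V"
abbreviation MI where "MI N \<equiv> {u \<in> multi_indices m. (\<Sum>i<m. u i) < N}"
abbreviation ME where "ME N \<equiv> {u \<in> multi_indices m. (\<Sum>i<m. u i) = N}"

lemma finite_MI: "finite (MI N)"
proof (rule finite_subset)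
  show "MI N \<subseteq> {u. \<forall>i. (i \<in> {..<m} \<longrightarrow> u i \<in> {..N}) \<and> (i \<notin> {..<m} \<longrightarrow> u i = 0)}"
  proof (intro subsetI CollectI allI conjI impI)
    fix u i assume u: "u \<in> MI N" and i: "i \<in> {..<m}"
    have "u i \<le> (\<Sum>i<m. u i)" using i by (intro member_le_sum) auto
    with u show "u i \<in> {..N}" by simp
  qed (auto simp: multi_indices_def)
qed (rule finite_set_of_finite_funs; simp)

lemma finite_ME: "finite (ME N)"
  by (rule finite_subset[OF _ finite_MI[of "Suc N"]]) auto

lemma MI_Suc: "MI (Suc N) = MI N \<union> ME N" and MI_ME_disjoint: "MI N \<inter> ME N = {}"
  by auto

lemma t_in_I: "i < m \<Longrightarrow> t i \<in> I"
  unfolding jacobi_ideal_def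
  by (rule I.genideal_self[THEN subsetD]) (auto intro: t_closed)

lemma tmon_closed: "tmon m V u \<in> carrier (ky m)"
  by (auto simp: tmon_def tpow_def intro!: poly_ring_intros t_closed)

lemma t_pow_mult: "i < m \<Longrightarrow> x \<in> pow n \<Longrightarrow> t i ^ j * x \<in> pow (j + n)"
  by (induction j) (auto simp: mult.assoc intro: pow_Suc_mult t_in_I)

lemma tmon_in_pow: "tmon m V u \<in> pow (\<Sum>i<m. u i)"
proof -
  have "S \<subseteq> {..<m} \<Longrightarrow> (\<Prod>i\<in>S. t i ^ u i) \<in> pow (\<Sum>i\<in>S. u i)" if "finite S" for S
    using that
    by induction (auto simp: ideal_pow.simps poly_ring_one intro: t_pow_mult)
  then show ?thesis by (simp add: tmon_def tpow_def)
qed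

lemma tmon_in_pow': "n \<le> (\<Sum>i<m. u i) \<Longrightarrow> tmon m V u \<in> pow n"
  using pow_antimono tmon_in_pow by blast

section \<open>Powers of the Jacobi ideal as forms in t\<close>

lemma I_subset_span: "x \<in> I \<Longrightarrow> \<exists>g. (\<forall>i. g i \<in> carrier R) \<and> x = (\<Sum>i<m. t i * g i)"
proof -
  let ?S = "{x. \<exists>g. (\<forall>i. g i \<in> carrier R) \<and> x = (\<Sum>i<m. t i * g i)}"
  have mult: "r * x \<in> ?S" if r: "r \<in> carrier R" and x: "x \<in> ?S" for r x
  proof -
    from x obtain g where g: "\<And>i. g i \<in> carrier R" "x = (\<Sum>i<m. t i * g i)" by auto
    then show ?thesis
      by (auto simp: sum_distrib_left ac_simps intro!: exI[of _ "\<lambda>i. r * g i"] poly_ring_mult r)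
  qed
  have "ideal ?S R"
  proof (rule idealI)
    show "ring R" using cring_poly_ring by (rule cring.axioms)
    show "subgroup ?S (add_monoid R)"
    proof (rule group.subgroupI)
      show "group (add_monoid R)"
        using abelian_group.a_group[OF I.is_abelian_group] .
      show "?S \<subseteq> carrier (add_monoid R)" by (auto intro!: poly_ring_intros t_closed)
      have "0 \<in> ?S" by (auto intro!: exI[of _ "\<lambda>i. 0"] poly_ring_zero)
      then show "?S \<noteq> {}" by blast
      fix a assume a: "a \<in> ?S"
      have "a \<in> carrier R" using a by (auto intro!: poly_ring_intros t_closed)
      moreover have "- a \<in> ?S" using mult[of "- 1", OF _ a] by (simp add: poly_ring_intros)
      ultimately show "inv\<^bsub>add_monoid R\<^esub> a \<in> ?S"
        by (simp only: poly_ring_a_inv flip: a_inv_def)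
      fix b assume "b \<in> ?S"
      with a obtain f g where "\<And>i. f i \<in> carrier R" "a = (\<Sum>i<m. t i * f i)"
        "\<And>i. g i \<in> carrier R" "b = (\<Sum>i<m. t i * g i)" by auto
      then show "a \<otimes>\<^bsub>add_monoid R\<^esub> b \<in> ?S"
        by (auto simp: sum.distrib distrib_left intro!: exI[of _ "\<lambda>i. f i + g i"] poly_ring_add)
    qed
    fix a x assume "a \<in> ?S" "x \<in> carrier R"
    then show "x \<otimes>\<^bsub>R\<^esub> a \<in> ?S" "a \<otimes>\<^bsub>R\<^esub> x \<in> ?S"
      using mult[of x a] by (simp_all only: poly_ring_simps mult.commute[of a])
  qed
  moreover have "t ` {..<m} \<subseteq> ?S"
  proof
    fix x assume "x \<in> t ` {..<m}"
    then obtain j where "j < m" "x = t j" by auto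
    then show "x \<in> ?S"
      by (auto intro!: exI[of _ "\<lambda>i. if i = j then 1 else 0"] poly_ring_intros
        simp: if_distrib sum.delta cong: if_cong)
  qed
  ultimately have "I \<subseteq> ?S" unfolding jacobi_ideal_def by (rule I.genideal_minimal)
  then show "x \<in> I \<Longrightarrow> ?thesis" by auto
qed

text \<open>The forms of degree N in the \<open>t\<^sub>i\<close> with polynomial coefficients, a
  concrete model of the N-th power of the Jacobi ideal.\<close>

definition span :: "nat \<Rightarrow> 'k pol set" where
  "span N = {x. \<exists>f. (\<forall>u. f u \<in> carrier R) \<and> x = (\<Sum>u\<in>ME N. tmon m V u * f u)}"

lemma span_add: "x \<in> span N \<Longrightarrow> y \<in> span N \<Longrightarrow> x + y \<in> span N"
proof -
  assume "x \<in> span N" "y \<in> span N"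
  then obtain f g where "\<And>u. f u \<in> carrier R" "x = (\<Sum>u\<in>ME N. tmon m V u * f u)"
    "\<And>u. g u \<in> carrier R" "y = (\<Sum>u\<in>ME N. tmon m V u * g u)" by (auto simp: span_def)
  then show ?thesis
    by (auto simp: span_def sum.distrib distrib_left intro!: exI[of _ "\<lambda>i. f i + g i"] poly_ring_add)
qed

lemma span_single: "u \<in> ME N \<Longrightarrow> r \<in> carrier R \<Longrightarrow> tmon m V u * r \<in> span N"
  using finite_ME[of N]
  by (auto simp: span_def if_distrib sum.delta cong: if_cong
    intro!: exI[of _ "\<lambda>w. if w = u then r else 0"] poly_ring_zero)

lemma span_zero: "0 \<in> span N"
  by (auto simp: span_def intro!: exI[of _ "\<lambda>i. 0"] poly_ring_zero)

lemma span_sum: "(\<And>i. i \<in> S \<Longrightarrow> f i \<in> span N) \<Longrightarrow> (\<Sum>i\<in>S. f i) \<in> span N"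
  by (induction S rule: infinite_finite_induct) (auto simp: span_zero span_add)

lemma t_times_tmon: "i < m \<Longrightarrow> t i * tmon m V u = tmon m V (u(i := Suc (u i)))"
proof -
  assume i: "i < m"
  have "(\<Prod>j<m. t j ^ (u(i := Suc (u i))) j) = (\<Prod>j<m. t j ^ u j * (if j = i then t i else 1))"
    by (intro prod.cong) auto
  with i show ?thesis by (simp add: tmon_def tpow_def prod.distrib prod.delta)
qed

lemma Suc_in_ME: "i < m \<Longrightarrow> u \<in> ME N \<Longrightarrow> u(i := Suc (u i)) \<in> ME (Suc N)"
proof -
  assume i: "i < m" and u: "u \<in> ME N"
  have "(\<Sum>j<m. (u(i := Suc (u i))) j) = (\<Sum>j<m. u j + (if j = i then 1 else 0))"
    by (intro sum.cong) auto
  also have "\<dots> = Suc N" using i u by (simp add: sum.distrib sum.delta)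
  finally show ?thesis using i u by (auto simp: multi_indices_def)
qed

text \<open>A linear form times a form of degree N is a form of degree N + 1, because multiplication
  by \<open>t i\<close> raises one exponent.\<close>

lemma pow_subset_span: "x \<in> pow N \<Longrightarrow> x \<in> span N"
proof (induction N arbitrary: x)
  case 0
  have "(\<lambda>i. 0) \<in> ME 0" by (simp add: multi_indices_def)
  moreover have "tmon m V (\<lambda>i. 0) = 1" by (simp add: tmon_def tpow_def)
  ultimately show ?case using span_single[of "\<lambda>i. 0" 0 x] 0 by (simp add: ideal_pow.simps)
next
  case (Suc N)
  from Suc.prems have "x \<in> ideal_prod R I (pow N)" by (simp add: ideal_pow.simps)
  then show ?case
  proof induction
    case (prod i j)
    from I_subset_span[OF prod(1)] obtain g
      where g: "\<And>i. g i \<in> carrier R" "i = (\<Sum>i<m. t i * g i)" by blast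
    from Suc.IH[OF prod(2)] obtain f
      where f: "\<And>u. f u \<in> carrier R" "j = (\<Sum>u\<in>ME N. tmon m V u * f u)" by (auto simp: span_def)
    have "i * j = (\<Sum>i<m. \<Sum>u\<in>ME N. (t i * tmon m V u) * (g i * f u))"
      by (simp only: g f sum_product ac_simps)
    also have "\<dots> = (\<Sum>i<m. \<Sum>u\<in>ME N. tmon m V (u(i := Suc (u i))) * (g i * f u))"
      by (intro sum.cong) (auto simp: t_times_tmon)
    also have "\<dots> \<in> span (Suc N)"
      by (intro span_sum span_single Suc_in_ME poly_ring_mult f g) auto
    finally show ?case by simp
  next
    case (sum s1 s2)
    then show ?case by (simp add: span_add)
  qed
qed

subsection \<open>Convergence\<close>

text \<open>At level n all terms of degree above n are zero, so the partial sums are constant from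
  bound n + 1 on. The threshold is strict to leave room for differentiated series, whose terms have
  lost one power of t.\<close>

lemma sum_series_comp:
  assumes a: "\<And>u. a u \<in> carrier K" and 0: "\<And>u. u \<in> multi_indices m \<Longrightarrow> n < (\<Sum>i<m. u i) \<Longrightarrow> a u n = \<zero>\<^bsub>P.Q n\<^esub>"
    and N: "n < N"
  shows "(\<Oplus>\<^bsub>K\<^esub>u\<in>MI N. a u) n = (\<Oplus>\<^bsub>K\<^esub>u\<in>MI (Suc n). a u) n"
proof -
  interpret Q: abelian_group "P.Q n" by (rule P.abelian_group_Q)
  show ?thesis
    unfolding finsum_K_comp[OF a]
    by (rule Q.add.finprod_mono_neutral_cong_right) (use N 0 a in \<open>auto simp: K_comp finite_MI\<close>)
qed

text \<open>Since the partial sums stabilise at a known bound, the limit statement becomes one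
  finite equation per level.\<close>

lemma series_sums_iff:
  assumes a: "\<And>u. a u \<in> carrier K" and 0: "\<And>u n. u \<in> multi_indices m \<Longrightarrow> n < (\<Sum>i<m. u i) \<Longrightarrow> a u n = \<zero>\<^bsub>P.Q n\<^esub>"
  shows "series_sums m V a h \<longleftrightarrow> h \<in> carrier K \<and> (\<forall>n. (\<Oplus>\<^bsub>K\<^esub>u\<in>MI (Suc n). a u) n = h n)"
proof -
  have "(\<forall>\<^sub>F N in sequentially. (\<Oplus>\<^bsub>K\<^esub>u\<in>MI N. a u) n = h n) \<longleftrightarrow> (\<Oplus>\<^bsub>K\<^esub>u\<in>MI (Suc n). a u) n = h n" for n
  proof
    assume "\<forall>\<^sub>F N in sequentially. (\<Oplus>\<^bsub>K\<^esub>u\<in>MI N. a u) n = h n"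
    then have "\<forall>\<^sub>F N in sequentially. (\<Oplus>\<^bsub>K\<^esub>u\<in>MI N. a u) n = h n \<and> n < N"
      by (intro eventually_conj eventually_gt_at_top)
    then obtain N where N: "(\<Oplus>\<^bsub>K\<^esub>u\<in>MI N. a u) n = h n" "n < N"
      using eventually_happens by fastforce
    with sum_series_comp[of a n N, OF a 0] show "(\<Oplus>\<^bsub>K\<^esub>u\<in>MI (Suc n). a u) n = h n" by simp
  next
    assume *: "(\<Oplus>\<^bsub>K\<^esub>u\<in>MI (Suc n). a u) n = h n"
    show "\<forall>\<^sub>F N in sequentially. (\<Oplus>\<^bsub>K\<^esub>u\<in>MI N. a u) n = h n"
      using eventually_gt_at_top[of n]
    proof eventually_elim
      case (elim N)
      with sum_series_comp[of a n N, OF a 0] * show ?case by simp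
    qed
  qed
  then show ?thesis by (simp add: series_sums_def)
qed

lemma finsum_K_closed: "(\<And>u. a u \<in> carrier K) \<Longrightarrow> (\<Oplus>\<^bsub>K\<^esub>u\<in>S. a u) \<in> carrier K"
proof -
  interpret K: abelian_group K by (rule abelian_group_K)
  show "(\<And>u. a u \<in> carrier K) \<Longrightarrow> ?thesis" by (rule K.finsum_closed) auto
qed

lemma series_sums_ex:
  assumes a: "\<And>u. a u \<in> carrier K" and 0: "\<And>u n. u \<in> multi_indices m \<Longrightarrow> n < (\<Sum>i<m. u i) \<Longrightarrow> a u n = \<zero>\<^bsub>P.Q n\<^esub>"
  obtains h where "series_sums m V a h"
proof
  define S where "S N = (\<Oplus>\<^bsub>K\<^esub>u\<in>MI N. a u)" for N
  have S: "S N \<in> carrier K" for N unfolding S_def by (rule finsum_K_closed) (rule a)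
  \<comment> \<open>Coherence of the diagonal family: going down one level inside
    \<open>S (Suc (Suc n))\<close> reaches a level at which \<open>S (Suc n)\<close> has the same
    component.\<close>
  have "S (Suc (Suc n)) (Suc n) \<subseteq> S (Suc n) n" for n
    using K_antimono[OF S, of n "Suc n" "Suc (Suc n)"] sum_series_comp[of a n "Suc (Suc n)", OF a 0]
    by (simp add: S_def)
  then have "(\<lambda>n. S (Suc n) n) \<in> carrier K"
    using K_comp[OF S] by (simp add: in_K)
  then show "series_sums m V a (\<lambda>n. S (Suc n) n)"
    by (subst series_sums_iff) (auto simp: a 0 S_def)
qed

lemma series_sums_add:
  assumes "\<And>u. a u \<in> carrier K" "\<And>u. b u \<in> carrier K" "series_sums m V a g" "series_sums m V b h"
  shows "series_sums m V (\<lambda>u. a u \<oplus>\<^bsub>K\<^esub> b u) (g \<oplus>\<^bsub>K\<^esub> h)"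
proof -
  interpret K: abelian_group K by (rule abelian_group_K)
  have *: "(\<Oplus>\<^bsub>K\<^esub>u\<in>S. a u \<oplus>\<^bsub>K\<^esub> b u) = (\<Oplus>\<^bsub>K\<^esub>u\<in>S. a u) \<oplus>\<^bsub>K\<^esub> (\<Oplus>\<^bsub>K\<^esub>u\<in>S. b u)" for S
    using assms(1,2) by (intro K.finsum_addf) auto
  have "\<forall>\<^sub>F N in sequentially. (\<Oplus>\<^bsub>K\<^esub>u\<in>MI N. a u \<oplus>\<^bsub>K\<^esub> b u) n = (g \<oplus>\<^bsub>K\<^esub> h) n" for n
    using assms(3,4)[unfolded series_sums_def, THEN conjunct2, THEN spec[of _ n]]
    by eventually_elim (simp only: *, simp add: K_simps)
  with assms(3,4) show ?thesis by (simp add: series_sums_def K_add)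
qed

lemma series_sums_smult:
  assumes "\<And>u. a u \<in> carrier K" "r \<in> carrier R" "series_sums m V a g"
  shows "series_sums m V (\<lambda>u. r \<odot>\<^bsub>K\<^esub> a u) (r \<odot>\<^bsub>K\<^esub> g)"
proof -
  interpret K: module R K by (rule module_K)
  have *: "(\<Oplus>\<^bsub>K\<^esub>u\<in>MI N. r \<odot>\<^bsub>K\<^esub> a u) = r \<odot>\<^bsub>K\<^esub> (\<Oplus>\<^bsub>K\<^esub>u\<in>MI N. a u)" for N
    using assms(1,2) finite_MI by (subst K.finsum_smult_ldistr) auto
  have "\<forall>\<^sub>F N in sequentially. (\<Oplus>\<^bsub>K\<^esub>u\<in>MI N. r \<odot>\<^bsub>K\<^esub> a u) n = (r \<odot>\<^bsub>K\<^esub> g) n" for n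
    using assms(3)[unfolded series_sums_def, THEN conjunct2, THEN spec[of _ n]]
    by eventually_elim (simp only: *, simp add: K_simps)
  with assms(2,3) show ?thesis by (simp add: series_sums_def K_smult)
qed

text \<open>Each component of the partial sums is eventually constant, so limits are unique. Terms
  are compared on \<open>multi_indices m\<close> only, the exponents over which the series
  runs.\<close>

lemma series_sums_unique:
  assumes "series_sums m V a g" "series_sums m V a' h" "\<And>u. u \<in> multi_indices m \<Longrightarrow> a u = a' u"
    "\<And>u. a u \<in> carrier K"  "\<And>u. a' u \<in> carrier K"
  shows "g = h"
proof
  fix n
  interpret K: abelian_group K by (rule abelian_group_K)
  have *: "(\<Oplus>\<^bsub>K\<^esub>u\<in>MI N. a u) = (\<Oplus>\<^bsub>K\<^esub>u\<in>MI N. a' u)" for N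
    using assms(3-5) by (intro K.finsum_cong') auto
  have "\<forall>\<^sub>F N in sequentially. g n = h n"
    using assms(1,2)[unfolded series_sums_def, THEN conjunct2, THEN spec[of _ n]]
    by eventually_elim (simp add: *)
  then show "g n = h n" by simp
qed

end

context expansion
begin

subsection \<open>Expansions along the section\<close>

abbreviation J where "J \<equiv> JV m V"

lemma J_eq: "J = quot_module R I"
  by (simp add: jacobi_ring_def)

lemma module_J: "module R J"
  unfolding J_eq by (rule module_quot)

lemma J_simps [simp]: "carrier J = carrier Q" "(\<oplus>\<^bsub>J\<^esub>) = (\<oplus>\<^bsub>Q\<^esub>)" "\<zero>\<^bsub>J\<^esub> = \<zero>\<^bsub>Q\<^esub>"
  by (simp_all add: J_eq)

lemma J_smult: "r \<in> carrier R \<Longrightarrow> x \<in> carrier R \<Longrightarrow> r \<odot>\<^bsub>J\<^esub> cls x = cls (r * x)"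
  by (simp add: J_eq quot_module_smult)

lemma K_comp_1: "h \<in> carrier K \<Longrightarrow> h (Suc 0) \<in> carrier Q"
  using K_comp[of h "Suc 0"] by (simp add: pow_1)

lemma \<sigma>_closed: "q \<in> carrier Q \<Longrightarrow> \<sigma> q \<in> carrier K"
  using sec by (auto simp: linear_section_def)

lemma \<sigma>_add: "q \<in> carrier Q \<Longrightarrow> r \<in> carrier Q \<Longrightarrow> \<sigma> (q \<oplus>\<^bsub>Q\<^esub> r) = \<sigma> q \<oplus>\<^bsub>K\<^esub> \<sigma> r"
  using sec by (auto simp: linear_section_def)

lemma \<sigma>_const: "q \<in> carrier Q \<Longrightarrow> \<sigma> (const c \<odot>\<^bsub>J\<^esub> q) = const c \<odot>\<^bsub>K\<^esub> \<sigma> q"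
  using sec by (auto simp: linear_section_def)

lemma \<sigma>_1: "q \<in> carrier Q \<Longrightarrow> \<sigma> q (Suc 0) = q"
  using sec by (auto simp: linear_section_def from_completion_def)

lemma \<sigma>_zero: "\<sigma> \<zero>\<^bsub>Q\<^esub> = \<zero>\<^bsub>K\<^esub>"
  by (rule additive_zero[OF abelian_group_Q abelian_group_K \<sigma>_closed \<sigma>_add])

lemma smult_comp: "p \<in> carrier R \<Longrightarrow> h \<in> carrier K \<Longrightarrow> x \<in> h n \<Longrightarrow> (p \<odot>\<^bsub>K\<^esub> h) n = P.cls n (p * x)"
  using P.mem_Q_eq[OF K_comp, of h x n] P.mem_Q_carrier[OF K_comp, of h x n]
  by (simp add: K_simps P.cls_mult)

lemma smult_comp_zero: "p \<in> pow n \<Longrightarrow> h \<in> carrier K \<Longrightarrow> (p \<odot>\<^bsub>K\<^esub> h) n = \<zero>\<^bsub>P.Q n\<^esub>"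
proof -
  assume p: "p \<in> pow n" and h: "h \<in> carrier K"
  obtain x where x: "x \<in> carrier R" "x \<in> h n" by (rule K_rep[OF h])
  from P.mult[OF x(1) p] have "p * x \<in> pow n" by (simp add: mult.commute)
  with smult_comp[OF P.subset[OF p] h x(2)] show ?thesis
    by (simp add: P.cls_eq_zero P.subset)
qed

definition summand where "summand r u = tmon m V u \<odot>\<^bsub>K\<^esub> \<sigma> (r u)"

definition dsummand where
  "dsummand i r u = (of_nat (u i) * tmon m V (u(i := u i - 1))) \<odot>\<^bsub>K\<^esub> \<sigma> (r u)"

definition expands where
  "expands r h \<longleftrightarrow> (\<forall>u. r u \<in> carrier Q) \<and> series_sums m V (summand r) h"

lemma summand_closed: "r u \<in> carrier Q \<Longrightarrow> summand r u \<in> carrier K"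
  by (simp add: summand_def K_smult tmon_closed \<sigma>_closed)

lemma summand_comp_zero: "r u \<in> carrier Q \<Longrightarrow> n \<le> (\<Sum>i<m. u i) \<Longrightarrow> summand r u n = \<zero>\<^bsub>P.Q n\<^esub>"
  by (simp add: summand_def smult_comp_zero \<sigma>_closed tmon_in_pow')

lemma dcoeff_closed: "of_nat (u i) * tmon m V (u(i := u i - 1)) \<in> carrier R"
  by (intro poly_ring_intros tmon_closed)

lemma dsummand_closed: "r u \<in> carrier Q \<Longrightarrow> dsummand i r u \<in> carrier K"
  unfolding dsummand_def by (intro K_smult dcoeff_closed \<sigma>_closed)

text \<open>Differentiation lowers the adic order by one, whence the strict inequality where
  \<open>summand_comp_zero\<close> has a weak one.\<close>

lemma dsummand_comp_zero:
  assumes r: "r u \<in> carrier Q" and n: "n < (\<Sum>i<m. u i)"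
  shows "dsummand i r u n = \<zero>\<^bsub>P.Q n\<^esub>"
proof -
  have "(\<Sum>j<m. u j) \<le> (\<Sum>j<m. (u(i := u i - 1)) j + (if j = i then 1 else 0))"
    by (intro sum_mono) auto
  also have "\<dots> \<le> (\<Sum>j<m. (u(i := u i - 1)) j) + 1"
    by (simp add: sum.distrib sum.delta')
  finally have "n \<le> (\<Sum>j<m. (u(i := u i - 1)) j)" using n by simp
  from P.mult[OF poly_ring_of_nat tmon_in_pow'[OF this]]
  show ?thesis unfolding dsummand_def by (intro smult_comp_zero \<sigma>_closed r)
qed

lemma expands_iff:
  "expands r h \<longleftrightarrow> (\<forall>u. r u \<in> carrier Q) \<and> h \<in> carrier K \<and>
    (\<forall>n. (\<Oplus>\<^bsub>K\<^esub>u\<in>MI (Suc n). summand r u) n = h n)"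
  unfolding expands_def using series_sums_iff[of "summand r" h]
  by (auto simp: summand_closed summand_comp_zero)

lemma expands_closed: "expands r h \<Longrightarrow> h \<in> carrier K"
  by (simp add: expands_iff)

text \<open>Terms of degree n vanish at level n, so both bounds give the same component: the
  inductive construction of coefficients uses the smaller one, convergence the larger one.\<close>

lemma sum_summand_diag:
  assumes r: "\<And>u. r u \<in> carrier Q"
  shows "(\<Oplus>\<^bsub>K\<^esub>u\<in>MI (Suc n). summand r u) n = (\<Oplus>\<^bsub>K\<^esub>u\<in>MI n. summand r u) n"
proof -
  interpret Q: abelian_group "P.Q n" by (rule P.abelian_group_Q)
  show ?thesis
    unfolding finsum_K_comp[OF summand_closed[OF r]]
    by (rule Q.add.finprod_mono_neutral_cong_right)
      (use r in \<open>auto simp: K_comp finite_MI summand_closed summand_comp_zero\<close>)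
qed

text \<open>At level N + 1 the remainder of h lies in \<open>pow N\<close>, hence is a form of
  degree N in t. The classes of its coefficients modulo I are the new coefficients, and lower ones
  are left alone.\<close>

lemma expand_step:
  assumes h: "h \<in> carrier K" and r: "\<And>u. r u \<in> carrier Q" and eq: "(\<Oplus>\<^bsub>K\<^esub>u\<in>MI N. summand r u) N = h N"
  shows "\<exists>r'. (\<forall>u. r' u \<in> carrier Q) \<and> (\<forall>u. (\<Sum>i<m. u i) < N \<longrightarrow> r' u = r u) \<and>
    (\<Oplus>\<^bsub>K\<^esub>u\<in>MI (Suc N). summand r' u) (Suc N) = h (Suc N)"
proof -
  interpret K: abelian_group K by (rule abelian_group_K)
  interpret Q: abelian_group "P.Q (Suc N)" by (rule P.abelian_group_Q)
  define S where "S = (\<Oplus>\<^bsub>K\<^esub>u\<in>MI N. summand r u)"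
  have S: "S \<in> carrier K" unfolding S_def by (rule finsum_K_closed) (simp add: summand_closed r)
  obtain x where x: "x \<in> carrier R" "\<And>k. k \<le> Suc N \<Longrightarrow> S k = P.cls k x" by (rule K_rep[OF S, where n = "Suc N"]) (rule that)
  obtain y where y: "y \<in> carrier R" "\<And>k. k \<le> Suc N \<Longrightarrow> h k = P.cls k y" by (rule K_rep[OF h, where n = "Suc N"]) (rule that)
  from eq have "P.cls N y = P.cls N x" using x(2)[of N] y(2)[of N] by (simp add: S_def)
  then have "y - x \<in> pow N" using x(1) y(1) by (simp add: P.cls_eq)
  from pow_subset_span[OF this] obtain f
    where f: "\<And>u. f u \<in> carrier R" "y - x = (\<Sum>u\<in>ME N. tmon m V u * f u)" by (auto simp: span_def)
  define r' where "r' u = (if (\<Sum>i<m. u i) = N then cls (f u) else r u)" for u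
  have r': "r' u \<in> carrier Q" for u using r by (simp add: r'_def cls_closed f)
  have summand: "summand r' u (Suc N) = P.cls (Suc N) (tmon m V u * f u)" if u: "u \<in> ME N" for u
  proof -
    have \<sigma>: "\<sigma> (cls (f u)) \<in> carrier K" by (simp add: \<sigma>_closed cls_closed f)
    obtain z where z: "z \<in> carrier R" "z \<in> \<sigma> (cls (f u)) (Suc N)"
      "\<And>k. k \<le> Suc N \<Longrightarrow> \<sigma> (cls (f u)) k = P.cls k z" by (rule K_rep[OF \<sigma>, where n = "Suc N"]) (rule that)
    have "cls (f u) = P.cls (Suc 0) z" using z(3)[of "Suc 0"] by (simp add: \<sigma>_1 cls_closed f)
    \<comment> \<open>The lift of the class of \<open>f u\<close> differs from \<open>f u\<close> by
      an element of I, so the term of degree N changes only by an element of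
      \<open>pow (Suc N)\<close>.\<close>
    then have "z - f u \<in> I" using z(1) f(1) by (auto simp: pow_1 cls_eq intro: minus_commute)
    from pow_Suc_mult[OF this tmon_in_pow, of u] u
    have "tmon m V u * z - tmon m V u * f u \<in> pow (Suc N)" by (simp add: algebra_simps)
    then have "P.cls (Suc N) (tmon m V u * z) = P.cls (Suc N) (tmon m V u * f u)"
      using z(1) f(1) by (simp add: P.cls_eq poly_ring_mult tmon_closed)
    moreover have "summand r' u (Suc N) = P.cls (Suc N) (tmon m V u * z)"
      using u smult_comp[OF tmon_closed \<sigma> z(2), of u] by (simp add: summand_def r'_def)
    ultimately show ?thesis by simp
  qed
  have "(\<Oplus>\<^bsub>K\<^esub>u\<in>MI (Suc N). summand r' u) = (\<Oplus>\<^bsub>K\<^esub>u\<in>MI N. summand r' u) \<oplus>\<^bsub>K\<^esub> (\<Oplus>\<^bsub>K\<^esub>u\<in>ME N. summand r' u)"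
    unfolding MI_Suc using r' by (intro K.finsum_Un_disjoint finite_MI finite_ME MI_ME_disjoint) (auto simp: summand_closed)
  also have "(\<Oplus>\<^bsub>K\<^esub>u\<in>MI N. summand r' u) = S"
    unfolding S_def using r r' by (intro K.finsum_cong') (auto simp: summand_closed, auto simp: r'_def summand_def)
  finally have "(\<Oplus>\<^bsub>K\<^esub>u\<in>MI (Suc N). summand r' u) (Suc N) = S (Suc N) \<oplus>\<^bsub>P.Q (Suc N)\<^esub> (\<Oplus>\<^bsub>K\<^esub>u\<in>ME N. summand r' u) (Suc N)"
    by (simp add: K_simps)
  also have "(\<Oplus>\<^bsub>K\<^esub>u\<in>ME N. summand r' u) (Suc N) = (\<Oplus>\<^bsub>P.Q (Suc N)\<^esub>u\<in>ME N. P.cls (Suc N) (tmon m V u * f u))"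
    unfolding finsum_K_comp[OF summand_closed[OF r']]
    by (intro Q.finsum_cong') (auto simp: summand intro!: P.cls_closed poly_ring_mult tmon_closed f)
  also have "\<dots> = P.cls (Suc N) (y - x)"
    unfolding f(2) by (intro P.finsum_cls poly_ring_mult tmon_closed f)
  also have "S (Suc N) = P.cls (Suc N) x" using x(2) by simp
  also have "P.cls (Suc N) x \<oplus>\<^bsub>P.Q (Suc N)\<^esub> P.cls (Suc N) (y - x) = P.cls (Suc N) y"
    using x(1) y(1) by (simp add: P.cls_add poly_ring_diff)
  also have "\<dots> = h (Suc N)" using y(2) by simp
  finally have eq': "(\<Oplus>\<^bsub>K\<^esub>u\<in>MI (Suc N). summand r' u) (Suc N) = h (Suc N)" .
  have "r' u = r u" if "(\<Sum>i<m. u i) < N" for u using that by (simp add: r'_def)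
  with r' eq' show ?thesis by blast
qed

lemma Q_0: "q \<in> carrier (P.Q 0) \<Longrightarrow> q = P.cls 0 0"
proof -
  assume "q \<in> carrier (P.Q 0)"
  then obtain x where "x \<in> carrier R" "q = P.cls 0 x" by (auto simp: P.in_Q)
  then show ?thesis using P.cls_eq[of x 0 0] by (simp add: poly_ring_zero ideal_pow.simps(1))
qed

lemma expansion_ex:
  assumes h: "h \<in> carrier K"
  obtains r where "expands r h"
proof -
  interpret K: abelian_group K by (rule abelian_group_K)
  let ?P = "\<lambda>N r. (\<forall>u. r u \<in> carrier Q) \<and> (\<Oplus>\<^bsub>K\<^esub>u\<in>MI N. summand r u) N = h N"
  have e: "MI 0 = {}" by auto
  \<comment> \<open>Level 0 is the quotient by the whole ring, where any two elements agree.\<close>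
  have "\<zero>\<^bsub>K\<^esub> 0 = h 0"
    by (rule trans[OF Q_0[OF K_comp[OF K_zero]] Q_0[OF K_comp[OF h], symmetric]])
  moreover have "(\<Oplus>\<^bsub>K\<^esub>u\<in>MI 0. summand (\<lambda>u. \<zero>\<^bsub>Q\<^esub>) u) = \<zero>\<^bsub>K\<^esub>"
    unfolding e by (rule K.finsum_empty)
  moreover have "\<zero>\<^bsub>Q\<^esub> \<in> carrier Q"
    by (rule abelian_monoid.zero_closed[OF abelian_group.axioms(1)[OF abelian_group_Q]])
  ultimately have "?P 0 (\<lambda>u. \<zero>\<^bsub>Q\<^esub>)"
    by (intro conjI allI) simp_all
  then have base: "\<exists>r. ?P 0 r" by (rule exI[of "?P 0" "\<lambda>u. \<zero>\<^bsub>Q\<^esub>"])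
  have step: "\<exists>r'. ?P (Suc N) r' \<and> (\<forall>u. (\<Sum>i<m. u i) < N \<longrightarrow> r' u = r u)" if r: "?P N r" for N r
  proof -
    from expand_step[OF h conjunct1[OF r, rule_format] conjunct2[OF r]]
    obtain r' where "(\<forall>u. r' u \<in> carrier Q) \<and> (\<forall>u. (\<Sum>i<m. u i) < N \<longrightarrow> r' u = r u) \<and>
      (\<Oplus>\<^bsub>K\<^esub>u\<in>MI (Suc N). summand r' u) (Suc N) = h (Suc N)" ..
    then show ?thesis by (intro exI[of _ r'] conjI) (elim conjE; assumption)+
  qed
  \<comment> \<open>Coefficients of degree below N are frozen from stage N on; the expansion takes
    each coefficient from the first stage at which it is final.\<close>
  from dependent_nat_choice[of ?P "\<lambda>N r r'. \<forall>u. (\<Sum>i<m. u i) < N \<longrightarrow> r' u = r u", OF base step]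
  obtain F where F0: "\<forall>N. ?P N (F N) \<and> (\<forall>u. (\<Sum>i<m. u i) < N \<longrightarrow> F (Suc N) u = F N u)" ..
  have F: "F N u \<in> carrier Q" "(\<Oplus>\<^bsub>K\<^esub>u\<in>MI N. summand (F N) u) N = h N"
    "(\<Sum>i<m. u i) < N \<Longrightarrow> F (Suc N) u = F N u" for N u
    using F0[rule_format, of N] by simp_all
  define r where "r u = F (Suc (\<Sum>i<m. u i)) u" for u
  have F_eq: "F N u = r u" if "(\<Sum>i<m. u i) < N" for N u
    using Suc_leI[OF that] by (induction rule: dec_induct) (simp_all add: r_def F(3))
  have r: "r u \<in> carrier Q" for u by (simp add: r_def F)
  have "(\<Oplus>\<^bsub>K\<^esub>u\<in>MI N. summand r u) N = h N" for N
  proof -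
    have "(\<Oplus>\<^bsub>K\<^esub>u\<in>MI N. summand r u) = (\<Oplus>\<^bsub>K\<^esub>u\<in>MI N. summand (F N) u)"
      using r F(1) by (intro K.finsum_cong') (auto simp: summand_closed, auto simp: summand_def F_eq)
    with F(2) show ?thesis by simp
  qed
  then have "expands r h" by (simp add: expands_iff r h sum_summand_diag)
  then show ?thesis by (rule that)
qed

text \<open>Quasi-regularity enters here. By induction on the degree d the lower coefficients are
  zero, so the form of degree d lies in \<open>pow (Suc d)\<close> and its coefficients lie in
  I.\<close>

lemma expands_vanish:
  assumes r: "expands r h" and h: "h N = \<zero>\<^bsub>P.Q N\<^esub>" and u: "u \<in> multi_indices m" "(\<Sum>i<m. u i) < N"
  shows "r u = \<zero>\<^bsub>Q\<^esub>"
  using u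
proof (induction "\<Sum>i<m. u i" arbitrary: u rule: less_induct)
  case less
  interpret K: abelian_group K by (rule abelian_group_K)
  have rc: "r w \<in> carrier Q" for w using r by (simp add: expands_def)
  have hK: "h \<in> carrier K" using r by (rule expands_closed)
  define d where "d = (\<Sum>i<m. u i)"
  interpret Q: abelian_group "P.Q (Suc d)" by (rule P.abelian_group_Q)
  have "h (Suc d) = \<zero>\<^bsub>P.Q (Suc d)\<^esub>"
    using K_agree[OF hK K_zero, of N "Suc d"] h less.prems by (simp add: d_def K_simps)
  then have "(\<Oplus>\<^bsub>K\<^esub>w\<in>MI (Suc d). summand r w) (Suc d) = \<zero>\<^bsub>P.Q (Suc d)\<^esub>"
    using r sum_summand_diag[of r "Suc d", OF rc] by (simp add: expands_iff)
  moreover have "(\<Oplus>\<^bsub>K\<^esub>w\<in>MI (Suc d). summand r w) = (\<Oplus>\<^bsub>K\<^esub>w\<in>ME d. summand r w)"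
  proof (rule K.add.finprod_mono_neutral_cong_right)
    fix w assume w: "w \<in> MI (Suc d) - ME d"
    then have "r w = \<zero>\<^bsub>Q\<^esub>" using less.prems by (intro less.hyps) (auto simp: d_def)
    interpret M: module R K by (rule module_K)
    show "summand r w = \<zero>\<^bsub>K\<^esub>"
      using \<open>r w = \<zero>\<^bsub>Q\<^esub>\<close> by (simp add: summand_def \<sigma>_zero M.smult_r_null tmon_closed)
  qed (auto simp: finite_MI summand_closed rc)
  ultimately have 0: "(\<Oplus>\<^bsub>P.Q (Suc d)\<^esub>w\<in>ME d. summand r w (Suc d)) = \<zero>\<^bsub>P.Q (Suc d)\<^esub>"
    by (simp add: finsum_K_comp summand_closed rc)
  have "\<exists>y. y \<in> carrier R \<and> summand r w (Suc d) = P.cls (Suc d) (tmon m V w * y) \<and> r w = cls y" for w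
  proof -
    obtain y where y: "y \<in> carrier R" "y \<in> \<sigma> (r w) (Suc d)" "\<And>k. k \<le> Suc d \<Longrightarrow> \<sigma> (r w) k = P.cls k y"
      by (rule K_rep[OF \<sigma>_closed[OF rc], where n = "Suc d"]) (rule that)
    have "r w = cls y" using y(3)[of "Suc 0"] \<sigma>_1[OF rc, of w] by (simp add: pow_1)
    with y(1) smult_comp[OF tmon_closed \<sigma>_closed[OF rc] y(2)] show ?thesis
      by (intro exI[of _ y]) (simp add: summand_def)
  qed
  then have "\<exists>y. \<forall>w. y w \<in> carrier R \<and> summand r w (Suc d) = P.cls (Suc d) (tmon m V w * y w) \<and> r w = cls (y w)"
    by (intro choice allI)
  then obtain y where y0: "\<forall>w. y w \<in> carrier R \<and> summand r w (Suc d) = P.cls (Suc d) (tmon m V w * y w) \<and> r w = cls (y w)" ..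
  have y: "y w \<in> carrier R" "summand r w (Suc d) = P.cls (Suc d) (tmon m V w * y w)" "r w = cls (y w)" for w
    using y0 by simp_all
  have "P.cls (Suc d) (\<Sum>w\<in>ME d. tmon m V w * y w) = \<zero>\<^bsub>P.Q (Suc d)\<^esub>"
    using 0 unfolding y(2) by (subst (asm) P.finsum_cls) (auto intro: poly_ring_mult tmon_closed y)
  then have "(\<Sum>w\<in>ME d. y w * tmon m V w) \<in> pow (Suc d)"
    by (subst (asm) P.cls_eq_zero) (auto intro: poly_ring_sum poly_ring_mult tmon_closed y simp: mult.commute)
  then have "\<forall>w\<in>ME d. y w \<in> I"
    using qr[unfolded quasi_regular_def Let_def, THEN spec[of _ d], THEN spec[of _ y]] y(1)
    unfolding tmon_def[symmetric] jacobi_ideal_def[symmetric] by simp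
  then have "y u \<in> I" using less.prems by (auto simp: d_def)
  then show ?case by (simp add: y cls_eq_zero)
qed

lemma expands_add:
  assumes "expands r g" "expands s h"
  shows "expands (\<lambda>u. r u \<oplus>\<^bsub>Q\<^esub> s u) (g \<oplus>\<^bsub>K\<^esub> h)"
proof -
  interpret M: module R K by (rule module_K)
  interpret Q: abelian_group Q by (rule abelian_group_Q)
  have rs: "r u \<in> carrier Q" "s u \<in> carrier Q" for u using assms by (auto simp: expands_def)
  have "summand (\<lambda>u. r u \<oplus>\<^bsub>Q\<^esub> s u) = (\<lambda>u. summand r u \<oplus>\<^bsub>K\<^esub> summand s u)"
    by (rule ext) (simp add: summand_def \<sigma>_add rs M.smult_r_distr tmon_closed \<sigma>_closed)
  then show ?thesis
    using assms series_sums_add[of "summand r" "summand s" g h] by (simp add: expands_def summand_closed)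
qed

lemma expands_const:
  assumes "expands r g"
  shows "expands (\<lambda>u. const c \<odot>\<^bsub>J\<^esub> r u) (const c \<odot>\<^bsub>K\<^esub> g)"
proof -
  interpret M: module R K by (rule module_K)
  interpret J: module R J by (rule module_J)
  have r: "r u \<in> carrier Q" for u using assms by (auto simp: expands_def)
  have c: "const c \<in> carrier R" by (rule poly_ring_const)
  have "const c \<odot>\<^bsub>J\<^esub> r u \<in> carrier Q" for u using J.smult_closed[OF c] r by simp
  moreover have "summand (\<lambda>u. const c \<odot>\<^bsub>J\<^esub> r u) = (\<lambda>u. const c \<odot>\<^bsub>K\<^esub> summand r u)"
  proof
    fix u
    have "tmon m V u \<odot>\<^bsub>K\<^esub> (const c \<odot>\<^bsub>K\<^esub> \<sigma> (r u)) = (tmon m V u * const c) \<odot>\<^bsub>K\<^esub> \<sigma> (r u)"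
      using M.smult_assoc1[OF tmon_closed c \<sigma>_closed[OF r], of u u] by simp
    also have "\<dots> = const c \<odot>\<^bsub>K\<^esub> (tmon m V u \<odot>\<^bsub>K\<^esub> \<sigma> (r u))"
      using M.smult_assoc1[OF c tmon_closed \<sigma>_closed[OF r], of u u] by (simp add: mult.commute)
    finally show "summand (\<lambda>u. const c \<odot>\<^bsub>J\<^esub> r u) u = const c \<odot>\<^bsub>K\<^esub> summand r u"
      by (simp add: summand_def \<sigma>_const r)
  qed
  ultimately show ?thesis
    using assms series_sums_smult[of "summand r" "const c" g] c by (simp add: expands_def summand_closed)
qed

text \<open>The difference of two expansions of h expands zero. It is formed with the multiple by
  the constant -1, since the section is compatible with sums and constant multiples.\<close>

lemma expands_unique:
  assumes r: "expands r h" and s: "expands s h" and u: "u \<in> multi_indices m"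
  shows "r u = s u"
proof -
  interpret K: module R K by (rule module_K)
  interpret J: module R J by (rule module_J)
  have rs: "r u \<in> carrier J" "s u \<in> carrier J" using assms by (auto simp: expands_def)
  have c: "const c = (- 1 :: 'k pol)" if "c = - 1" for c by (simp add: that const_def single_uminus)
  have neg: "const (- 1) \<odot>\<^bsub>J\<^esub> x = \<ominus>\<^bsub>J\<^esub> x" if "x \<in> carrier J" for x
    using J.smult_l_minus[of 1 x] J.smult_one[OF that] that by (simp add: c poly_ring_one poly_ring_a_inv)
  have "const (- 1) \<odot>\<^bsub>K\<^esub> h = \<ominus>\<^bsub>K\<^esub> h"
    using K.smult_l_minus[of 1 h] K.smult_one[of h] expands_closed[OF r]
    by (simp add: c poly_ring_one poly_ring_a_inv)
  then have "expands (\<lambda>u. r u \<oplus>\<^bsub>Q\<^esub> const (- 1) \<odot>\<^bsub>J\<^esub> s u) \<zero>\<^bsub>K\<^esub>"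
    using expands_add[OF r expands_const[OF s, of "- 1"]] expands_closed[OF r] by (simp add: K.r_neg)
  from expands_vanish[OF this _ u, of "Suc (\<Sum>i<m. u i)"]
  have "r u \<oplus>\<^bsub>J\<^esub> \<ominus>\<^bsub>J\<^esub> s u = \<zero>\<^bsub>J\<^esub>" using neg[OF rs(2)] by (simp add: K_simps)
  with rs show ?thesis using J.minus_equality[of "r u" "\<ominus>\<^bsub>J\<^esub> s u"] J.a_inv_closed[OF rs(2)] by simp
qed

subsection \<open>The connection\<close>

definition unit_index :: "nat \<Rightarrow> nat \<Rightarrow> nat" where
  "unit_index i = (\<lambda>j. if j = i then 1 else 0)"

lemma unit_index_in: "i < m \<Longrightarrow> unit_index i \<in> multi_indices m" "i < m \<Longrightarrow> (\<Sum>j<m. unit_index i j) = 1"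
  by (auto simp: unit_index_def multi_indices_def sum.delta)

lemma index_of_degree_1:
  assumes "u \<in> multi_indices m" "(\<Sum>j<m. u j) < 2" "u i \<noteq> 0" "i < m"
  shows "u = unit_index i"
proof
  fix j
  have le: "(\<Sum>j\<in>{i}. u j) \<le> (\<Sum>j<m. u j)" using assms by (intro sum_mono2) auto
  show "u j = unit_index i j"
  proof (cases "j = i")
    case True with assms le show ?thesis by (simp add: unit_index_def)
  next
    case False
    have "(\<Sum>j\<in>{i, j}. u j) \<le> (\<Sum>j<m. u j)" if "j < m" using assms that by (intro sum_mono2) auto
    with False assms show ?thesis by (cases "j < m") (auto simp: unit_index_def multi_indices_def)
  qed
qed

text \<open>The definite description in \<open>conn\<close> is met by exactly one element: the
  differentiated series converges, and uniqueness of expansions fixes its terms.\<close>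

lemma conn_expands:
  assumes r: "expands r h"
  shows "series_sums m V (dsummand i r) (conn m V \<sigma> i h)"
proof -
  have rc: "r u \<in> carrier Q" for u using r by (simp add: expands_def)
  obtain g where g: "series_sums m V (dsummand i r) g"
    by (rule series_sums_ex[of "dsummand i r"]) (auto simp: dsummand_closed dsummand_comp_zero rc)
  have "conn m V \<sigma> i h = g"
    unfolding conn_def
  proof (rule the_equality)
    show "\<exists>r. (\<forall>u. r u \<in> carrier J) \<and> series_sums m V (\<lambda>u. tmon m V u \<odot>\<^bsub>K\<^esub> \<sigma> (r u)) h \<and>
      series_sums m V (\<lambda>u. (of_nat (u i) * tmon m V (u(i := u i - 1))) \<odot>\<^bsub>K\<^esub> \<sigma> (r u)) g"
      using r g by (intro exI[of _ r]) (simp add: expands_def summand_def[abs_def] dsummand_def[abs_def])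
  next
    fix g' assume "\<exists>r. (\<forall>u. r u \<in> carrier J) \<and> series_sums m V (\<lambda>u. tmon m V u \<odot>\<^bsub>K\<^esub> \<sigma> (r u)) h \<and>
      series_sums m V (\<lambda>u. (of_nat (u i) * tmon m V (u(i := u i - 1))) \<odot>\<^bsub>K\<^esub> \<sigma> (r u)) g'"
    then obtain s where s: "expands s h" "series_sums m V (dsummand i s) g'"
      by (auto simp: expands_def summand_def[abs_def] dsummand_def[abs_def])
    show "g' = g"
    proof (rule series_sums_unique[OF s(2) g])
      show "dsummand i s u = dsummand i r u" if "u \<in> multi_indices m" for u
        using expands_unique[OF s(1) r that] by (simp add: dsummand_def)
    qed (use s(1) rc in \<open>auto simp: dsummand_closed expands_def\<close>)
  qed
  with g show ?thesis by simp
qed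

lemma conn_closed: "h \<in> carrier K \<Longrightarrow> conn m V \<sigma> i h \<in> carrier K"
  by (metis expansion_ex conn_expands series_sums_def)

text \<open>Modulo I only those terms of the derivative survive that have no factor t left, and such
  a term arises from the exponent \<open>unit_index i\<close> alone.\<close>

lemma from_completion_conn:
  assumes r: "expands r h" and i: "i < m"
  shows "from_completion (conn m V \<sigma> i h) = r (unit_index i)"
proof -
  interpret K: abelian_group K by (rule abelian_group_K)
  interpret M: module R K by (rule module_K)
  have rc: "r u \<in> carrier Q" for u using r by (simp add: expands_def)
  have t1: "tmon m V ((unit_index i)(i := 0)) = 1" 
    unfolding tmon_def tpow_def by (rule prod.neutral) (simp add: unit_index_def)
  have eq: "dsummand i r (unit_index i) = \<sigma> (r (unit_index i))"
    using M.smult_one[OF \<sigma>_closed[OF rc], of "unit_index i"] t1 by (simp add: dsummand_def, simp add: unit_index_def)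
  \<comment> \<open>The bound is 2, not 1: at level 1 the derivatives of the linear terms still
    count.\<close>
  have "(\<Oplus>\<^bsub>K\<^esub>u\<in>MI 2. dsummand i r u) = (\<Oplus>\<^bsub>K\<^esub>u\<in>{unit_index i}. dsummand i r u)"
  proof (rule K.add.finprod_mono_neutral_cong_right)
    show "{unit_index i} \<subseteq> MI 2" using i by (auto simp: unit_index_in)
    fix u assume u: "u \<in> MI 2 - {unit_index i}"
    then have "u i = 0" using index_of_degree_1[of u i] i by auto
    then show "dsummand i r u = \<zero>\<^bsub>K\<^esub>"
      using M.smult_l_null[OF \<sigma>_closed[OF rc], of u] by (simp add: dsummand_def)
  qed (auto simp: finite_MI dsummand_closed rc)
  also have "\<dots> = \<sigma> (r (unit_index i))"
    using K.finsum_singleton[of "unit_index i" "{unit_index i}" "dsummand i r"]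
    by (simp add: dsummand_closed rc eq[symmetric])
  finally have "(\<Oplus>\<^bsub>K\<^esub>u\<in>MI (Suc (Suc 0)). dsummand i r u) (Suc 0) = r (unit_index i)"
    by (simp add: \<sigma>_1 rc numeral_2_eq_2)
  moreover have "(\<Oplus>\<^bsub>K\<^esub>u\<in>MI (Suc (Suc 0)). dsummand i r u) (Suc 0) = conn m V \<sigma> i h (Suc 0)"
    using conn_expands[OF r, of i] series_sums_iff[of "dsummand i r" "conn m V \<sigma> i h"]
    by (auto simp: dsummand_closed dsummand_comp_zero rc)
  ultimately show ?thesis by (simp add: from_completion_def)
qed

definition dcoef where "dcoef i h = from_completion (conn m V \<sigma> i h)"

lemma dcoef_eq: "expands r h \<Longrightarrow> i < m \<Longrightarrow> dcoef i h = r (unit_index i)"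
  by (simp add: dcoef_def from_completion_conn)

lemma dcoef_closed: "h \<in> carrier K \<Longrightarrow> dcoef i h \<in> carrier Q"
  unfolding dcoef_def from_completion_def using K_comp_1[OF conn_closed] by simp

lemma dcoef_add: "g \<in> carrier K \<Longrightarrow> h \<in> carrier K \<Longrightarrow> i < m \<Longrightarrow>
    dcoef i (g \<oplus>\<^bsub>K\<^esub> h) = dcoef i g \<oplus>\<^bsub>Q\<^esub> dcoef i h"
proof -
  assume g: "g \<in> carrier K" and h: "h \<in> carrier K" and i: "i < m"
  obtain r where r: "expands r g" by (rule expansion_ex[OF g])
  obtain s where s: "expands s h" by (rule expansion_ex[OF h])
  show ?thesis using dcoef_eq[OF r i] dcoef_eq[OF s i] dcoef_eq[OF expands_add[OF r s] i] by simp
qed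

lemma dcoef_const: "g \<in> carrier K \<Longrightarrow> i < m \<Longrightarrow> dcoef i (const c \<odot>\<^bsub>K\<^esub> g) = const c \<odot>\<^bsub>J\<^esub> dcoef i g"
proof -
  assume g: "g \<in> carrier K" and i: "i < m"
  obtain r where r: "expands r g" by (rule expansion_ex[OF g])
  show ?thesis using dcoef_eq[OF r i] dcoef_eq[OF expands_const[OF r] i] by simp
qed

lemma dcoef_vanish: "h \<in> carrier K \<Longrightarrow> h 2 = \<zero>\<^bsub>P.Q 2\<^esub> \<Longrightarrow> i < m \<Longrightarrow> dcoef i h = \<zero>\<^bsub>Q\<^esub>"
proof -
  assume h: "h \<in> carrier K" "h 2 = \<zero>\<^bsub>P.Q 2\<^esub>" and i: "i < m"
  obtain r where r: "expands r h" by (rule expansion_ex[OF h(1)])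
  show ?thesis using dcoef_eq[OF r i] expands_vanish[OF r h(2)] i by (simp add: unit_index_in)
qed

text \<open>The coefficient of \<open>t\<^sub>i\<close> in an expansion is determined modulo the
  square of the ideal. This is what allows power series to be replaced by polynomials.\<close>

lemma dcoef_cong: "g \<in> carrier K \<Longrightarrow> h \<in> carrier K \<Longrightarrow> g 2 = h 2 \<Longrightarrow> i < m \<Longrightarrow> dcoef i g = dcoef i h"
proof -
  assume g: "g \<in> carrier K" and h: "h \<in> carrier K" and eq: "g 2 = h 2" and i: "i < m"
  interpret K: abelian_group K by (rule abelian_group_K)
  interpret Q: abelian_group Q by (rule abelian_group_Q)
  interpret Q2: abelian_group "P.Q 2" by (rule P.abelian_group_Q)
  have "(g \<ominus>\<^bsub>K\<^esub> h) 2 = \<zero>\<^bsub>P.Q 2\<^esub>"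
    using K_comp[OF h, of 2] by (subst K_minus_comp[OF g h]) (simp only: eq a_minus_def Q2.r_neg)
  then have "dcoef i (g \<ominus>\<^bsub>K\<^esub> h) = \<zero>\<^bsub>Q\<^esub>" using dcoef_vanish[OF _ _ i] g h by simp
  moreover have "g = (g \<ominus>\<^bsub>K\<^esub> h) \<oplus>\<^bsub>K\<^esub> h" using g h by (simp add: a_minus_def K.a_assoc K.l_neg)
  ultimately show ?thesis
    using dcoef_add[of "g \<ominus>\<^bsub>K\<^esub> h" h i] g h i dcoef_closed[OF h] by simp
qed

lemma expands_single:
  assumes q: "q \<in> carrier Q" and j: "j < m"
  shows "expands (\<lambda>u. if u = unit_index j then q else \<zero>\<^bsub>Q\<^esub>) (t j \<odot>\<^bsub>K\<^esub> \<sigma> q)" (is "expands ?r _")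
proof -
  interpret K: abelian_group K by (rule abelian_group_K)
  interpret M: module R K by (rule module_K)
  interpret Q: abelian_group Q by (rule abelian_group_Q)
  have rc: "?r u \<in> carrier Q" for u using q by simp
  have "tmon m V (unit_index j) = (\<Prod>i<m. if i = j then t i else 1)"
    unfolding tmon_def tpow_def by (rule prod.cong) (simp_all add: unit_index_def)
  then have tj: "tmon m V (unit_index j) = t j" using j by (simp add: prod.delta)
  have tc: "t j \<odot>\<^bsub>K\<^esub> \<sigma> q \<in> carrier K" by (intro K_smult t_closed \<sigma>_closed q)
  have "(\<Oplus>\<^bsub>K\<^esub>u\<in>MI (Suc n). summand ?r u) n = (t j \<odot>\<^bsub>K\<^esub> \<sigma> q) n" for n
  proof (cases "n = 0")
    \<comment> \<open>At level 0 the partial sum does not reach \<open>unit_index j\<close>, but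
      there the quotient is the zero ring.\<close>
    case True
    show ?thesis unfolding True
      by (rule trans[OF Q_0[OF K_comp[OF finsum_K_closed[of "summand ?r", OF summand_closed[where r = ?r, OF rc]]]]
            Q_0[OF K_comp[OF tc], symmetric]])
  next
    case False
    have "(\<Oplus>\<^bsub>K\<^esub>u\<in>MI (Suc n). summand ?r u) = (\<Oplus>\<^bsub>K\<^esub>u\<in>{unit_index j}. summand ?r u)"
    proof (rule K.add.finprod_mono_neutral_cong_right)
      show "{unit_index j} \<subseteq> MI (Suc n)" using j False by (auto simp: unit_index_in)
      fix u assume u: "u \<in> MI (Suc n) - {unit_index j}"
      then show "summand ?r u = \<zero>\<^bsub>K\<^esub>"
        by (simp add: summand_def \<sigma>_zero tmon_closed)
    qed (use summand_closed[where r = ?r, OF rc] in \<open>auto simp: finite_MI\<close>)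
    also have "\<dots> = t j \<odot>\<^bsub>K\<^esub> \<sigma> q"
      using K.finsum_singleton[of "unit_index j" "{unit_index j}" "summand ?r"] tc
      by (simp add: summand_closed rc q tj summand_def)
    finally show ?thesis by simp
  qed
  with rc tc show ?thesis by (simp add: expands_iff)
qed

text \<open>A product rule without k[y]-linearity: modulo I^2, \<open>t j\<close> times h equals
  \<open>t j\<close> times the lift of the class of h modulo I, and the latter product has a
  one-term expansion.\<close>

lemma dcoef_t:
  assumes h: "h \<in> carrier K" and i: "i < m" and j: "j < m"
  shows "dcoef i (t j \<odot>\<^bsub>K\<^esub> h) = (if i = j then h 1 else \<zero>\<^bsub>Q\<^esub>)"
proof -
  have q: "h (Suc 0) \<in> carrier Q" by (rule K_comp_1[OF h])
  have s: "\<sigma> (h (Suc 0)) \<in> carrier K" by (rule \<sigma>_closed[OF q])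
  obtain x where x: "x \<in> carrier R" "x \<in> h 2" "\<And>k. k \<le> 2 \<Longrightarrow> h k = P.cls k x"
    by (rule K_rep[OF h, where n = 2]) (rule that)
  obtain y where y: "y \<in> carrier R" "y \<in> \<sigma> (h (Suc 0)) 2"
    "\<And>k. k \<le> 2 \<Longrightarrow> \<sigma> (h (Suc 0)) k = P.cls k y" by (rule K_rep[OF s, where n = 2]) (rule that)
  have "P.cls (Suc 0) x = P.cls (Suc 0) y" using x(3)[of "Suc 0"] y(3)[of "Suc 0"] \<sigma>_1[OF q] by simp
  then have "x - y \<in> pow (Suc 0)" using x(1) y(1) by (simp add: P.cls_eq)
  from pow_Suc_mult[OF t_in_I[OF j] this] have "t j * x - t j * y \<in> pow 2"
    by (simp add: algebra_simps numeral_2_eq_2)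
  then have "(t j \<odot>\<^bsub>K\<^esub> h) 2 = (t j \<odot>\<^bsub>K\<^esub> \<sigma> (h (Suc 0))) 2"
    using smult_comp[OF t_closed h x(2)] smult_comp[OF t_closed s y(2)] x(1) y(1)
    by (simp add: P.cls_eq poly_ring_mult t_closed)
  then have "dcoef i (t j \<odot>\<^bsub>K\<^esub> h) = dcoef i (t j \<odot>\<^bsub>K\<^esub> \<sigma> (h (Suc 0)))"
    by (intro dcoef_cong i K_smult t_closed h s)
  also have "\<dots> = (if i = j then h 1 else \<zero>\<^bsub>Q\<^esub>)"
    using dcoef_eq[OF expands_single[OF q j] i] by (auto simp: unit_index_def fun_eq_iff)
  finally show ?thesis .
qed

lemma conn_zero: "conn m V \<sigma> i \<zero>\<^bsub>K\<^esub> = \<zero>\<^bsub>K\<^esub>"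
proof -
  interpret K: abelian_group K by (rule abelian_group_K)
  interpret M: module R K by (rule module_K)
  interpret Q: abelian_group Q by (rule abelian_group_Q)
  have 0: "summand (\<lambda>u. \<zero>\<^bsub>Q\<^esub>) = (\<lambda>u. \<zero>\<^bsub>K\<^esub>)" "dsummand i (\<lambda>u. \<zero>\<^bsub>Q\<^esub>) = (\<lambda>u. \<zero>\<^bsub>K\<^esub>)"
    using M.smult_r_null[OF dcoeff_closed]
    by (auto simp: summand_def[abs_def] dsummand_def[abs_def] \<sigma>_zero tmon_closed)
  have z: "series_sums m V (\<lambda>u. \<zero>\<^bsub>K\<^esub>) \<zero>\<^bsub>K\<^esub>" by (simp add: series_sums_def)
  with 0 have "expands (\<lambda>u. \<zero>\<^bsub>Q\<^esub>) \<zero>\<^bsub>K\<^esub>" by (simp add: expands_def)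
  from conn_expands[OF this, of i] have "series_sums m V (\<lambda>u. \<zero>\<^bsub>K\<^esub>) (conn m V \<sigma> i \<zero>\<^bsub>K\<^esub>)"
    by (simp add: 0)
  from series_sums_unique[OF this z] show ?thesis by simp
qed

subsection \<open>The derivative modulo the Jacobi ideal, on polynomials\<close>

text \<open>A choice of representatives, hence additive only modulo the ideal.\<close>

definition D :: "nat \<Rightarrow> 'k pol \<Rightarrow> 'k pol" where
  "D i f = (if f \<in> carrier R \<and> f \<noteq> 0 then SOME g. g \<in> carrier R \<and> cls g = dcoef i (\<epsilon> f) else 0)"

text \<open>Choosing 0 as the representative at 0 makes the coefficientwise derivative preserve
  finite support and parity.\<close>

lemma D_zero [simp]: "D i 0 = 0"
  by (simp add: D_def)

lemma D_closed: "D i f \<in> carrier R" and cls_D: "f \<in> carrier R \<Longrightarrow> cls (D i f) = dcoef i (\<epsilon> f)"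
proof -
  have *: "D i f \<in> carrier R \<and> cls (D i f) = dcoef i (\<epsilon> f)" if f: "f \<in> carrier R" "f \<noteq> 0"
  proof -
    have "\<exists>g. g \<in> carrier R \<and> cls g = dcoef i (\<epsilon> f)"
      using dcoef_closed[OF \<epsilon>_closed[OF f(1)], of i] unfolding in_Q by metis
    from someI_ex[OF this] f show ?thesis by (simp add: D_def)
  qed
  show "D i f \<in> carrier R"
  proof (cases "f \<in> carrier R \<and> f \<noteq> 0")
    case True
    with * show ?thesis by blast
  next
    case False
    then have "D i f = 0" unfolding D_def by (rule if_not_P)
    then show ?thesis by (simp add: poly_ring_zero)
  qed
  have "cls 0 = dcoef i (\<epsilon> 0)"
    unfolding \<epsilon>_zero dcoef_def conn_zero from_completion_def by (simp add: K_simps P.cls_zero pow_1)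
  with * show "f \<in> carrier R \<Longrightarrow> cls (D i f) = dcoef i (\<epsilon> f)" by (cases "f = 0") simp_all
qed

lemma D_add: "f \<in> carrier R \<Longrightarrow> g \<in> carrier R \<Longrightarrow> i < m \<Longrightarrow> D i (f + g) - (D i f + D i g) \<in> I"
  by (subst cls_eq[symmetric])
    (simp_all add: poly_ring_add D_closed cls_D \<epsilon>_add dcoef_add \<epsilon>_closed flip: cls_add)

lemma D_const: "f \<in> carrier R \<Longrightarrow> i < m \<Longrightarrow> D i (const c * f) - const c * D i f \<in> I"
  by (subst cls_eq[symmetric])
    (simp_all add: poly_ring_mult poly_ring_const D_closed cls_D \<epsilon>_smult dcoef_const \<epsilon>_closed flip: J_smult)

lemma D_t: "f \<in> carrier R \<Longrightarrow> i < m \<Longrightarrow> j < m \<Longrightarrow> D i (t j * f) - (if i = j then f else 0) \<in> I"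
  by (subst cls_eq[symmetric])
    (simp_all add: poly_ring_mult poly_ring_zero t_closed D_closed cls_D \<epsilon>_smult dcoef_t \<epsilon>_closed
      \<epsilon>_comp pow_1 cls_zero)

lemma from_completion_conn_rep:
  assumes h: "h \<in> carrier K" and f: "f \<in> carrier R" "h 2 = P.cls 2 f" and i: "i < m"
  shows "from_completion (conn m V \<sigma> i h) = cls (D i f)"
  using dcoef_cong[OF h \<epsilon>_closed[OF f(1)] _ i] f by (simp add: \<epsilon>_comp cls_D dcoef_def)

end

section \<open>Coefficient modules and tensor products\<close>

text \<open>The instances are the quotient maps, the canonical map into the completion and the
  projections of the completion to its levels; operators given by polynomial matrices commute with
  all of them.\<close>

definition coeff_hom :: "'r ring \<Rightarrow> ('r, 'e, 'y) module_scheme \<Rightarrow> ('r, 'f, 'z) module_scheme \<Rightarrow> ('e \<Rightarrow> 'f) \<Rightarrow> bool" where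
  "coeff_hom R M N \<phi> \<longleftrightarrow> module R M \<and> module R N \<and> (\<forall>x\<in>carrier M. \<phi> x \<in> carrier N) \<and>
     (\<forall>x\<in>carrier M. \<forall>y\<in>carrier M. \<phi> (x \<oplus>\<^bsub>M\<^esub> y) = \<phi> x \<oplus>\<^bsub>N\<^esub> \<phi> y) \<and>
     (\<forall>r\<in>carrier R. \<forall>x\<in>carrier M. \<phi> (r \<odot>\<^bsub>M\<^esub> x) = r \<odot>\<^bsub>N\<^esub> \<phi> x)"

context
  fixes R M N \<phi>
  assumes hom: "coeff_hom R M N \<phi>"
begin

lemma coeff_hom_modules: "module R M" "module R N"
  using hom by (auto simp: coeff_hom_def)

lemma coeff_hom_groups: "abelian_group M" "abelian_group N"
  using coeff_hom_modules by (auto simp: module_def)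

lemma coeff_hom_closed: "x \<in> carrier M \<Longrightarrow> \<phi> x \<in> carrier N"
  and coeff_hom_add: "x \<in> carrier M \<Longrightarrow> y \<in> carrier M \<Longrightarrow> \<phi> (x \<oplus>\<^bsub>M\<^esub> y) = \<phi> x \<oplus>\<^bsub>N\<^esub> \<phi> y"
  and coeff_hom_smult: "r \<in> carrier R \<Longrightarrow> x \<in> carrier M \<Longrightarrow> \<phi> (r \<odot>\<^bsub>M\<^esub> x) = r \<odot>\<^bsub>N\<^esub> \<phi> x"
  using hom by (auto simp: coeff_hom_def)

lemma coeff_hom_zero: "\<phi> \<zero>\<^bsub>M\<^esub> = \<zero>\<^bsub>N\<^esub>"
  by (rule additive_zero[OF coeff_hom_groups coeff_hom_closed coeff_hom_add])

lemma coeff_hom_finsum: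
  "(\<And>i. i \<in> S \<Longrightarrow> f i \<in> carrier M) \<Longrightarrow> \<phi> (\<Oplus>\<^bsub>M\<^esub>i\<in>S. f i) = (\<Oplus>\<^bsub>N\<^esub>i\<in>S. \<phi> (f i))"
  by (rule finsum_hom[OF coeff_hom_groups(1)[THEN abelian_group.axioms(1)]
        coeff_hom_groups(2)[THEN abelian_group.axioms(1)]])
    (auto simp: coeff_hom_closed coeff_hom_add coeff_hom_zero)

end

lemma finsum_nonzero_ex:
  assumes "abelian_monoid M" "(\<Oplus>\<^bsub>M\<^esub>i\<in>S. f i) \<noteq> \<zero>\<^bsub>M\<^esub>"
  shows "\<exists>i\<in>S. f i \<noteq> \<zero>\<^bsub>M\<^esub>"
proof (rule ccontr)
  interpret abelian_monoid M by fact
  assume "\<not> (\<exists>i\<in>S. f i \<noteq> \<zero>\<^bsub>M\<^esub>)"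
  then have "(\<Oplus>\<^bsub>M\<^esub>i\<in>S. f i) = \<zero>\<^bsub>M\<^esub>" by (intro add.finprod_one_eqI) auto
  with assms(2) show False ..
qed

lemma self_module_simps [simp]: "carrier (self_module R) = carrier R" "(\<oplus>\<^bsub>self_module R\<^esub>) = (\<oplus>\<^bsub>R\<^esub>)"
  "\<zero>\<^bsub>self_module R\<^esub> = \<zero>\<^bsub>R\<^esub>" "(\<odot>\<^bsub>self_module R\<^esub>) = (\<otimes>\<^bsub>R\<^esub>)"
  by (simp_all add: self_module_def ring.defs)

lemma finsum_self_module:
  fixes f :: "'i \<Rightarrow> 'k::comm_ring_1 pol"
  assumes "\<And>i. i \<in> S \<Longrightarrow> f i \<in> carrier (poly_ring A)"
  shows "(\<Oplus>\<^bsub>self_module (poly_ring A)\<^esub>i\<in>S. f i) = (\<Sum>i\<in>S. f i)"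
proof -
  interpret module "poly_ring A" "self_module (poly_ring A :: 'k pol ring)"
    by (rule module_self) (rule cring_poly_ring)
  show ?thesis using assms
  proof (induction S rule: infinite_finite_induct)
    case (insert i S)
    have "(\<Oplus>\<^bsub>self_module (poly_ring A)\<^esub>i\<in>insert i S. f i)
        = f i \<oplus>\<^bsub>self_module (poly_ring A)\<^esub> (\<Oplus>\<^bsub>self_module (poly_ring A)\<^esub>i\<in>S. f i)"
      using insert by (intro M.finsum_insert) auto
    also have "(\<Oplus>\<^bsub>self_module (poly_ring A)\<^esub>i\<in>S. f i) = (\<Sum>i\<in>S. f i)" using insert by simp
    finally show ?case using insert by simp
  next
    case (infinite S)
    have "(\<Oplus>\<^bsub>self_module (poly_ring A)\<^esub>i\<in>S. f i) = \<zero>\<^bsub>self_module (poly_ring A)\<^esub>"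
      by (rule M.finsum_infinite) fact
    with infinite show ?case by simp
  next
    case empty
    show ?case unfolding M.finsum_empty by simp
  qed
qed

section \<open>Tensor products with an arbitrary coefficient module, in the chosen bases\<close>

locale tensor_setup =
  fixes n m l :: nat and X :: "('k::comm_ring_1 pol, 'b) mfact" and Y :: "('k pol, 'a) mfact"
  assumes fin: "finite (basis X)" "finite (basis Y)"
    and X_mat: "\<And>a b. a \<in> basis X \<Longrightarrow> b \<in> basis X \<Longrightarrow>
      mat X a b \<in> carrier (poly_ring (VX ` {..<n} \<union> VY ` {..<m}))"
    and Y_mat: "\<And>a b. a \<in> basis Y \<Longrightarrow> b \<in> basis Y \<Longrightarrow>
      mat Y a b \<in> carrier (poly_ring (VY ` {..<m} \<union> VZ ` {..<l}))"
begin

abbreviation AV where "AV \<equiv> xz_vars n l \<union> VY ` {..<m}"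
abbreviation PR where "PR \<equiv> (poly_ring AV :: 'k pol ring)"
abbreviation KY where "KY \<equiv> (ky m :: 'k pol ring)"

definition Xmat :: "('b \<Rightarrow> 'b \<Rightarrow> 'k pol) \<Rightarrow> bool" where
  "Xmat A \<longleftrightarrow> (\<forall>a\<in>basis X. \<forall>b\<in>basis X. A a b \<in> carrier PR)"

definition Ymat :: "('a \<Rightarrow> 'a \<Rightarrow> 'k pol) \<Rightarrow> bool" where
  "Ymat A \<longleftrightarrow> (\<forall>a\<in>basis Y. \<forall>b\<in>basis Y. A a b \<in> carrier PR)"

lemma Xmat_X: "Xmat (mat X)"
  unfolding Xmat_def using X_mat by (auto intro: poly_ring_mono simp: xz_vars_def)

lemma Ymat_Y: "Ymat (mat Y)"
  unfolding Ymat_def using Y_mat by (auto intro: poly_ring_mono simp: xz_vars_def)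

lemma Xmat_pdiff: "Xmat A \<Longrightarrow> Xmat (\<lambda>b c. pdiff v (A b c))"
  by (auto simp: Xmat_def poly_ring_pdiff)

lemma scalar_closed: "p \<in> carrier PR \<Longrightarrow> \<kappa> \<in> Poly_Mapping.keys p \<Longrightarrow> Poly_Mapping.single (ypart \<kappa>) c \<in> carrier KY"
  by (rule poly_ring_single) (auto simp: poly_ring_def keys_ypart xz_vars_def)

lemma xzpart_vars: "p \<in> carrier PR \<Longrightarrow> \<kappa> \<in> Poly_Mapping.keys p \<Longrightarrow> Poly_Mapping.keys (xzpart \<kappa>) \<subseteq> xz_vars n l"
proof -
  assume "p \<in> carrier PR" "\<kappa> \<in> Poly_Mapping.keys p"
  then have "Poly_Mapping.keys \<kappa> \<subseteq> AV" by (auto simp: poly_ring_def)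
  then show ?thesis by (auto simp: keys_xzpart)
qed

lemma pol_act_closed:
  assumes M: "module KY M" and p: "p \<in> carrier PR" and f: "\<And>\<nu>. f \<nu> \<in> carrier M"
  shows "pol_act M p f \<mu> \<in> carrier M"
proof -
  interpret M: module KY M by fact
  show ?thesis unfolding pol_act_def
    by (rule M.finsum_closed) (auto intro!: M.smult_closed scalar_closed p f)
qed

text \<open>Locates the support of a product; its finiteness and the variables that it may involve
  are read off from this.\<close>

lemma pol_act_nonzero:
  assumes M: "module KY M" and p: "p \<in> carrier PR" and nz: "pol_act M p f \<mu> \<noteq> \<zero>\<^bsub>M\<^esub>"
  shows "\<exists>\<kappa>\<in>Poly_Mapping.keys p. \<exists>\<nu>. \<mu> = xzpart \<kappa> + \<nu> \<and> f \<nu> \<noteq> \<zero>\<^bsub>M\<^esub>"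
proof -
  interpret M: module KY M by fact
  from finsum_nonzero_ex[OF M.abelian_monoid_axioms nz[unfolded pol_act_def]]
  obtain \<kappa> \<nu> where \<kappa>: "\<kappa> \<in> Poly_Mapping.keys p" "\<mu> = xzpart \<kappa> + \<nu>"
    and ne: "Poly_Mapping.single (ypart \<kappa>) (Poly_Mapping.lookup p \<kappa>) \<odot>\<^bsub>M\<^esub> f (\<mu> - xzpart \<kappa>) \<noteq> \<zero>\<^bsub>M\<^esub>"
    by auto
  then have "f \<nu> \<noteq> \<zero>\<^bsub>M\<^esub>"
    using M.smult_r_null[OF scalar_closed[OF p \<kappa>(1)]] by auto
  with \<kappa> show ?thesis by blast
qed

lemma pol_act_hom:
  assumes \<phi>: "coeff_hom KY M N \<phi>" and p: "p \<in> carrier PR" and f: "\<And>\<nu>. f \<nu> \<in> carrier M"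
  shows "\<phi> (pol_act M p f \<mu>) = pol_act N p (\<lambda>\<nu>. \<phi> (f \<nu>)) \<mu>"
proof -
  interpret M: module KY M using coeff_hom_modules[OF \<phi>] by simp
  interpret N: module KY N using coeff_hom_modules[OF \<phi>] by simp
  let ?S = "{\<kappa> \<in> Poly_Mapping.keys p. \<exists>\<nu>. \<mu> = xzpart \<kappa> + \<nu>}"
  let ?s = "\<lambda>\<kappa>. Poly_Mapping.single (ypart \<kappa>) (Poly_Mapping.lookup p \<kappa>)"
  have s: "?s \<kappa> \<in> carrier KY" if "\<kappa> \<in> ?S" for \<kappa> using that by (auto intro: scalar_closed p)
  have "\<phi> (pol_act M p f \<mu>) = (\<Oplus>\<^bsub>N\<^esub>\<kappa>\<in>?S. \<phi> (?s \<kappa> \<odot>\<^bsub>M\<^esub> f (\<mu> - xzpart \<kappa>)))"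
    unfolding pol_act_def by (rule coeff_hom_finsum[OF \<phi>]) (rule M.smult_closed[OF s f])
  also have "\<dots> = pol_act N p (\<lambda>\<nu>. \<phi> (f \<nu>)) \<mu>"
    unfolding pol_act_def
  proof (rule N.finsum_cong'[OF refl])
    show "(\<lambda>\<kappa>. ?s \<kappa> \<odot>\<^bsub>N\<^esub> \<phi> (f (\<mu> - xzpart \<kappa>))) \<in> ?S \<rightarrow> carrier N"
      using s f coeff_hom_closed[OF \<phi>] N.smult_closed by blast
    show "\<phi> (?s \<kappa> \<odot>\<^bsub>M\<^esub> f (\<mu> - xzpart \<kappa>)) = ?s \<kappa> \<odot>\<^bsub>N\<^esub> \<phi> (f (\<mu> - xzpart \<kappa>))" if "\<kappa> \<in> ?S" for \<kappa>
      by (rule coeff_hom_smult[OF \<phi> s[OF that] f])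
  qed
  finally show ?thesis .
qed

lemma pol_act_self:
  assumes p: "p \<in> carrier PR" and f: "\<And>\<nu>. f \<nu> \<in> carrier KY"
  shows "pol_act (ky_module m) p f \<mu> = mact p f \<mu>"
proof -
  let ?S = "{\<kappa> \<in> Poly_Mapping.keys p. \<exists>\<nu>. \<mu> = xzpart \<kappa> + \<nu>}"
  have "pol_act (ky_module m) p f \<mu>
      = (\<Sum>\<kappa>\<in>?S. Poly_Mapping.single (ypart \<kappa>) (Poly_Mapping.lookup p \<kappa>) * f (\<mu> - xzpart \<kappa>))"
    unfolding pol_act_def
    by (subst finsum_self_module) (auto intro!: poly_ring_mult scalar_closed p f)
  also have "\<dots> = (\<Sum>\<kappa>\<in>?S. mono_act \<kappa> (Poly_Mapping.lookup p \<kappa>) f \<mu>)"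
    by (rule sum.cong) (auto simp: mono_act_def)
  also have "\<dots> = (\<Sum>\<kappa>\<in>Poly_Mapping.keys p. mono_act \<kappa> (Poly_Mapping.lookup p \<kappa>) f \<mu>)"
    by (rule sum.mono_neutral_left) (auto simp: mono_act_def)
  finally show ?thesis by (simp add: mact_def sum_fun_apply)
qed

abbreviation TC :: "('k pol, 'e) module \<Rightarrow> ('a \<times> 'b \<Rightarrow> mono \<Rightarrow> 'e) set" where
  "TC M \<equiv> tensor_carrier n l M Y X"

abbreviation T :: "('k pol, 'e) module \<Rightarrow> ('k pol, 'a \<times> 'b \<Rightarrow> mono \<Rightarrow> 'e) gmodule" where
  "T M \<equiv> tensor n l M Y X"

lemma TC_closed: "v \<in> TC M \<Longrightarrow> v e \<mu> \<in> carrier M"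
  unfolding tensor_carrier_def by blast

lemma TC_supp: "v \<in> TC M \<Longrightarrow> v e \<mu> \<noteq> \<zero>\<^bsub>M\<^esub> \<Longrightarrow> e \<in> basis Y \<times> basis X \<and> Poly_Mapping.keys \<mu> \<subseteq> xz_vars n l"
  unfolding tensor_carrier_def by blast

lemma TC_finite: "v \<in> TC M \<Longrightarrow> finite {(e, \<mu>). v e \<mu> \<noteq> \<zero>\<^bsub>M\<^esub>}"
  by (simp add: tensor_carrier_def)

lemma TC_I:
  assumes "\<And>e \<mu>. v e \<mu> \<in> carrier M"
    and "\<And>e \<mu>. v e \<mu> \<noteq> \<zero>\<^bsub>M\<^esub> \<Longrightarrow> e \<in> basis Y \<times> basis X \<and> Poly_Mapping.keys \<mu> \<subseteq> xz_vars n l"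
    and "finite S" "\<And>e \<mu>. v e \<mu> \<noteq> \<zero>\<^bsub>M\<^esub> \<Longrightarrow> (e, \<mu>) \<in> S"
  shows "v \<in> TC M"
proof -
  have "finite {(e, \<mu>). v e \<mu> \<noteq> \<zero>\<^bsub>M\<^esub>}"
    by (rule finite_subset[OF _ assms(3)]) (use assms(4) in auto)
  with assms(1,2) show ?thesis unfolding tensor_carrier_def by blast
qed

lemma T_simps [simp]: "carrier (T M) = TC M" "\<zero>\<^bsub>T M\<^esub> = (\<lambda>e \<mu>. \<zero>\<^bsub>M\<^esub>)"
  "(v \<oplus>\<^bsub>T M\<^esub> w) = (\<lambda>e \<mu>. v e \<mu> \<oplus>\<^bsub>M\<^esub> w e \<mu>)"
  "p \<odot>\<^bsub>T M\<^esub> v = (\<lambda>e. pol_act M p (v e))"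
  "dif (T M) v = (\<lambda>e \<mu>. left_act M Y X (mat Y) v e \<mu> \<oplus>\<^bsub>M\<^esub> right_act M Y X (mat X) v e \<mu>)"
  by (simp_all add: tensor_def)

lemma TC_coeffwise:
  assumes v: "v \<in> TC M" and \<phi>: "\<And>x. x \<in> carrier M \<Longrightarrow> \<phi> x \<in> carrier N" "\<phi> \<zero>\<^bsub>M\<^esub> = \<zero>\<^bsub>N\<^esub>"
  shows "coeffwise \<phi> v \<in> TC N"
proof (rule TC_I[OF _ _ TC_finite[OF v]])
  have *: "v e \<mu> \<noteq> \<zero>\<^bsub>M\<^esub>" if "coeffwise \<phi> v e \<mu> \<noteq> \<zero>\<^bsub>N\<^esub>" for e \<mu>
    using that \<phi>(2) by (auto simp: coeffwise_def)
  show "e \<in> basis Y \<times> basis X \<and> Poly_Mapping.keys \<mu> \<subseteq> xz_vars n l" if "coeffwise \<phi> v e \<mu> \<noteq> \<zero>\<^bsub>N\<^esub>" for e \<mu>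
    by (rule TC_supp[OF v *[OF that]])
  show "(e, \<mu>) \<in> {(e, \<mu>). v e \<mu> \<noteq> \<zero>\<^bsub>M\<^esub>}" if "coeffwise \<phi> v e \<mu> \<noteq> \<zero>\<^bsub>N\<^esub>" for e \<mu>
    using *[OF that] by simp
qed (simp add: coeffwise_def \<phi> TC_closed[OF v])

lemma TC_zero: "module KY M \<Longrightarrow> (\<lambda>e \<mu>. \<zero>\<^bsub>M\<^esub>) \<in> TC M"
proof -
  assume "module KY M"
  then interpret M: module KY M .
  show ?thesis by (rule TC_I[where S = "{}"]) auto
qed

lemma TC_add:
  assumes M: "module KY M" and v: "v \<in> TC M" and w: "w \<in> TC M"
  shows "(\<lambda>e \<mu>. v e \<mu> \<oplus>\<^bsub>M\<^esub> w e \<mu>) \<in> TC M"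
proof (rule TC_I[OF _ _ finite_UnI[OF TC_finite[OF v] TC_finite[OF w]]])
  interpret M: module KY M by fact
  have *: "v e \<mu> \<noteq> \<zero>\<^bsub>M\<^esub> \<or> w e \<mu> \<noteq> \<zero>\<^bsub>M\<^esub>" if "v e \<mu> \<oplus>\<^bsub>M\<^esub> w e \<mu> \<noteq> \<zero>\<^bsub>M\<^esub>" for e \<mu>
    using that by auto
  show "e \<in> basis Y \<times> basis X \<and> Poly_Mapping.keys \<mu> \<subseteq> xz_vars n l"
    if "v e \<mu> \<oplus>\<^bsub>M\<^esub> w e \<mu> \<noteq> \<zero>\<^bsub>M\<^esub>" for e \<mu>
    using *[OF that] TC_supp[OF v] TC_supp[OF w] by blast
  show "(e, \<mu>) \<in> {(e, \<mu>). v e \<mu> \<noteq> \<zero>\<^bsub>M\<^esub>} \<union> {(e, \<mu>). w e \<mu> \<noteq> \<zero>\<^bsub>M\<^esub>}"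
    if "v e \<mu> \<oplus>\<^bsub>M\<^esub> w e \<mu> \<noteq> \<zero>\<^bsub>M\<^esub>" for e \<mu>
    using *[OF that] by auto
  show "v e \<mu> \<oplus>\<^bsub>M\<^esub> w e \<mu> \<in> carrier M" for e \<mu>
    using TC_closed[OF v] TC_closed[OF w] by simp
qed

lemma abelian_group_T:
  assumes M: "module KY M"
  shows "abelian_group (T M)"
proof -
  interpret M: module KY M by fact
  show ?thesis
  proof (rule abelian_group_by_evaluation[where ev = "\<lambda>(e, \<mu>) v. v e \<mu>" and M = "\<lambda>_. M"])
    fix v w assume "\<And>x. (case x of (e, \<mu>) \<Rightarrow> \<lambda>v. v e \<mu>) v = (case x of (e, \<mu>) \<Rightarrow> \<lambda>v. v e \<mu>) (w :: 'a \<times> 'b \<Rightarrow> mono \<Rightarrow> 'c)"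
    then have "v e \<mu> = w e \<mu>" for e \<mu> by (metis case_prod_conv)
    then show "v = w" by blast
  next
    fix v assume v: "v \<in> carrier (T M)"
    have "coeffwise (a_inv M) v \<in> carrier (T M)"
      using v by (auto intro: TC_coeffwise)
    then show "\<exists>b\<in>carrier (T M). \<forall>x. (case x of (e, \<mu>) \<Rightarrow> \<lambda>v. v e \<mu>) b
        = \<ominus>\<^bsub>M\<^esub> (case x of (e, \<mu>) \<Rightarrow> \<lambda>v. v e \<mu>) v"
      by (intro bexI[of _ "coeffwise (a_inv M) v"]) (auto simp: coeffwise_def)
  qed (auto simp: M.abelian_group_axioms TC_closed TC_zero[OF M] TC_add[OF M])
qed

lemma finite_pol_act_supp:
  assumes M: "module KY M" and p: "p \<in> carrier PR" and f: "finite {\<nu>. f \<nu> \<noteq> \<zero>\<^bsub>M\<^esub>}"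
  shows "finite {\<mu>. pol_act M p f \<mu> \<noteq> \<zero>\<^bsub>M\<^esub>}"
proof (rule finite_subset)
  show "{\<mu>. pol_act M p f \<mu> \<noteq> \<zero>\<^bsub>M\<^esub>} \<subseteq>
      (\<lambda>(\<kappa>, \<nu>). xzpart \<kappa> + \<nu>) ` (Poly_Mapping.keys p \<times> {\<nu>. f \<nu> \<noteq> \<zero>\<^bsub>M\<^esub>})"
  proof
    fix \<mu> assume "\<mu> \<in> {\<mu>. pol_act M p f \<mu> \<noteq> \<zero>\<^bsub>M\<^esub>}"
    then have "pol_act M p f \<mu> \<noteq> \<zero>\<^bsub>M\<^esub>" by simp
    from pol_act_nonzero[OF M p this] obtain \<kappa> \<nu>
      where "\<kappa> \<in> Poly_Mapping.keys p" "\<mu> = xzpart \<kappa> + \<nu>" "f \<nu> \<noteq> \<zero>\<^bsub>M\<^esub>" by blast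
    then show "\<mu> \<in> (\<lambda>(\<kappa>, \<nu>). xzpart \<kappa> + \<nu>) ` (Poly_Mapping.keys p \<times> {\<nu>. f \<nu> \<noteq> \<zero>\<^bsub>M\<^esub>})"
      by (intro image_eqI[of _ _ "(\<kappa>, \<nu>)"]) simp_all
  qed
qed (use f in simp)

lemma pol_act_vars:
  assumes M: "module KY M" and p: "p \<in> carrier PR"
    and f: "\<And>\<nu>. f \<nu> \<noteq> \<zero>\<^bsub>M\<^esub> \<Longrightarrow> Poly_Mapping.keys \<nu> \<subseteq> xz_vars n l"
    and nz: "pol_act M p f \<mu> \<noteq> \<zero>\<^bsub>M\<^esub>"
  shows "Poly_Mapping.keys \<mu> \<subseteq> xz_vars n l"
proof -
  from pol_act_nonzero[OF M p nz] obtain \<kappa> \<nu>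
    where \<kappa>: "\<kappa> \<in> Poly_Mapping.keys p" "\<mu> = xzpart \<kappa> + \<nu>" "f \<nu> \<noteq> \<zero>\<^bsub>M\<^esub>" by blast
  with f[of \<nu>] xzpart_vars[OF p \<kappa>(1)] keys_add[of "xzpart \<kappa>" \<nu>] show ?thesis by blast
qed

lemma TC_finite_fibre: "v \<in> TC M \<Longrightarrow> finite {\<nu>. v e \<nu> \<noteq> \<zero>\<^bsub>M\<^esub>}"
proof -
  assume "v \<in> TC M"
  from finite_imageI[OF TC_finite[OF this], of snd] show ?thesis
  proof (rule finite_subset[rotated], intro subsetI)
    fix \<nu> assume "\<nu> \<in> {\<nu>. v e \<nu> \<noteq> \<zero>\<^bsub>M\<^esub>}"
    then show "\<nu> \<in> snd ` {(e, \<mu>). v e \<mu> \<noteq> \<zero>\<^bsub>M\<^esub>}"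
      by (intro image_eqI[of _ _ "(e, \<nu>)"]) simp_all
  qed
qed

text \<open>The common shape of \<open>left_act\<close> and \<open>right_act\<close>:
  \<open>p\<close> gives the matrix entries with their signs, and \<open>g\<close> names the
  component of v that each entry multiplies.\<close>

lemma TC_sum_pol_act:
  assumes M: "module KY M" and v: "v \<in> TC M"
    and p: "\<And>a b i. a \<in> basis Y \<Longrightarrow> b \<in> basis X \<Longrightarrow> i \<in> S a b \<Longrightarrow> p a b i \<in> carrier PR"
    and S: "\<And>a b. a \<in> basis Y \<Longrightarrow> b \<in> basis X \<Longrightarrow> finite (S a b)"
  shows "(\<lambda>(a, b) \<mu>. if a \<in> basis Y \<and> b \<in> basis X
    then (\<Oplus>\<^bsub>M\<^esub>i\<in>S a b. pol_act M (p a b i) (v (g a b i)) \<mu>) else \<zero>\<^bsub>M\<^esub>) \<in> TC M"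
    (is "?w \<in> _")
proof -
  interpret M: module KY M by fact
  let ?supp = "\<lambda>a b i. {\<mu>. pol_act M (p a b i) (v (g a b i)) \<mu> \<noteq> \<zero>\<^bsub>M\<^esub>}"
  let ?U = "\<Union>a\<in>basis Y. \<Union>b\<in>basis X. \<Union>i\<in>S a b. {(a, b)} \<times> ?supp a b i"
  have nz: "a \<in> basis Y \<and> b \<in> basis X \<and> (\<exists>i\<in>S a b. pol_act M (p a b i) (v (g a b i)) \<mu> \<noteq> \<zero>\<^bsub>M\<^esub>)"
    if "?w (a, b) \<mu> \<noteq> \<zero>\<^bsub>M\<^esub>" for a b \<mu>
    using that finsum_nonzero_ex[OF M.abelian_monoid_axioms] by (auto split: if_splits)
  show ?thesis
  proof (rule TC_I)
    show "?w e \<mu> \<in> carrier M" for e \<mu>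
      by (auto simp: split_beta intro!: M.finsum_closed pol_act_closed[OF M] p TC_closed[OF v])
    show "finite ?U"
      by (intro finite_UN_I fin S finite_cartesian_product finite_pol_act_supp[OF M] p TC_finite_fibre[OF v]) auto
    show "(e, \<mu>) \<in> ?U" if "?w e \<mu> \<noteq> \<zero>\<^bsub>M\<^esub>" for e \<mu>
      using nz[of "fst e" "snd e" \<mu>] that by (cases e) auto
    show "e \<in> basis Y \<times> basis X \<and> Poly_Mapping.keys \<mu> \<subseteq> xz_vars n l" if "?w e \<mu> \<noteq> \<zero>\<^bsub>M\<^esub>" for e \<mu>
    proof -
      obtain a b where e: "e = (a, b)" by (cases e)
      note * = nz[OF that[unfolded e]]
      from conjunct2[OF conjunct2[OF *]] obtain i
        where i: "i \<in> S a b" "pol_act M (p a b i) (v (g a b i)) \<mu> \<noteq> \<zero>\<^bsub>M\<^esub>" ..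
      have "Poly_Mapping.keys \<mu> \<subseteq> xz_vars n l"
      proof (rule pol_act_vars[OF M p _ i(2)])
        show "Poly_Mapping.keys \<nu> \<subseteq> xz_vars n l" if "v (g a b i) \<nu> \<noteq> \<zero>\<^bsub>M\<^esub>" for \<nu>
          using TC_supp[OF v that] by (rule conjunct2)
      qed (use * i in simp_all)
      with * e show ?thesis by simp
    qed
  qed
qed

lemma left_act_closed:
  assumes "module KY M" "v \<in> TC M" "Ymat A"
  shows "left_act M Y X A v \<in> TC M"
  unfolding left_act_def
  using assms(3) by (intro TC_sum_pol_act assms(1,2) fin) (auto simp: Ymat_def)

lemma sgn_mult_closed: "p \<in> carrier PR \<Longrightarrow> sgn_pol s * p \<in> carrier PR"
  by (intro poly_ring_mult poly_ring_sgn_pol)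

lemma right_act_closed:
  assumes "module KY M" "v \<in> TC M" "Xmat A"
  shows "right_act M Y X A v \<in> TC M"
  unfolding right_act_def
  using assms(3) by (intro TC_sum_pol_act assms(1,2) fin sgn_mult_closed) (auto simp: Xmat_def)

lemma dif_closed: "module KY M \<Longrightarrow> v \<in> TC M \<Longrightarrow> dif (T M) v \<in> TC M"
  unfolding T_simps by (intro TC_add left_act_closed right_act_closed Xmat_X Ymat_Y)

lemma T_smult_closed: "module KY M \<Longrightarrow> v \<in> TC M \<Longrightarrow> p \<in> carrier PR \<Longrightarrow> (\<lambda>e. pol_act M p (v e)) \<in> TC M"
proof -
  assume M: "module KY M" and v: "v \<in> TC M" and p: "p \<in> carrier PR"
  have nz: "\<exists>\<nu>. v e \<nu> \<noteq> \<zero>\<^bsub>M\<^esub>" if "pol_act M p (v e) \<mu> \<noteq> \<zero>\<^bsub>M\<^esub>" for e \<mu>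
    using pol_act_nonzero[OF M p that] by (elim bexE exE conjE) (rule exI)
  show ?thesis
  proof (rule TC_I)
    show "finite (\<Union>e\<in>basis Y \<times> basis X. {e} \<times> {\<mu>. pol_act M p (v e) \<mu> \<noteq> \<zero>\<^bsub>M\<^esub>})"
      by (intro finite_UN_I finite_cartesian_product fin finite_pol_act_supp[OF M p] TC_finite_fibre[OF v]) auto
    have e: "e \<in> basis Y \<times> basis X" if "pol_act M p (v e) \<mu> \<noteq> \<zero>\<^bsub>M\<^esub>" for e \<mu>
      using nz[OF that] by (elim exE) (rule conjunct1[OF TC_supp[OF v]])
    show "e \<in> basis Y \<times> basis X \<and> Poly_Mapping.keys \<mu> \<subseteq> xz_vars n l"
      if "pol_act M p (v e) \<mu> \<noteq> \<zero>\<^bsub>M\<^esub>" for e \<mu>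
      using e[OF that] pol_act_vars[OF M p conjunct2[OF TC_supp[OF v]] that] by (rule conjI)
    show "(e, \<mu>) \<in> (\<Union>e\<in>basis Y \<times> basis X. {e} \<times> {\<mu>. pol_act M p (v e) \<mu> \<noteq> \<zero>\<^bsub>M\<^esub>})"
      if "pol_act M p (v e) \<mu> \<noteq> \<zero>\<^bsub>M\<^esub>" for e \<mu>
      using e[OF that] that by simp
  qed (rule pol_act_closed[OF M p TC_closed[OF v]])
qed

subsection \<open>Naturality in the coefficient module\<close>

context
  fixes M :: "('k pol, 'e) module" and N :: "('k pol, 'f) module" and \<phi>
  assumes \<phi>: "coeff_hom KY M N \<phi>"
begin

interpretation M: module KY M using coeff_hom_modules[OF \<phi>] by simp
interpretation N: module KY N using coeff_hom_modules[OF \<phi>] by simp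

lemma coeffwise_closed: "v \<in> TC M \<Longrightarrow> coeffwise \<phi> v \<in> TC N"
  by (rule TC_coeffwise) (auto simp: coeff_hom_closed[OF \<phi>] coeff_hom_zero[OF \<phi>])

lemma hom_sum_pol_act:
  assumes v: "v \<in> TC M" and p: "\<And>i. i \<in> S \<Longrightarrow> p i \<in> carrier PR"
  shows "\<phi> (\<Oplus>\<^bsub>M\<^esub>i\<in>S. pol_act M (p i) (v (g i)) \<mu>) = (\<Oplus>\<^bsub>N\<^esub>i\<in>S. pol_act N (p i) (coeffwise \<phi> v (g i)) \<mu>)"
proof -
  have "\<phi> (\<Oplus>\<^bsub>M\<^esub>i\<in>S. pol_act M (p i) (v (g i)) \<mu>) = (\<Oplus>\<^bsub>N\<^esub>i\<in>S. \<phi> (pol_act M (p i) (v (g i)) \<mu>))"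
    by (rule coeff_hom_finsum[OF \<phi>]) (rule pol_act_closed[OF M.module_axioms p TC_closed[OF v]])
  also have "\<dots> = (\<Oplus>\<^bsub>N\<^esub>i\<in>S. pol_act N (p i) (coeffwise \<phi> v (g i)) \<mu>)"
  proof (rule N.finsum_cong'[OF refl])
    show "(\<lambda>i. pol_act N (p i) (coeffwise \<phi> v (g i)) \<mu>) \<in> S \<rightarrow> carrier N"
      by (intro Pi_I pol_act_closed[OF N.module_axioms p] TC_closed[OF coeffwise_closed[OF v]])
    show "\<phi> (pol_act M (p i) (v (g i)) \<mu>) = pol_act N (p i) (coeffwise \<phi> v (g i)) \<mu>" if "i \<in> S" for i
      unfolding coeffwise_def by (rule pol_act_hom[OF \<phi> p[OF that] TC_closed[OF v]])
  qed
  finally show ?thesis .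
qed

lemma coeffwise_left_act:
  assumes v: "v \<in> TC M" and A: "Ymat A"
  shows "coeffwise \<phi> (left_act M Y X A v) = left_act N Y X A (coeffwise \<phi> v)"
proof (intro ext, clarify)
  fix a b \<mu>
  show "coeffwise \<phi> (left_act M Y X A v) (a, b) \<mu> = left_act N Y X A (coeffwise \<phi> v) (a, b) \<mu>"
  proof (cases "a \<in> basis Y \<and> b \<in> basis X")
    case True
    then show ?thesis
      using hom_sum_pol_act[OF v, of "basis Y" "A a" "\<lambda>c. (c, b)" \<mu>] A
      by (simp add: left_act_def coeffwise_def[of _ "\<lambda>(a, b). _ a b"] Ymat_def)
  next
    case False
    then show ?thesis by (auto simp: coeffwise_def left_act_def coeff_hom_zero[OF \<phi>])
  qed
qed

lemma coeffwise_right_act: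
  assumes v: "v \<in> TC M" and A: "Xmat A"
  shows "coeffwise \<phi> (right_act M Y X A v) = right_act N Y X A (coeffwise \<phi> v)"
proof (intro ext, clarify)
  fix a b \<mu>
  show "coeffwise \<phi> (right_act M Y X A v) (a, b) \<mu> = right_act N Y X A (coeffwise \<phi> v) (a, b) \<mu>"
  proof (cases "a \<in> basis Y \<and> b \<in> basis X")
    case True
    then show ?thesis
      using hom_sum_pol_act[OF v, of "basis X" "\<lambda>c. sgn_pol (bodd Y a) * A b c" "\<lambda>c. (a, c)" \<mu>] A
      by (simp add: right_act_def coeffwise_def[of _ "\<lambda>(a, b). _ a b"] Xmat_def sgn_mult_closed)
  next
    case False
    then show ?thesis by (auto simp: coeffwise_def right_act_def coeff_hom_zero[OF \<phi>])
  qed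
qed

lemma coeffwise_add: "v \<in> TC M \<Longrightarrow> w \<in> TC M \<Longrightarrow>
    coeffwise \<phi> (\<lambda>e \<mu>. v e \<mu> \<oplus>\<^bsub>M\<^esub> w e \<mu>) = (\<lambda>e \<mu>. coeffwise \<phi> v e \<mu> \<oplus>\<^bsub>N\<^esub> coeffwise \<phi> w e \<mu>)"
  by (intro ext) (simp add: coeffwise_def coeff_hom_add[OF \<phi>] TC_closed)

lemma coeffwise_dif: "v \<in> TC M \<Longrightarrow> coeffwise \<phi> (dif (T M) v) = dif (T N) (coeffwise \<phi> v)"
  using coeffwise_add[OF left_act_closed[OF M.module_axioms _ Ymat_Y] right_act_closed[OF M.module_axioms _ Xmat_X], of v v]
  by (simp add: coeffwise_left_act Ymat_Y coeffwise_right_act Xmat_X)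

lemma coeffwise_lam: "v \<in> TC M \<Longrightarrow> coeffwise \<phi> (lam M Y X i v) = lam N Y X i (coeffwise \<phi> v)"
  unfolding lam_def by (intro coeffwise_right_act Xmat_pdiff Xmat_X)

lemma coeffwise_smult: "v \<in> TC M \<Longrightarrow> p \<in> carrier PR \<Longrightarrow> coeffwise \<phi> (p \<odot>\<^bsub>T M\<^esub> v) = p \<odot>\<^bsub>T N\<^esub> coeffwise \<phi> v"
  by (intro ext) (simp add: coeffwise_def pol_act_hom[OF \<phi>] TC_closed)

end

end

section \<open>Matrix operators on the polynomial tensor product\<close>

text \<open>The sign of \<open>sgn_pol\<close> as a negation in an additive group, so that sign
  calculations need no module structure.\<close>

definition sg :: "bool \<Rightarrow> 'v::ab_group_add \<Rightarrow> 'v" where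
  "sg s x = (if s then - x else x)"

lemma sg_sg: "sg s (sg s' x) = sg (s \<noteq> s') x"
  by (simp add: sg_def)

lemma sg_add: "sg s (x + y) = sg s x + sg s y"
  by (simp add: sg_def)

lemma sg_zero [simp]: "sg s 0 = 0"
  by (simp add: sg_def)

lemma sg_False [simp]: "sg False x = x"
  by (simp add: sg_def)

lemma mact_sgn_pol: "mact (sgn_pol s) f = sg s f"
  by (simp add: sgn_pol_def sg_def mact_uminus_left)

context tensor_setup
begin

text \<open>\<open>lmat\<close>, \<open>rmat\<close> and \<open>act\<close> restate the matrix
  operators over k[y] as total functions with pointwise addition, so that their algebra needs no
  closure conditions; they agree with \<open>left_act\<close>, \<open>right_act\<close> and scalar
  multiplication on the carrier.\<close>

definition lmat :: "('a \<Rightarrow> 'a \<Rightarrow> 'k pol) \<Rightarrow> ('a \<times> 'b \<Rightarrow> mono \<Rightarrow> 'k pol) \<Rightarrow> 'a \<times> 'b \<Rightarrow> mono \<Rightarrow> 'k pol" where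
  "lmat A v = (\<lambda>(a, b). if a \<in> basis Y \<and> b \<in> basis X then \<Sum>c\<in>basis Y. mact (A a c) (v (c, b)) else 0)"

definition rmat :: "('b \<Rightarrow> 'b \<Rightarrow> 'k pol) \<Rightarrow> ('a \<times> 'b \<Rightarrow> mono \<Rightarrow> 'k pol) \<Rightarrow> 'a \<times> 'b \<Rightarrow> mono \<Rightarrow> 'k pol" where
  "rmat A v = (\<lambda>(a, b). if a \<in> basis Y \<and> b \<in> basis X
     then \<Sum>c\<in>basis X. mact (sgn_pol (bodd Y a) * A b c) (v (a, c)) else 0)"

definition act :: "'k pol \<Rightarrow> ('a \<times> 'b \<Rightarrow> mono \<Rightarrow> 'k pol) \<Rightarrow> 'a \<times> 'b \<Rightarrow> mono \<Rightarrow> 'k pol" where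
  "act p v = (\<lambda>e. mact p (v e))"

definition dT :: "('a \<times> 'b \<Rightarrow> mono \<Rightarrow> 'k pol) \<Rightarrow> 'a \<times> 'b \<Rightarrow> mono \<Rightarrow> 'k pol" where
  "dT v = lmat (mat Y) v + rmat (mat X) v"

text \<open>Matrix operators discard components outside the bases while \<open>act\<close> keeps
  them, so a matrix product can equal a scalar only on supported families.\<close>

definition supported :: "('a \<times> 'b \<Rightarrow> mono \<Rightarrow> 'k pol) \<Rightarrow> bool" where
  "supported v \<longleftrightarrow> (\<forall>a b. v (a, b) \<noteq> 0 \<longrightarrow> a \<in> basis Y \<and> b \<in> basis X)"

lemma lmat_apply: "a \<in> basis Y \<Longrightarrow> b \<in> basis X \<Longrightarrow> lmat A v (a, b) = (\<Sum>c\<in>basis Y. mact (A a c) (v (c, b)))"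
  by (simp add: lmat_def)

lemma rmat_apply: "a \<in> basis Y \<Longrightarrow> b \<in> basis X \<Longrightarrow>
    rmat A v (a, b) = (\<Sum>c\<in>basis X. mact (sgn_pol (bodd Y a) * A b c) (v (a, c)))"
  by (simp add: rmat_def)

lemma supported_eqI:
  assumes "supported v" "supported w" "\<And>a b. a \<in> basis Y \<Longrightarrow> b \<in> basis X \<Longrightarrow> v (a, b) = w (a, b)"
  shows "v = w"
proof
  fix e :: "'a \<times> 'b"
  obtain a b where e: "e = (a, b)" by (cases e)
  show "v e = w e"
  proof (cases "a \<in> basis Y \<and> b \<in> basis X")
    case False
    with assms(1,2) have "v (a, b) = 0" "w (a, b) = 0" unfolding supported_def by blast+
    with e show ?thesis by simp
  qed (use assms(3) e in simp)
qed

lemma supported_lmat: "supported (lmat A v)"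
  by (simp add: supported_def lmat_def)

lemma supported_rmat: "supported (rmat A v)"
  by (simp add: supported_def rmat_def)

lemma supported_act: "supported v \<Longrightarrow> supported (act p v)"
  by (auto simp: supported_def act_def) (metis mact_zero)+

lemma act_apply: "act p v e = mact p (v e)"
  by (simp add: act_def)

lemma supported_zero: "supported 0"
  by (simp add: supported_def)

lemma supported_add: "supported v \<Longrightarrow> supported w \<Longrightarrow> supported (v + w)"
  by (auto simp: supported_def) (metis add.right_neutral)+

lemma supported_sum: "(\<And>i. i \<in> S \<Longrightarrow> supported (f i)) \<Longrightarrow> supported (\<Sum>i\<in>S. f i)"
  by (induction S rule: infinite_finite_induct)
    (simp_all only: sum.infinite sum.empty sum.insert supported_zero supported_add insertI1 insertI2 not_False_eq_True)

lemma lmat_add: "lmat A (v + w) = lmat A v + lmat A w"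
  by (rule supported_eqI)
    (simp_all only: supported_lmat supported_add lmat_apply plus_fun_apply[of _ _ "(_, _)"] mact_add sum.distrib)

lemma rmat_add: "rmat A (v + w) = rmat A v + rmat A w"
  by (rule supported_eqI)
    (simp_all only: supported_rmat supported_add rmat_apply plus_fun_apply[of _ _ "(_, _)"] mact_add sum.distrib)

lemma act_add: "act p (v + w) = act p v + act p w"
  by (rule ext) (simp only: act_def plus_fun_apply[of _ _ "_ :: 'a \<times> 'b"] mact_add)

lemma dT_add: "dT (v + w) = dT v + dT w"
  by (simp only: dT_def lmat_add rmat_add ac_simps)

lemma act_act: "act p (act q v) = act (p * q) v"
  by (simp add: act_def mact_mact)

lemma act_add_left: "act (p + q) v = act p v + act q v"
  by (rule ext) (simp only: act_def plus_fun_apply[of _ _ "_ :: 'a \<times> 'b"] mact_add_left)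

lemma act_one: "act 1 v = v"
  by (simp add: act_def)

lemma act_lmat: "act p (lmat A v) = lmat A (act p v)"
  by (rule supported_eqI) (simp_all only: supported_act supported_lmat lmat_apply act_apply mact_sum mact_commute[of p])

lemma act_rmat: "act p (rmat A v) = rmat A (act p v)"
  by (rule supported_eqI) (simp_all only: supported_act supported_rmat rmat_apply act_apply mact_sum mact_commute[of p])

lemma act_dT: "act p (dT v) = dT (act p v)"
  by (simp only: dT_def act_add act_lmat act_rmat)

lemma lmat_lmat: "lmat A (lmat B v) = lmat (\<lambda>a c. \<Sum>e\<in>basis Y. A a e * B e c) v"
proof (rule supported_eqI)
  fix a b assume ab: "a \<in> basis Y" "b \<in> basis X"
  have "lmat A (lmat B v) (a, b) = (\<Sum>e\<in>basis Y. \<Sum>c\<in>basis Y. mact (A a e * B e c) (v (c, b)))"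
    unfolding lmat_apply[OF ab]
    by (rule sum.cong[OF refl]) (simp only: ab lmat_apply mact_sum mact_mact)
  also have "\<dots> = (\<Sum>c\<in>basis Y. \<Sum>e\<in>basis Y. mact (A a e * B e c) (v (c, b)))"
    by (rule sum.swap)
  also have "\<dots> = lmat (\<lambda>a c. \<Sum>e\<in>basis Y. A a e * B e c) v (a, b)"
    by (simp only: lmat_apply[OF ab] mact_sum_left)
  finally show "lmat A (lmat B v) (a, b) = lmat (\<lambda>a c. \<Sum>e\<in>basis Y. A a e * B e c) v (a, b)" .
qed (rule supported_lmat)+

lemma rmat_rmat: "rmat A (rmat B v) = (\<lambda>(a, b). if a \<in> basis Y \<and> b \<in> basis X
    then \<Sum>c\<in>basis X. mact (\<Sum>e\<in>basis X. A b e * B e c) (v (a, c)) else 0)"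
proof (rule supported_eqI)
  fix a b assume ab: "a \<in> basis Y" "b \<in> basis X"
  \<comment> \<open>The Koszul sign of the Y-basis element enters twice and cancels.\<close>
  have s: "sgn_pol (bodd Y a) * x * (sgn_pol (bodd Y a) * y) = x * y" for x y :: "'k pol"
    by (cases "bodd Y a") (simp_all add: sgn_pol_def)
  have "rmat A (rmat B v) (a, b) = (\<Sum>e\<in>basis X. \<Sum>c\<in>basis X. mact (A b e * B e c) (v (a, c)))"
    unfolding rmat_apply[OF ab]
    by (rule sum.cong[OF refl]) (simp only: ab rmat_apply mact_sum mact_mact s)
  also have "\<dots> = (\<Sum>c\<in>basis X. \<Sum>e\<in>basis X. mact (A b e * B e c) (v (a, c)))"
    by (rule sum.swap)
  finally show "rmat A (rmat B v) (a, b) = (\<lambda>(a, b). if a \<in> basis Y \<and> b \<in> basis X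
    then \<Sum>c\<in>basis X. mact (\<Sum>e\<in>basis X. A b e * B e c) (v (a, c)) else 0) (a, b)"
    using ab by (simp only: mact_sum_left prod.case simp_thms if_True)
qed (rule supported_rmat, simp add: supported_def)

text \<open>The Koszul sign in \<open>rmat\<close> makes odd operators on the two factors anticommute.\<close>

lemma lmat_rmat_anticommute:
  assumes "\<And>a c. a \<in> basis Y \<Longrightarrow> c \<in> basis Y \<Longrightarrow> A a c \<noteq> 0 \<Longrightarrow> bodd Y a \<noteq> bodd Y c"
  shows "lmat A (rmat B v) + rmat B (lmat A v) = 0"
proof (rule supported_eqI)
  fix a b assume ab: "a \<in> basis Y" "b \<in> basis X"
  have s: "A a c * (sgn_pol (bodd Y c) * B b e) = - (sgn_pol (bodd Y a) * B b e * A a c)"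
    if "c \<in> basis Y" for c e
    using assms[OF ab(1) that] by (cases "A a c = 0") (auto simp: sgn_pol_def)
  have "lmat A (rmat B v) (a, b) = (\<Sum>c\<in>basis Y. \<Sum>e\<in>basis X. mact (A a c * (sgn_pol (bodd Y c) * B b e)) (v (c, e)))"
    unfolding lmat_apply[OF ab]
    by (rule sum.cong[OF refl]) (simp only: ab rmat_apply mact_sum mact_mact)
  also have "\<dots> = (\<Sum>c\<in>basis Y. \<Sum>e\<in>basis X. - mact (sgn_pol (bodd Y a) * B b e * A a c) (v (c, e)))"
    by (intro sum.cong refl) (simp only: s mact_uminus_left)
  also have "\<dots> = - (\<Sum>e\<in>basis X. \<Sum>c\<in>basis Y. mact (sgn_pol (bodd Y a) * B b e * A a c) (v (c, e)))"
    by (simp only: sum_negf sum.swap[of _ "basis Y"])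
  also have "(\<Sum>e\<in>basis X. \<Sum>c\<in>basis Y. mact (sgn_pol (bodd Y a) * B b e * A a c) (v (c, e))) = rmat B (lmat A v) (a, b)"
    unfolding rmat_apply[OF ab]
    by (rule sum.cong[OF refl]) (simp only: ab lmat_apply mact_sum mact_mact)
  finally show "(lmat A (rmat B v) + rmat B (lmat A v)) (a, b) = 0 (a, b)"
    by (simp only: plus_fun_apply[of _ _ "(a, b)"] zero_fun_apply left_minus)
qed (rule supported_add[OF supported_lmat supported_rmat] supported_zero)+

lemma lmat_scalar:
  assumes v: "supported v" and A: "\<And>a c. a \<in> basis Y \<Longrightarrow> c \<in> basis Y \<Longrightarrow> A a c = (if a = c then p else 0)"
  shows "lmat A v = act p v"
proof (rule supported_eqI)
  fix a b assume ab: "a \<in> basis Y" "b \<in> basis X"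
  have "lmat A v (a, b) = (\<Sum>c\<in>basis Y. if a = c then mact p (v (c, b)) else 0)"
    unfolding lmat_apply[OF ab] by (rule sum.cong[OF refl]) (simp add: A ab)
  also have "\<dots> = act p v (a, b)" using ab fin by (simp add: act_def sum.delta)
  finally show "lmat A v (a, b) = act p v (a, b)" .
qed (rule supported_lmat supported_act[OF v])+

text \<open>Stated for a sum of matrix products so that the first and second derivatives of the
  equation for the square of \<open>d\<^sub>X\<close>, with two and four products, transfer to
  operators at once.\<close>

lemma rmat_rmat_scalar:
  assumes v: "supported v"
    and A: "\<And>b c. b \<in> basis X \<Longrightarrow> c \<in> basis X \<Longrightarrow> (\<Sum>i\<in>S. \<Sum>e\<in>basis X. A i b e * B i e c) = (if b = c then p else 0)"
  shows "(\<Sum>i\<in>S. rmat (A i) (rmat (B i) v)) = act p v"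
proof (rule supported_eqI)
  fix a b assume ab: "a \<in> basis Y" "b \<in> basis X"
  have "(\<Sum>i\<in>S. rmat (A i) (rmat (B i) v)) (a, b)
      = (\<Sum>i\<in>S. \<Sum>c\<in>basis X. mact (\<Sum>e\<in>basis X. A i b e * B i e c) (v (a, c)))"
    unfolding sum_fun_apply[of _ S "(a, b)"] using ab by (simp only: rmat_rmat prod.case simp_thms if_True)
  also have "\<dots> = (\<Sum>c\<in>basis X. mact (\<Sum>i\<in>S. \<Sum>e\<in>basis X. A i b e * B i e c) (v (a, c)))"
    by (simp only: mact_sum_left sum.swap[of _ S "basis X"])
  also have "\<dots> = (\<Sum>c\<in>basis X. if b = c then mact p (v (a, c)) else 0)"
    by (rule sum.cong[OF refl]) (simp add: A ab)
  also have "\<dots> = act p v (a, b)" using ab fin by (simp add: act_def sum.delta)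
  finally show "(\<Sum>i\<in>S. rmat (A i) (rmat (B i) v)) (a, b) = act p v (a, b)" .
qed (rule supported_sum supported_rmat supported_act[OF v])+

subsection \<open>Comparison with the tensor product over the polynomial ring\<close>

abbreviation SM where "SM \<equiv> (ky_module m :: ('k pol, 'k pol) module)"

lemma module_SM: "module KY SM"
  by (rule module_self) (rule cring_poly_ring)

lemma TS_closed: "v \<in> TC SM \<Longrightarrow> v e \<mu> \<in> carrier KY"
  using TC_closed[of v SM] by simp

lemma TS_supported: "v \<in> TC SM \<Longrightarrow> supported v"
proof -
  assume v: "v \<in> TC SM"
  show ?thesis unfolding supported_def
  proof (intro allI impI)
    fix a b assume "v (a, b) \<noteq> 0"
    then obtain \<mu> where "v (a, b) \<mu> \<noteq> 0" by (auto simp: fun_eq_iff)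
    then show "a \<in> basis Y \<and> b \<in> basis X" using TC_supp[OF v, of "(a, b)" \<mu>] by simp
  qed
qed

lemma finsum_SM:
  "(\<And>i. i \<in> S \<Longrightarrow> f i \<in> carrier KY) \<Longrightarrow> (\<Oplus>\<^bsub>SM\<^esub>i\<in>S. f i) = (\<Sum>i\<in>S. f i)"
  by (rule finsum_self_module)

lemma left_act_self:
  assumes v: "v \<in> TC SM" and A: "Ymat A"
  shows "left_act SM Y X A v = lmat A v"
proof (intro ext, clarify)
  fix a b \<mu>
  show "left_act SM Y X A v (a, b) \<mu> = lmat A v (a, b) \<mu>"
  proof (cases "a \<in> basis Y \<and> b \<in> basis X")
    case True
    then have ab: "a \<in> basis Y" "b \<in> basis X" by auto
    have p: "A a c \<in> carrier PR" if "c \<in> basis Y" for c using A ab that by (simp add: Ymat_def)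
    have "(\<Oplus>\<^bsub>SM\<^esub>c\<in>basis Y. pol_act SM (A a c) (v (c, b)) \<mu>) = (\<Sum>c\<in>basis Y. pol_act SM (A a c) (v (c, b)) \<mu>)"
      using pol_act_closed[OF module_SM p TC_closed[OF v]] by (intro finsum_SM) simp
    also have "\<dots> = (\<Sum>c\<in>basis Y. mact (A a c) (v (c, b)) \<mu>)"
      by (rule sum.cong[OF refl]) (rule pol_act_self[OF p TS_closed[OF v]])
    finally show ?thesis using ab by (simp add: left_act_def lmat_apply sum_fun_apply)
  qed (auto simp: left_act_def lmat_def)
qed

lemma right_act_self:
  assumes v: "v \<in> TC SM" and A: "Xmat A"
  shows "right_act SM Y X A v = rmat A v"
proof (intro ext, clarify)
  fix a b \<mu>
  show "right_act SM Y X A v (a, b) \<mu> = rmat A v (a, b) \<mu>"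
  proof (cases "a \<in> basis Y \<and> b \<in> basis X")
    case True
    then have ab: "a \<in> basis Y" "b \<in> basis X" by auto
    let ?p = "\<lambda>c. sgn_pol (bodd Y a) * A b c"
    have p: "?p c \<in> carrier PR" if "c \<in> basis X" for c
      using A ab that by (intro sgn_mult_closed) (simp add: Xmat_def)
    have "(\<Oplus>\<^bsub>SM\<^esub>c\<in>basis X. pol_act SM (?p c) (v (a, c)) \<mu>) = (\<Sum>c\<in>basis X. pol_act SM (?p c) (v (a, c)) \<mu>)"
      using pol_act_closed[OF module_SM p TC_closed[OF v]] by (intro finsum_SM) simp
    also have "\<dots> = (\<Sum>c\<in>basis X. mact (?p c) (v (a, c)) \<mu>)"
      by (rule sum.cong[OF refl]) (rule pol_act_self[OF p TS_closed[OF v]])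
    finally show ?thesis using ab by (simp add: right_act_def rmat_apply sum_fun_apply)
  qed (auto simp: right_act_def rmat_def)
qed

lemma smult_self: "v \<in> TC SM \<Longrightarrow> p \<in> carrier PR \<Longrightarrow> p \<odot>\<^bsub>T SM\<^esub> v = act p v"
  by (intro ext) (simp add: act_def pol_act_self TS_closed)

lemma dif_self: "v \<in> TC SM \<Longrightarrow> dif (T SM) v = dT v"
  by (intro ext) (simp add: dT_def left_act_self right_act_self Xmat_X Ymat_Y)

lemma lam_self: "v \<in> TC SM \<Longrightarrow> lam SM Y X i v = rmat (\<lambda>b c. pdiff (VY i) (mat X b c)) v"
  unfolding lam_def by (intro right_act_self Xmat_pdiff Xmat_X)

lemma lmat_closed: "v \<in> TC SM \<Longrightarrow> Ymat A \<Longrightarrow> lmat A v \<in> TC SM"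
  using left_act_closed[OF module_SM] by (simp only: left_act_self)

lemma rmat_closed: "v \<in> TC SM \<Longrightarrow> Xmat A \<Longrightarrow> rmat A v \<in> TC SM"
  using right_act_closed[OF module_SM] by (simp only: right_act_self)

lemma act_closed: "v \<in> TC SM \<Longrightarrow> p \<in> carrier PR \<Longrightarrow> act p v \<in> TC SM"
  using T_smult_closed[OF module_SM, of v p] smult_self[of v p] by simp

lemma TS_add: "v \<in> TC SM \<Longrightarrow> w \<in> TC SM \<Longrightarrow> v + w \<in> TC SM"
  using TC_add[OF module_SM, of v w] by (simp add: plus_fun_def)

lemma TS_zero: "0 \<in> TC SM"
  using TC_zero[OF module_SM] by (simp add: zero_fun_def)

lemma TS_uminus: "v \<in> TC SM \<Longrightarrow> - v \<in> TC SM"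
proof -
  assume "v \<in> TC SM"
  then have "act (- 1) v \<in> TC SM" by (rule act_closed) (intro poly_ring_intros)
  moreover have "act (- 1) v = - v" by (rule ext) (simp add: act_def mact_uminus_left)
  ultimately show ?thesis by simp
qed

lemma TS_diff: "v \<in> TC SM \<Longrightarrow> w \<in> TC SM \<Longrightarrow> v - w \<in> TC SM"
  using TS_add[of v "- w"] TS_uminus[of w] by simp

lemma TS_sum: "(\<And>i. i \<in> S \<Longrightarrow> f i \<in> TC SM) \<Longrightarrow> (\<Sum>i\<in>S. f i) \<in> TC SM"
  by (induction S rule: infinite_finite_induct)
    (simp_all only: sum.infinite sum.empty sum.insert TS_zero TS_add insertI1 insertI2 not_False_eq_True)

lemma dT_closed: "v \<in> TC SM \<Longrightarrow> dT v \<in> TC SM"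
  unfolding dT_def by (intro TS_add lmat_closed rmat_closed Xmat_X Ymat_Y)

end

section \<open>Exponentials of a nilpotent operator\<close>

text \<open>In the application \<open>d\<close> is the differential, \<open>\<delta> = \<Sum>\<^sub>i \<lambda>\<^sub>i \<theta>\<^sub>i\<^sup>*\<close>, \<open>\<kappa>\<close> is the Koszul differential and
  \<open>\<Lambda> = \<lambda>\<^sub>i\<close>. The congruence modulo \<open>K\<close> is congruence modulo the Jacobi ideal; there \<open>[\<delta>, \<Lambda>]\<close> is \<open>- B\<close>
  up to the homotopy \<open>\<nu>\<close>.\<close>

locale perturbation =
  fixes scal :: "'k::comm_ring_1 \<Rightarrow> 'v::ab_group_add \<Rightarrow> 'v"
    and d \<delta> \<kappa> \<theta> \<Lambda> B \<nu> :: "'v \<Rightarrow> 'v" and C K :: "'v set"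
    and c :: "nat \<Rightarrow> 'k" and half :: 'k and m :: nat
  assumes add: "\<And>f x y. f \<in> {d, \<delta>, \<kappa>, \<theta>, \<Lambda>, B, \<nu>} \<Longrightarrow> f (x + y) = f x + f y"
    and scal_add: "\<And>a x y. scal a (x + y) = scal a x + scal a y"
    and scal_add_left: "\<And>a b x. scal (a + b) x = scal a x + scal b x"
    and scal_scal: "\<And>a b x. scal a (scal b x) = scal (a * b) x"
    and scal_one: "\<And>x. scal 1 x = x"
    and scal_comm: "\<And>f a x. f \<in> {d, \<delta>, \<kappa>, \<theta>, \<Lambda>, B, \<nu>} \<Longrightarrow> f (scal a x) = scal a (f x)"
    and C: "0 \<in> C" "\<And>x y. x \<in> C \<Longrightarrow> y \<in> C \<Longrightarrow> x + y \<in> C" "\<And>a x. x \<in> C \<Longrightarrow> scal a x \<in> C"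
      "\<And>f x. f \<in> {d, \<delta>, \<kappa>, \<theta>, \<Lambda>, B, \<nu>} \<Longrightarrow> x \<in> C \<Longrightarrow> f x \<in> C"
    and K: "0 \<in> K" "\<And>x y. x \<in> K \<Longrightarrow> y \<in> K \<Longrightarrow> x + y \<in> K" "\<And>a x. x \<in> K \<Longrightarrow> scal a x \<in> K"
      "\<And>f x. f \<in> {\<delta>, \<nu>} \<Longrightarrow> x \<in> K \<Longrightarrow> f x \<in> K" "\<And>x. x \<in> C \<Longrightarrow> \<kappa> x \<in> K"
    and d_\<delta>: "\<And>x. x \<in> C \<Longrightarrow> d (\<delta> x) = \<delta> (d x) + \<kappa> x"
    and \<kappa>_\<delta>: "\<And>x. x \<in> C \<Longrightarrow> \<kappa> (\<delta> x) = \<delta> (\<kappa> x)"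
    and \<delta>_\<theta>: "\<And>x. x \<in> C \<Longrightarrow> \<delta> (\<theta> x) = \<theta> (\<delta> x) + \<Lambda> x"
    and \<delta>_\<Lambda>: "\<And>x. x \<in> C \<Longrightarrow> \<delta> (\<Lambda> x) = \<Lambda> (\<delta> x) - B x + d (\<nu> x) - \<nu> (d x)"
    and \<delta>_B: "\<And>x. x \<in> C \<Longrightarrow> \<delta> (B x) = B (\<delta> x)"
    and nilpotent: "\<And>x j. x \<in> C \<Longrightarrow> m < j \<Longrightarrow> (\<delta> ^^ j) x = 0"
    and c_Suc: "\<And>j. of_nat (Suc j) * c (Suc j) = - c j"
    and half: "half + half = 1"
begin

section \<open>Linearity and closure of the operators\<close>

lemma zero:
  assumes "f \<in> {d, \<delta>, \<kappa>, \<theta>, \<Lambda>, B, \<nu>}" shows "f 0 = 0"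
  using add[OF assms, of 0 0] by simp

lemma minus:
  assumes "f \<in> {d, \<delta>, \<kappa>, \<theta>, \<Lambda>, B, \<nu>}" shows "f (x - y) = f x - f y"
  using add[OF assms, of "x - y" y] by (simp add: algebra_simps)

lemma distrib_sum:
  assumes "f \<in> {d, \<delta>, \<kappa>, \<theta>, \<Lambda>, B, \<nu>}" shows "f (\<Sum>i\<in>S. g i) = (\<Sum>i\<in>S. f (g i))"
proof (induction S rule: infinite_finite_induct)
  case (insert i S)
  then show ?case using add[OF assms, of "g i" "\<Sum>i\<in>S. g i"] by simp
qed (simp_all add: zero[OF assms])

lemma op_add: "d (x + y) = d x + d y" "\<delta> (x + y) = \<delta> x + \<delta> y" "\<kappa> (x + y) = \<kappa> x + \<kappa> y" "\<theta> (x + y) = \<theta> x + \<theta> y" "\<Lambda> (x + y) = \<Lambda> x + \<Lambda> y" "B (x + y) = B x + B y" "\<nu> (x + y) = \<nu> x + \<nu> y"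
  using add[of d] add[of \<delta>] add[of \<kappa>] add[of \<theta>] add[of \<Lambda>] add[of B] add[of \<nu>] by simp_all

lemma op_zero: "d 0 = 0" "\<delta> 0 = 0" "\<kappa> 0 = 0" "\<theta> 0 = 0" "\<Lambda> 0 = 0" "B 0 = 0" "\<nu> 0 = 0"
  using zero[of d] zero[of \<delta>] zero[of \<kappa>] zero[of \<theta>] zero[of \<Lambda>] zero[of B] zero[of \<nu>] by simp_all

lemma op_minus: "d (x - y) = d x - d y" "\<delta> (x - y) = \<delta> x - \<delta> y" "\<kappa> (x - y) = \<kappa> x - \<kappa> y" "\<theta> (x - y) = \<theta> x - \<theta> y" "\<Lambda> (x - y) = \<Lambda> x - \<Lambda> y" "B (x - y) = B x - B y" "\<nu> (x - y) = \<nu> x - \<nu> y"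
  using minus[of d] minus[of \<delta>] minus[of \<kappa>] minus[of \<theta>] minus[of \<Lambda>] minus[of B] minus[of \<nu>] by simp_all

lemma op_scal: "d (scal a x) = scal a (d x)" "\<delta> (scal a x) = scal a (\<delta> x)" "\<kappa> (scal a x) = scal a (\<kappa> x)" "\<theta> (scal a x) = scal a (\<theta> x)" "\<Lambda> (scal a x) = scal a (\<Lambda> x)" "B (scal a x) = scal a (B x)" "\<nu> (scal a x) = scal a (\<nu> x)"
  using scal_comm[of d] scal_comm[of \<delta>] scal_comm[of \<kappa>] scal_comm[of \<theta>] scal_comm[of \<Lambda>] scal_comm[of B] scal_comm[of \<nu>] by simp_all

lemma op_sum: "d (\<Sum>i\<in>S. g i) = (\<Sum>i\<in>S. d (g i))" "\<delta> (\<Sum>i\<in>S. g i) = (\<Sum>i\<in>S. \<delta> (g i))" "\<kappa> (\<Sum>i\<in>S. g i) = (\<Sum>i\<in>S. \<kappa> (g i))" "\<theta> (\<Sum>i\<in>S. g i) = (\<Sum>i\<in>S. \<theta> (g i))" "\<Lambda> (\<Sum>i\<in>S. g i) = (\<Sum>i\<in>S. \<Lambda> (g i))" "B (\<Sum>i\<in>S. g i) = (\<Sum>i\<in>S. B (g i))" "\<nu> (\<Sum>i\<in>S. g i) = (\<Sum>i\<in>S. \<nu> (g i))"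
  using distrib_sum[of d] distrib_sum[of \<delta>] distrib_sum[of \<kappa>] distrib_sum[of \<theta>] distrib_sum[of \<Lambda>] distrib_sum[of B] distrib_sum[of \<nu>] by simp_all

lemma op_C: "x \<in> C \<Longrightarrow> d x \<in> C" "x \<in> C \<Longrightarrow> \<delta> x \<in> C" "x \<in> C \<Longrightarrow> \<kappa> x \<in> C" "x \<in> C \<Longrightarrow> \<theta> x \<in> C" "x \<in> C \<Longrightarrow> \<Lambda> x \<in> C" "x \<in> C \<Longrightarrow> B x \<in> C" "x \<in> C \<Longrightarrow> \<nu> x \<in> C"
  using C(4)[of d] C(4)[of \<delta>] C(4)[of \<kappa>] C(4)[of \<theta>] C(4)[of \<Lambda>] C(4)[of B] C(4)[of \<nu>] by simp_all

lemma op_K: "x \<in> K \<Longrightarrow> \<delta> x \<in> K" "x \<in> K \<Longrightarrow> \<nu> x \<in> K"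
  using K(4)[of \<delta>] K(4)[of \<nu>] by simp_all

lemma scal_zero [simp]: "scal a 0 = 0"
  using scal_add[of a 0 0] by simp

lemma scal_minus: "scal a (x - y) = scal a x - scal a y"
  using scal_add[of a "x - y" y] by (simp add: algebra_simps)

lemma scal_zero_left [simp]: "scal 0 x = 0"
  using scal_add_left[of 0 0 x] by simp

lemma scal_uminus_left: "scal (- a) x = - scal a x"
  using scal_add_left[of "- a" a x] by (simp add: eq_neg_iff_add_eq_0)

lemma scal_sum: "scal a (\<Sum>i\<in>S. g i) = (\<Sum>i\<in>S. scal a (g i))"
  by (induction S rule: infinite_finite_induct) (simp_all only: sum.infinite sum.empty sum.insert scal_zero scal_add not_False_eq_True)

lemma K_sum: "(\<And>i. i \<in> S \<Longrightarrow> g i \<in> K) \<Longrightarrow> (\<Sum>i\<in>S. g i) \<in> K"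
  by (induction S rule: infinite_finite_induct) (auto intro: K(1,2))

lemma K_uminus: "x \<in> K \<Longrightarrow> - x \<in> K"
  using K(3)[of x "- 1"] by (simp add: scal_uminus_left scal_one)

lemma K_minus: "x \<in> K \<Longrightarrow> y \<in> K \<Longrightarrow> x - y \<in> K"
  using K(2)[of x "- y"] K_uminus[of y] by simp

lemma pow_C: "x \<in> C \<Longrightarrow> (\<delta> ^^ j) x \<in> C"
  by (induction j) (auto intro: C(1-3) op_C)

lemma pow_add: "(\<delta> ^^ j) (x + y) = (\<delta> ^^ j) x + (\<delta> ^^ j) y"
  by (induction j) (simp_all add: op_add)

text \<open>Each of the j transpositions of d with \<delta> leaves one \<kappa>, and \<kappa>
  commutes with \<delta>. The truncated exponent at j = 0 carries the coefficient 0.\<close>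

lemma d_pow: "x \<in> C \<Longrightarrow> d ((\<delta> ^^ j) x) = (\<delta> ^^ j) (d x) + scal (of_nat j) (\<kappa> ((\<delta> ^^ (j - 1)) x))"
proof (induction j)
  case (Suc j)
  have "\<delta> (scal (of_nat j) (\<kappa> ((\<delta> ^^ (j - 1)) x))) = scal (of_nat j) (\<kappa> ((\<delta> ^^ j) x))"
    using Suc.prems by (cases j) (simp_all add: op_zero op_scal \<kappa>_\<delta>[symmetric] pow_C)
  then show ?case
    using Suc by (simp add: d_\<delta> pow_C op_add scal_add_left scal_one algebra_simps)
qed simp

definition e where "e N x = (\<Sum>j\<le>N. scal (c j) ((\<delta> ^^ j) x))"

lemma e_stable: "x \<in> C \<Longrightarrow> m \<le> N \<Longrightarrow> e N x = e m x"
  unfolding e_def by (rule sum.mono_neutral_right) (auto simp: nilpotent)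

text \<open>\<open>c_Suc\<close> says that e is a truncated exponential of -\<delta>: weighting by j
  shifts the index and changes the sign. The shift makes the truncation orders differ by one, until
  nilpotence lets them be identified.\<close>

lemma d_e_Suc: "x \<in> C \<Longrightarrow> d (e (Suc N) x) = e (Suc N) (d x) - \<kappa> (e N x)"
proof -
  assume x: "x \<in> C"
  have "d (e (Suc N) x) = (\<Sum>j\<le>Suc N. scal (c j) ((\<delta> ^^ j) (d x)))
      + (\<Sum>j\<le>Suc N. scal (c j * of_nat j) (\<kappa> ((\<delta> ^^ (j - 1)) x)))"
    unfolding e_def op_sum op_scal d_pow[OF x] scal_add scal_scal by (rule sum.distrib)
  also have "(\<Sum>j\<le>Suc N. scal (c j * of_nat j) (\<kappa> ((\<delta> ^^ (j - 1)) x)))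
      = (\<Sum>j\<le>N. scal (c (Suc j) * of_nat (Suc j)) (\<kappa> ((\<delta> ^^ j) x)))"
    by (subst sum.atMost_Suc_shift) simp
  also have "\<dots> = - \<kappa> (e N x)"
    unfolding e_def op_sum op_scal by (simp only: mult.commute[of "c _"] c_Suc scal_uminus_left sum_negf)
  finally show ?thesis by (simp add: e_def)
qed

lemma d_e: "x \<in> C \<Longrightarrow> d (e m x) = e m (d x) - \<kappa> (e m x)"
  using d_e_Suc[of x m] e_stable[of x "Suc m"] e_stable[of "d x" "Suc m"] op_C(1)[of x] by simp

text \<open>The homotopy accumulated when \<theta> is moved past j copies of \<delta>: a further
  \<delta> meets j terms containing \<Lambda>, and each of them contributes \<nu> through
  \<open>\<delta>_\<Lambda>\<close>.\<close>

primrec Hn :: "nat \<Rightarrow> 'v \<Rightarrow> 'v" where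
  "Hn 0 x = 0"
| "Hn (Suc j) x = \<delta> (Hn j x) + scal (of_nat j) (\<nu> ((\<delta> ^^ (j - 1)) x))"

lemma Hn_C: "x \<in> C \<Longrightarrow> Hn j x \<in> C"
  by (induction j) (auto intro!: C(1-3) op_C pow_C)

text \<open>The failure of the expected normal form for moving \<theta> past j copies of \<delta>.
  The binomial coefficient counts the pairs of factors whose commutators with \<theta> produce
  B.\<close>

definition defect where
  "defect j x = (\<delta> ^^ j) (\<theta> x) - (\<theta> ((\<delta> ^^ j) x) + scal (of_nat j) (\<Lambda> ((\<delta> ^^ (j - 1)) x))
    - scal (of_nat (j choose 2)) (B ((\<delta> ^^ (j - 2)) x)) + (d (Hn j x) - Hn j (d x)))"

text \<open>Applying \<delta> to the normal form reproduces the next one by Pascal's rule. What is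
  left over are the \<kappa> terms from moving d past \<delta>, once inside \<nu> and once in front
  of \<open>Hn\<close>.\<close>

lemma defect_Suc_Suc:
  assumes x: "x \<in> C" and j: "j = Suc i"
  shows "defect (Suc j) x = \<delta> (defect j x)
    - (scal (of_nat j) (\<nu> (scal (of_nat i) (\<kappa> ((\<delta> ^^ (i - 1)) x)))) + \<kappa> (Hn j x))"
proof -
  define p where "p = (\<delta> ^^ j) x"
  define q where "q = (\<delta> ^^ i) x"
  define q' where "q' = (\<delta> ^^ i) (d x)"
  define r where "r = scal (of_nat i) (\<kappa> ((\<delta> ^^ (i - 1)) x))"
  have pq: "\<delta> q = p" by (simp add: p_def q_def j)
  have idx: "Suc j - 1 = j" "Suc j - 2 = i" "j - 1 = i"
    by (simp_all add: j)
  have S: "scal (of_nat (Suc j)) y = scal (of_nat j) y + y" for y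
    by (simp add: scal_add_left scal_one add.commute)
  \<comment> \<open>For i = 0 the truncated exponent j - 2 would be wrong, but then (j choose 2) is
    0.\<close>
  have B: "scal (of_nat (j choose 2)) (\<delta> (B ((\<delta> ^^ (j - 2)) x))) = scal (of_nat (j choose 2)) (B q)"
    using x by (cases i) (simp_all add: j q_def \<delta>_B pow_C numeral_2_eq_2)
  have choose: "(of_nat (Suc j choose 2) :: 'k) = of_nat (j choose 2) + of_nat j"
    by (simp add: numeral_2_eq_2)
  have 1: "\<delta> (\<theta> p) = \<theta> (\<delta> p) + \<Lambda> p"
    by (simp add: \<delta>_\<theta> pow_C x p_def)
  have 2: "\<delta> (\<Lambda> q) = \<Lambda> p - B q + d (\<nu> q) - (\<nu> q' + \<nu> r)"
    by (simp add: \<delta>_\<Lambda> pow_C x q_def q'_def r_def d_pow op_add p_def j)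
  have 3: "\<delta> (d (Hn j x)) = d (\<delta> (Hn j x)) - \<kappa> (Hn j x)"
    by (simp add: d_\<delta> Hn_C x)
  have L: "defect (Suc j) x = \<delta> ((\<delta> ^^ j) (\<theta> x)) - (\<theta> (\<delta> p) + (scal (of_nat j) (\<Lambda> p) + \<Lambda> p)
      - (scal (of_nat (j choose 2)) (B q) + scal (of_nat j) (B q))
      + (d (\<delta> (Hn j x)) + scal (of_nat j) (d (\<nu> q)) - (\<delta> (Hn j (d x)) + scal (of_nat j) (\<nu> q'))))"
    by (simp only: defect_def choose idx Hn.simps funpow.simps o_apply S scal_add_left op_add op_scal
        p_def q_def q'_def)
  have R: "\<delta> (defect j x) = \<delta> ((\<delta> ^^ j) (\<theta> x)) - (\<theta> (\<delta> p) + \<Lambda> p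
      + scal (of_nat j) (\<Lambda> p - B q + d (\<nu> q) - (\<nu> q' + \<nu> r))
      - scal (of_nat (j choose 2)) (B q) + (d (\<delta> (Hn j x)) - \<kappa> (Hn j x) - \<delta> (Hn j (d x))))"
    by (simp only: defect_def op_minus op_add B idx p_def[symmetric] q_def[symmetric] op_scal 1 2 3)
  show ?thesis
    unfolding L R r_def[symmetric] scal_minus scal_add by (simp add: algebra_simps)
qed

text \<open>By the recursion the defects stay in K, which is stable under \<delta> and \<nu> and
  contains every value of \<kappa> on C. The cases j = 0 and j = 1 are exact and handled apart,
  because the recursion needs j = Suc i.\<close>

lemma pow_\<theta>: "x \<in> C \<Longrightarrow> defect j x \<in> K"
proof (induction j)
  case 0
  then show ?case by (simp add: defect_def K(1) op_zero numeral_2_eq_2)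
next
  case (Suc j)
  show ?case
  proof (cases j)
    case 0
    then show ?thesis using Suc.prems by (simp add: defect_def K(1) op_zero \<delta>_\<theta> scal_one numeral_2_eq_2)
  next
    case (Suc i)
    show ?thesis
      unfolding defect_Suc_Suc[OF Suc.prems Suc]
      by (intro K_minus op_K Suc.IH Suc.prems K(2) K(3) K(5) pow_C Hn_C)
  qed
qed

text \<open>The bound is m + 2 so that, after the index shifts by one and two, the sums for
  \<Lambda> and B still run at least up to m.\<close>

definition H where "H x = (\<Sum>j\<le>Suc (Suc m). scal (c j) (Hn j x))"

text \<open>The origin of the factor 1/2: two applications of \<open>c_Suc\<close> turn c(j+2)
  (j+2)(j+1) into c(j), and the binomial coefficient is half of that product.\<close>

lemma c_choose: "c (Suc (Suc j)) * of_nat (Suc (Suc j) choose 2) = half * c j"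
proof -
  have "(Suc (Suc j) choose 2) * 2 = Suc (Suc j) * Suc j"
    by (simp add: choose_two)
  then have "of_nat ((Suc (Suc j) choose 2) * 2) = (of_nat (Suc (Suc j) * Suc j) :: 'k)"
    by (rule arg_cong)
  then have nat: "of_nat (Suc (Suc j) choose 2) * 2 = (of_nat (Suc (Suc j)) * of_nat (Suc j) :: 'k)"
    by (simp only: of_nat_mult of_nat_numeral)
  have "c (Suc (Suc j)) * of_nat (Suc (Suc j) choose 2) = c (Suc (Suc j)) * of_nat (Suc (Suc j) choose 2) * (half + half)"
    by (simp only: half mult_1_right)
  also have "\<dots> = half * (c (Suc (Suc j)) * (of_nat (Suc (Suc j) choose 2) * 2))"
    by (simp add: algebra_simps)
  also have "c (Suc (Suc j)) * (of_nat (Suc (Suc j) choose 2) * 2) = of_nat (Suc j) * (of_nat (Suc (Suc j)) * c (Suc (Suc j)))"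
    unfolding nat by (simp only: ac_simps)
  also have "\<dots> = c j" by (simp only: c_Suc mult_minus_right minus_minus)
  finally show ?thesis .
qed

text \<open>The congruences of \<open>pow_\<theta>\<close> are weighted by c and added. After the
  index shifts, the \<Lambda> terms sum to -\<Lambda> e by \<open>c_Suc\<close> and the B terms to
  half of B e by \<open>c_choose\<close>.\<close>

lemma e_\<theta>:
  assumes x: "x \<in> C"
  shows "e m (\<theta> x) - (\<theta> (e m x) - \<Lambda> (e m x) - scal half (B (e m x)) + (d (H x) - H (d x))) \<in> K"
proof -
  let ?N = "Suc (Suc m)"
  have "(\<Sum>j\<le>?N. scal (c j) (defect j x)) \<in> K"
    by (intro K_sum K(3) pow_\<theta> x)
  also have "(\<Sum>j\<le>?N. scal (c j) (defect j x)) = e ?N (\<theta> x) - (\<theta> (e ?N x)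
      + (\<Sum>j\<le>?N. scal (c j * of_nat j) (\<Lambda> ((\<delta> ^^ (j - 1)) x)))
      - (\<Sum>j\<le>?N. scal (c j * of_nat (j choose 2)) (B ((\<delta> ^^ (j - 2)) x))) + (d (H x) - H (d x)))"
    by (simp only: defect_def e_def H_def op_sum op_scal
        scal_minus scal_add scal_scal sum_subtractf sum.distrib)
  also have "(\<Sum>j\<le>?N. scal (c j * of_nat j) (\<Lambda> ((\<delta> ^^ (j - 1)) x))) = - \<Lambda> (e (Suc m) x)"
  proof -
    have "(\<Sum>j\<le>?N. scal (c j * of_nat j) (\<Lambda> ((\<delta> ^^ (j - 1)) x)))
        = (\<Sum>j\<le>Suc m. scal (c (Suc j) * of_nat (Suc j)) (\<Lambda> ((\<delta> ^^ j) x)))"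
      by (subst sum.atMost_Suc_shift) simp
    also have "\<dots> = - \<Lambda> (e (Suc m) x)"
      unfolding e_def op_sum op_scal by (simp only: mult.commute[of "c _"] c_Suc scal_uminus_left sum_negf)
    finally show ?thesis .
  qed
  also have "(\<Sum>j\<le>?N. scal (c j * of_nat (j choose 2)) (B ((\<delta> ^^ (j - 2)) x))) = scal half (B (e m x))"
  proof -
    have "(\<Sum>j\<le>?N. scal (c j * of_nat (j choose 2)) (B ((\<delta> ^^ (j - 2)) x)))
        = (\<Sum>j\<le>m. scal (c (Suc (Suc j)) * of_nat (Suc (Suc j) choose 2)) (B ((\<delta> ^^ j) x)))"
      by (subst sum.atMost_Suc_shift, subst sum.atMost_Suc_shift) (simp add: numeral_2_eq_2)
    also have "\<dots> = scal half (B (e m x))"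
      by (simp only: e_def op_sum op_scal c_choose scal_scal[symmetric] scal_sum)
    finally show ?thesis .
  qed
  finally show ?thesis
    using e_stable[OF x, of "Suc m"] e_stable[OF x, of ?N] e_stable[of "\<theta> x" ?N] op_C(4)[of x] x
    by (simp add: algebra_simps)
qed

text \<open>The set S is left arbitrary so that one proof shows that H preserves both the carrier
  and the parity.\<close>

lemma H_closed:
  assumes "0 \<in> S" "\<And>x y. x \<in> S \<Longrightarrow> y \<in> S \<Longrightarrow> x + y \<in> S" "\<And>a x. x \<in> S \<Longrightarrow> scal a x \<in> S"
    "\<And>x. x \<in> S \<Longrightarrow> \<delta> x \<in> S" "\<And>x. x \<in> S \<Longrightarrow> \<nu> x \<in> S" "x \<in> S"
  shows "H x \<in> S"
proof -
  have pow: "(\<delta> ^^ j) x \<in> S" for j by (induction j) (auto intro: assms)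
  have Hn: "Hn j x \<in> S" for j by (induction j) (auto intro: assms pow)
  have "(\<Sum>j\<in>A. scal (c j) (Hn j x)) \<in> S" if "finite A" for A
    using that by induction (auto intro: assms Hn)
  from this[OF finite_atMost] show ?thesis unfolding H_def .
qed

lemma H_commute:
  assumes F: "\<And>x y. F (x + y) = F x + F y" "\<And>a x. F (scal a x) = scal a (F x)" "\<And>x. F (\<delta> x) = \<delta> (F x)"
    "\<And>x. F (\<nu> x) = \<nu> (F x)"
  shows "F (H x) = H (F x)"
proof -
  have F0: "F 0 = 0" using F(1)[of 0 0] by simp
  have pow: "F ((\<delta> ^^ j) x) = (\<delta> ^^ j) (F x)" for j by (induction j) (simp_all add: F)
  have Hn: "F (Hn j x) = Hn j (F x)" for j by (induction j) (simp_all add: F F0 pow)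
  have "F (\<Sum>j\<in>A. scal (c j) (Hn j x)) = (\<Sum>j\<in>A. scal (c j) (Hn j (F x)))" if "finite A" for A
    using that by induction (simp_all add: F F0 Hn)
  from this[OF finite_atMost] show ?thesis unfolding H_def .
qed

lemma H_add: "H (x + y) = H x + H y"
proof -
  have "Hn j (x + y) = Hn j x + Hn j y" for j
    by (induction j) (simp_all add: op_add pow_add scal_add)
  then show ?thesis by (simp only: H_def scal_add sum.distrib)
qed

end

section \<open>Operators on the exterior algebra\<close>

text \<open>The counterpart of \<open>ext_odd\<close> in an additive group; the sign is that of the
  odd operator f passing the \<theta>-factors.\<close>

definition eodd :: "('v \<Rightarrow> 'v::ab_group_add) \<Rightarrow> (nat set \<Rightarrow> 'v) \<Rightarrow> nat set \<Rightarrow> 'v" where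
  "eodd f w A = sg (odd (card A)) (f (w A))"

text \<open>The sign for moving \<open>\<theta>\<^sub>i\<close> to its place in the increasing
  product.\<close>

definition below :: "nat \<Rightarrow> nat set \<Rightarrow> bool" where
  "below i A \<longleftrightarrow> odd (card {j\<in>A. j < i})"

text \<open>\<open>wed i\<close> is \<open>\<theta>\<^sub>i\<close> and \<open>con i\<close> is \<open>\<theta>\<^sub>i\<^sup>*\<close>, in the encoding of \<open>wedge\<close> and \<open>contract\<close>.\<close>

definition wed :: "nat \<Rightarrow> (nat set \<Rightarrow> 'v::ab_group_add) \<Rightarrow> nat set \<Rightarrow> 'v" where
  "wed i w A = (if i \<in> A then sg (below i A) (w (A - {i})) else 0)"

definition con :: "nat \<Rightarrow> (nat set \<Rightarrow> 'v::ab_group_add) \<Rightarrow> nat set \<Rightarrow> 'v" where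
  "con i w A = (if i \<notin> A then sg (below i A) (w (insert i A)) else 0)"

text \<open>An infinite set has \<open>card\<close> equal to 0, so the Koszul sign does not change
  when an element is added to it. Requiring components to vanish off the subsets of
  \<open>{..<m}\<close> keeps the anticommutation laws true.\<close>

definition fsupp :: "nat \<Rightarrow> (nat set \<Rightarrow> 'v::zero) \<Rightarrow> bool" where
  "fsupp m w \<longleftrightarrow> (\<forall>A. \<not> A \<subseteq> {..<m} \<longrightarrow> w A = 0)"

lemma additive_sg: "additive f \<Longrightarrow> f (sg s x) = sg s (f x)"
  by (simp add: sg_def additive.minus)

lemma additive_eodd: "additive f \<Longrightarrow> additive (eodd f)"
  by (rule additive.intro, rule ext) (simp add: eodd_def sg_add additive.add)

lemma additive_wed: "additive (wed i)"
  by (rule additive.intro, rule ext) (simp add: wed_def sg_add)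

lemma additive_con: "additive (con i)"
  by (rule additive.intro, rule ext) (simp add: con_def sg_add)

lemma below_insert: "i \<notin> A \<Longrightarrow> below j (insert i A) \<longleftrightarrow> (below j A \<noteq> (i < j))"
proof (cases "i < j")
  case True
  assume "i \<notin> A"
  then have "{k \<in> insert i A. k < j} = insert i {k\<in>A. k < j}" "i \<notin> {k\<in>A. k < j}" using True by auto
  moreover have "finite {k\<in>A. k < j}" by (rule finite_subset[of _ "{..<j}"]) auto
  ultimately show ?thesis using True by (simp add: below_def)
next
  case False
  then have "{k \<in> insert i A. k < j} = {k\<in>A. k < j}" by auto
  with False show ?thesis by (simp add: below_def)
qed

lemma below_remove: "i \<in> A \<Longrightarrow> below j (A - {i}) \<longleftrightarrow> (below j A \<noteq> (i < j))"
  using below_insert[of i "A - {i}" j] by (auto simp: insert_absorb)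

text \<open>Both orders read the same component, and their signs are opposite because exactly one of
  i < j and j < i holds.\<close>

lemma con_con: "con i (con j w) = - con j (con i w)"
proof
  fix A
  show "con i (con j w) A = (- con j (con i w)) A"
  proof (cases "i = j \<or> i \<in> A \<or> j \<in> A")
    case True
    then show ?thesis by (auto simp: con_def)
  next
    case False
    then have "con i (con j w) A = sg (below i A \<noteq> (below j A \<noteq> (i < j))) (w (insert i (insert j A)))"
      by (simp add: con_def sg_sg below_insert insert_commute)
    moreover have "con j (con i w) A = sg (below j A \<noteq> (below i A \<noteq> (j < i))) (w (insert i (insert j A)))"
      using False by (simp add: con_def sg_sg below_insert)
    moreover have "(i < j) = (\<not> j < i)" using False by auto
    ultimately show ?thesis
      by (cases "below i A"; cases "below j A"; cases "j < i") (simp_all add: sg_def)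
  qed
qed

text \<open>The mixed Clifford relation. For i = j exactly one of the two products is nonzero at
  each A; for distinct indices the signs are opposite, as in \<open>con_con\<close>.\<close>

lemma con_wed: "con j (wed i w) = (if i = j then w else 0) - wed i (con j w)"
proof
  fix A
  show "con j (wed i w) A = ((if i = j then w else 0) - wed i (con j w)) A"
  proof (cases "i = j")
    case True
    show ?thesis
    proof (cases "i \<in> A")
      case A: True
      then show ?thesis
        using True by (simp add: con_def wed_def sg_sg below_remove insert_absorb)
    next
      case A: False
      then show ?thesis
        using True by (simp add: con_def wed_def sg_sg below_insert)
    qed
  next
    case False
    show ?thesis
    proof (cases "i \<in> A \<and> j \<notin> A")
      case A: True
      have "insert j A - {i} = insert j (A - {i})" using False by auto
      then have "con j (wed i w) A = sg (below j A \<noteq> (below i A \<noteq> (j < i))) (w (insert j (A - {i})))"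
        using A False by (simp add: con_def wed_def sg_sg below_insert)
      moreover have "wed i (con j w) A = sg (below i A \<noteq> (below j A \<noteq> (i < j))) (w (insert j (A - {i})))"
        using A False by (simp add: con_def wed_def sg_sg below_remove)
      moreover have "(i < j) = (\<not> j < i)" using False by auto
      ultimately show ?thesis
        using False by (cases "below i A"; cases "below j A"; cases "j < i") (simp_all add: sg_def)
    next
      case A: False
      then show ?thesis using False by (auto simp: con_def wed_def)
    qed
  qed
qed

lemma fsupp_con: "fsupp m w \<Longrightarrow> fsupp m (con i w)"
  by (simp add: fsupp_def con_def)

text \<open>The Koszul signs on the two sides belong to index sets whose sizes differ by
  one.\<close>

lemma con_eodd:
  assumes f: "additive f" and w: "fsupp m w"
  shows "con i (eodd f w) = - eodd f (con i w)"
proof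
  fix A
  show "con i (eodd f w) A = (- eodd f (con i w)) A"
  proof (cases "i \<in> A \<or> \<not> A \<subseteq> {..<m}")
    case True
    then have "con i w A = 0" "i \<notin> A \<Longrightarrow> w (insert i A) = 0"
      using w fsupp_con[OF w, of i] by (auto simp: con_def[of _ _ A] fsupp_def)
    then show ?thesis using additive.zero[OF f] by (auto simp: eodd_def con_def)
  next
    case False
    then have "finite A" using finite_subset by blast
    with False show ?thesis
      by (simp add: eodd_def con_def additive_sg[OF f] sg_sg) (auto simp: sg_def)
  qed
qed

lemma eodd_wed:
  assumes f: "additive f" and w: "fsupp m w"
  shows "eodd f (wed i w) = - wed i (eodd f w)"
proof
  fix A
  show "eodd f (wed i w) A = (- wed i (eodd f w)) A"
  proof (cases "i \<notin> A \<or> \<not> A - {i} \<subseteq> {..<m}")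
    case True
    then have "wed i w A = 0" "i \<in> A \<Longrightarrow> w (A - {i}) = 0" using w by (auto simp: wed_def fsupp_def)
    then show ?thesis using additive.zero[OF f] by (auto simp: eodd_def wed_def)
  next
    case False
    then have "finite (A - {i})" using finite_subset by blast
    then have "finite A" by simp
    then have "card A = Suc (card (A - {i}))" using False by (metis card_Suc_Diff1)
    with False show ?thesis
      by (simp add: eodd_def wed_def additive_sg[OF f] sg_sg) (auto simp: sg_def)
  qed
qed

lemma eodd_eodd: "additive f \<Longrightarrow> eodd f (eodd g w) A = f (g (w A))"
  by (simp add: eodd_def additive_sg sg_sg)

lemma fsupp_eodd: "additive f \<Longrightarrow> fsupp m w \<Longrightarrow> fsupp m (eodd f w)"
  by (auto simp: fsupp_def eodd_def additive.zero)

section \<open>Derivatives of the factorisation equations\<close>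

locale cut_system = tensor_setup n m l X Y + expansion m V \<sigma>
  for n m l and X :: "('k::comm_ring_1 pol, 'b) mfact" and Y :: "('k pol, 'a) mfact"
    and V :: "'k pol" and \<sigma> +
  fixes W U :: "'k pol" and \<iota> :: "rat \<Rightarrow> 'k"
  assumes W: "W \<in> carrier (poly_ring (VX ` {..<n}))" and U: "U \<in> carrier (poly_ring (VZ ` {..<l}))"
    and X_fact: "matrix_factorisation (poly_ring (VX ` {..<n} \<union> VY ` {..<m})) (V - W) X"
    and Y_fact: "matrix_factorisation (poly_ring (VY ` {..<m} \<union> VZ ` {..<l})) (U - V) Y"
    and \<iota>: "rat_algebra \<iota>"
begin

abbreviation V2 where "V2 i j \<equiv> pdiff (VY j) (pdiff (VY i) V)"
abbreviation X1 where "X1 i \<equiv> \<lambda>b c. pdiff (VY i) (mat X b c)"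
abbreviation X2 where "X2 i j \<equiv> \<lambda>b c. pdiff (VY j) (pdiff (VY i) (mat X b c))"

text \<open>\<open>lm i\<close> is \<open>\<lambda>\<^sub>i\<close>, and \<open>mu i j\<close> is \<open>1 \<otimes> \<partial>\<^sub>j\<partial>\<^sub>i(d\<^sub>X)\<close>, the homotopy between \<open>[\<lambda>\<^sub>i, \<lambda>\<^sub>j]\<close> and \<open>\<partial>\<^sub>j\<partial>\<^sub>i V\<close>.\<close>

definition lm where "lm i = rmat (X1 i)"
definition mu where "mu i j = rmat (X2 i j)"

lemma X_square: "b \<in> basis X \<Longrightarrow> c \<in> basis X \<Longrightarrow> (\<Sum>e\<in>basis X. mat X b e * mat X e c) = (if b = c then V - W else 0)"
  using X_fact unfolding matrix_factorisation_def by blast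

lemma Y_square: "b \<in> basis Y \<Longrightarrow> c \<in> basis Y \<Longrightarrow> (\<Sum>e\<in>basis Y. mat Y b e * mat Y e c) = (if b = c then U - V else 0)"
  using Y_fact unfolding matrix_factorisation_def by blast

lemma X_odd: "b \<in> basis X \<Longrightarrow> c \<in> basis X \<Longrightarrow> mat X b c \<noteq> 0 \<Longrightarrow> bodd X b \<noteq> bodd X c"
  using X_fact unfolding matrix_factorisation_def by blast

lemma Y_odd: "b \<in> basis Y \<Longrightarrow> c \<in> basis Y \<Longrightarrow> mat Y b c \<noteq> 0 \<Longrightarrow> bodd Y b \<noteq> bodd Y c"
  using Y_fact unfolding matrix_factorisation_def by blast

lemma pdiff_W: "pdiff (VY i) W = 0"
  by (rule pdiff_eq_zero[OF W]) auto

text \<open>The Leibniz rule applied to \<open>X_square\<close>; W disappears because it does not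
  involve y.\<close>

lemma X1_X: "b \<in> basis X \<Longrightarrow> c \<in> basis X \<Longrightarrow>
  (\<Sum>e\<in>basis X. mat X b e * X1 i e c) + (\<Sum>e\<in>basis X. X1 i b e * mat X e c) = (if b = c then t i else 0)"
proof -
  assume bc: "b \<in> basis X" "c \<in> basis X"
  have "(\<Sum>e\<in>basis X. mat X b e * X1 i e c) + (\<Sum>e\<in>basis X. X1 i b e * mat X e c)
      = pdiff (VY i) (\<Sum>e\<in>basis X. mat X b e * mat X e c)"
    by (simp only: pdiff_sum pdiff_mult sum.distrib add.commute)
  also have "\<dots> = (if b = c then t i else 0)"
    unfolding X_square[OF bc] by (simp add: pdiff_diff pdiff_W)
  finally show ?thesis .
qed

text \<open>The Leibniz rule applied once more to \<open>X1_X\<close>. The terms with two first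
  derivatives form an anticommutator, those with a second derivative its homotopy.\<close>

lemma X2_X: "b \<in> basis X \<Longrightarrow> c \<in> basis X \<Longrightarrow>
  (\<Sum>e\<in>basis X. X1 j b e * X1 i e c) + (\<Sum>e\<in>basis X. X1 i b e * X1 j e c)
  + (\<Sum>e\<in>basis X. mat X b e * X2 i j e c) + (\<Sum>e\<in>basis X. X2 i j b e * mat X e c)
  = (if b = c then V2 i j else 0)"
proof -
  assume bc: "b \<in> basis X" "c \<in> basis X"
  have "(\<Sum>e\<in>basis X. X1 j b e * X1 i e c) + (\<Sum>e\<in>basis X. X1 i b e * X1 j e c)
  + (\<Sum>e\<in>basis X. mat X b e * X2 i j e c) + (\<Sum>e\<in>basis X. X2 i j b e * mat X e c)
     = pdiff (VY j) ((\<Sum>e\<in>basis X. mat X b e * X1 i e c) + (\<Sum>e\<in>basis X. X1 i b e * mat X e c))"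
    by (simp only: pdiff_sum pdiff_add pdiff_mult sum.distrib ac_simps)
  also have "\<dots> = (if b = c then V2 i j else 0)"
    unfolding X1_X[OF bc] by simp
  finally show ?thesis .
qed

lemma additive_dT: "additive dT" and additive_lm: "additive (lm i)" and additive_mu: "additive (mu i j)"
  and additive_act: "additive (act p)"
  by (auto intro: additive.intro simp: dT_add lm_def mu_def rmat_add act_add)

text \<open>The part of d coming from Y anticommutes with any operator on X by the Koszul sign, so
  only \<open>X1_X\<close> contributes.\<close>

lemma dT_lm:
  assumes v: "supported v"
  shows "dT (lm i v) + lm i (dT v) = act (t i) v"
proof -
  have "(\<Sum>k\<in>{False, True}. rmat (if k then X1 i else mat X) (rmat (if k then mat X else X1 i) v)) = act (t i) v"
    by (rule rmat_rmat_scalar[OF v]) (simp add: X1_X)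
  then have 1: "rmat (mat X) (rmat (X1 i) v) + rmat (X1 i) (rmat (mat X) v) = act (t i) v" by simp
  have 2: "lmat (mat Y) (rmat (X1 i) v) + rmat (X1 i) (lmat (mat Y) v) = 0"
    by (rule lmat_rmat_anticommute) (rule Y_odd)
  have "dT (lm i v) + lm i (dT v) = (lmat (mat Y) (rmat (X1 i) v) + rmat (X1 i) (lmat (mat Y) v))
      + (rmat (mat X) (rmat (X1 i) v) + rmat (X1 i) (rmat (mat X) v))"
    unfolding dT_def lm_def rmat_add by (simp only: ac_simps)
  with 1 2 show ?thesis by simp
qed

lemma lm_lm:
  assumes v: "supported v"
  shows "lm j (lm i v) + lm i (lm j v) + dT (mu i j v) + mu i j (dT v) = act (V2 i j) v"
proof -
  \<comment> \<open>The four matrix products of \<open>X2_X\<close> are listed as a family to fit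
    \<open>rmat_rmat_scalar\<close>.\<close>
  define A where "A k = (if k = 0 then X1 j else if k = 1 then X1 i else if k = 2 then mat X else X2 i j)" for k :: nat
  define B where "B k = (if k = 0 then X1 i else if k = 1 then X1 j else if k = 2 then X2 i j else mat X)" for k :: nat
  have sum4: "(\<Sum>k\<in>{0, 1, 2, 3::nat}. f k) = f 0 + f 1 + f 2 + f 3" for f :: "nat \<Rightarrow> 'z::comm_monoid_add"
    by (simp add: add.assoc)
  have "(\<Sum>k\<in>{0, 1, 2, 3}. rmat (A k) (rmat (B k) v)) = act (V2 i j) v"
    by (rule rmat_rmat_scalar[OF v]) (unfold sum4, simp add: A_def B_def X2_X)
  then have 1: "lm j (lm i v) + lm i (lm j v) + rmat (mat X) (mu i j v) + mu i j (rmat (mat X) v) = act (V2 i j) v"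
    unfolding sum4 by (simp add: A_def B_def lm_def mu_def)
  have 2: "lmat (mat Y) (mu i j v) + mu i j (lmat (mat Y) v) = 0"
    unfolding mu_def by (rule lmat_rmat_anticommute) (rule Y_odd)
  have "lm j (lm i v) + lm i (lm j v) + dT (mu i j v) + mu i j (dT v)
      = (lm j (lm i v) + lm i (lm j v) + rmat (mat X) (mu i j v) + mu i j (rmat (mat X) v))
        + (lmat (mat Y) (mu i j v) + mu i j (lmat (mat Y) v))"
    unfolding dT_def additive.add[OF additive_mu] by (simp only: ac_simps)
  with 1 2 show ?thesis by simp
qed

text \<open>The mixed terms cancel, and the two squares U - V and V - W add up.\<close>

lemma dT_dT:
  assumes v: "supported v"
  shows "dT (dT v) = act (U - W) v"
proof -
  have 1: "rmat (mat X) (rmat (mat X) v) = act (V - W) v"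
    using rmat_rmat_scalar[OF v, where S = "{True}" and A = "\<lambda>_. mat X" and B = "\<lambda>_. mat X" and p = "V - W"] by (simp add: X_square)
  have 2: "lmat (mat Y) (lmat (mat Y) v) = act (U - V) v"
    unfolding lmat_lmat by (rule lmat_scalar[OF v]) (rule Y_square)
  have 3: "lmat (mat Y) (rmat (mat X) v) + rmat (mat X) (lmat (mat Y) v) = 0"
    by (rule lmat_rmat_anticommute) (rule Y_odd)
  have "dT (dT v) = (lmat (mat Y) (rmat (mat X) v) + rmat (mat X) (lmat (mat Y) v))
      + (lmat (mat Y) (lmat (mat Y) v) + rmat (mat X) (rmat (mat X) v))"
    unfolding dT_def lmat_add rmat_add by (simp only: ac_simps)
  also have "\<dots> = act ((U - V) + (V - W)) v"
    unfolding 1 2 3 act_add_left by simp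
  finally show ?thesis by simp
qed

lemma lm_closed: "v \<in> TC SM \<Longrightarrow> lm i v \<in> TC SM"
  unfolding lm_def by (intro rmat_closed Xmat_pdiff Xmat_X)

lemma mu_closed: "v \<in> TC SM \<Longrightarrow> mu i j v \<in> TC SM"
  unfolding mu_def by (intro rmat_closed Xmat_pdiff Xmat_X)

lemma KY_PR: "p \<in> carrier KY \<Longrightarrow> p \<in> carrier PR"
  by (erule poly_ring_mono) auto

subsection \<open>Congruence modulo the Jacobi ideal\<close>

text \<open>The kernel of the quotient map from \<open>Y \<otimes> X\<close> to \<open>Y | X\<close>.\<close>

definition TI where "TI = {v \<in> TC SM. \<forall>e \<mu>. v e \<mu> \<in> I}"

lemma TI_TC: "v \<in> TI \<Longrightarrow> v \<in> TC SM"
  by (simp add: TI_def)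

lemma mact_I:
  assumes p: "p \<in> carrier PR" and f: "\<And>\<nu>. f \<nu> \<in> I"
  shows "mact p f \<mu> \<in> I"
  unfolding mact_def sum_fun_apply mono_act_def
  by (intro sum) (auto intro!: mult scalar_closed p f zero)

lemma TI_zero: "0 \<in> TI"
  by (simp add: TI_def TS_zero zero)

lemma TI_add: "v \<in> TI \<Longrightarrow> w \<in> TI \<Longrightarrow> v + w \<in> TI"
  by (simp add: TI_def TS_add add)

lemma TI_uminus: "v \<in> TI \<Longrightarrow> - v \<in> TI"
  by (simp add: TI_def TS_uminus uminus)

lemma TI_sum: "(\<And>i. i \<in> S \<Longrightarrow> f i \<in> TI) \<Longrightarrow> (\<Sum>i\<in>S. f i) \<in> TI"
  by (induction S rule: infinite_finite_induct)
    (simp_all only: sum.infinite sum.empty sum.insert TI_zero TI_add insertI1 insertI2 not_False_eq_True)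

lemma TI_act: "v \<in> TI \<Longrightarrow> p \<in> carrier PR \<Longrightarrow> act p v \<in> TI"
  using act_closed[of v p] by (simp add: TI_def act_apply mact_I)

text \<open>Multiplication by an element of I lands in the kernel of the quotient; applied to the
  \<open>t\<^sub>j\<close>, it makes Koszul terms negligible.\<close>

lemma TI_act_I: "v \<in> TC SM \<Longrightarrow> p \<in> I \<Longrightarrow> act p v \<in> TI"
  using subset[of p] act_closed[of v p] KY_PR
  by (auto simp: TI_def act_apply mact_ky[OF subset] mult.commute[of p] intro!: mult TS_closed)

lemma TI_lmat: "v \<in> TI \<Longrightarrow> Ymat A \<Longrightarrow> lmat A v \<in> TI"
  unfolding TI_def using lmat_closed[of v A]
  by (auto simp: lmat_def sum_fun_apply Ymat_def zero intro!: sum mact_I)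

lemma TI_rmat: "v \<in> TI \<Longrightarrow> Xmat A \<Longrightarrow> rmat A v \<in> TI"
  unfolding TI_def using rmat_closed[of v A]
  by (auto simp: rmat_def sum_fun_apply Xmat_def zero intro!: sum mact_I sgn_mult_closed)

lemma TI_lm: "v \<in> TI \<Longrightarrow> lm i v \<in> TI"
  unfolding lm_def by (intro TI_rmat Xmat_pdiff Xmat_X)

lemma TI_mu: "v \<in> TI \<Longrightarrow> mu i j v \<in> TI"
  unfolding mu_def by (intro TI_rmat Xmat_pdiff Xmat_X)

lemma TI_dT: "v \<in> TI \<Longrightarrow> dT v \<in> TI"
  unfolding dT_def by (intro TI_add TI_lmat TI_rmat Xmat_X Ymat_Y)

section \<open>The exponential on the polynomial exterior algebra\<close>

definition ES :: "(nat set \<Rightarrow> 'a \<times> 'b \<Rightarrow> mono \<Rightarrow> 'k pol) set" where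
  "ES = {w. (\<forall>A. w A \<in> TC SM) \<and> fsupp m w}"

definition EI :: "(nat set \<Rightarrow> 'a \<times> 'b \<Rightarrow> mono \<Rightarrow> 'k pol) set" where
  "EI = {w. (\<forall>A. w A \<in> TI) \<and> fsupp m w}"

definition scl :: "'k pol \<Rightarrow> (nat set \<Rightarrow> 'a \<times> 'b \<Rightarrow> mono \<Rightarrow> 'k pol) \<Rightarrow> nat set \<Rightarrow> 'a \<times> 'b \<Rightarrow> mono \<Rightarrow> 'k pol" where
  "scl p w A = act p (w A)"

text \<open>\<open>delta_op\<close> and \<open>koszul\<close> are \<open>\<delta>\<close> and \<open>\<Sum>\<^sub>j t\<^sub>j \<theta>\<^sub>j\<^sup>*\<close>; \<open>hess_con\<close> and \<open>mu_con\<close> are the operators \<open>B\<close> and \<open>\<nu>\<close> of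
  \<open>perturbation\<close>.\<close>

definition delta_op where "delta_op w = (\<Sum>i<m. eodd (lm i) (con i w))"
definition koszul where "koszul w = (\<Sum>j<m. scl (t j) (con j w))"
definition hess_con where "hess_con i w = (\<Sum>j<m. scl (V2 i j) (con j w))"
definition mu_con where "mu_con i w = (\<Sum>j<m. eodd (mu i j) (con j w))"
definition exp_coeff :: "nat \<Rightarrow> 'k" where "exp_coeff j = \<iota> ((- 1) ^ j / fact j)"

lemma \<iota>_simps: "\<iota> 1 = 1" "\<iota> (a + b) = \<iota> a + \<iota> b" "\<iota> (a * b) = \<iota> a * \<iota> b"
  using \<iota> by (auto simp: rat_algebra_def)

lemma \<iota>_0: "\<iota> 0 = 0"
  using \<iota>_simps(2)[of 0 0] by simp

lemma \<iota>_uminus: "\<iota> (- a) = - \<iota> a"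
  using \<iota>_simps(2)[of a "- a"] by (simp add: \<iota>_0 eq_neg_iff_add_eq_0 add.commute)

lemma \<iota>_of_nat: "\<iota> (of_nat j) = of_nat j"
  by (induction j) (simp_all add: \<iota>_0 \<iota>_simps)

lemma exp_coeff_Suc: "of_nat (Suc j) * exp_coeff (Suc j) = - exp_coeff j"
proof -
  have "of_nat (Suc j) * exp_coeff (Suc j) = \<iota> (of_nat (Suc j) * ((- 1) ^ Suc j / fact (Suc j)))"
    unfolding exp_coeff_def \<iota>_simps(3) \<iota>_of_nat ..
  also have "of_nat (Suc j) * ((- 1) ^ Suc j / fact (Suc j)) = - ((- 1) ^ j / fact j :: rat)"
    by (simp add: divide_simps del: of_nat_Suc)
  finally show ?thesis unfolding \<iota>_uminus exp_coeff_def .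
qed

lemma half: "\<iota> (1 / 2) + \<iota> (1 / 2) = 1"
  unfolding \<iota>_simps(2)[symmetric] by (simp add: \<iota>_simps)

lemma additive_scl: "additive (scl p)"
  by (rule additive.intro, rule ext) (simp add: scl_def act_add)

lemma additive_delta_op: "additive delta_op" and additive_koszul: "additive koszul" and additive_hess_con: "additive (hess_con i)"
  and additive_mu_con: "additive (mu_con i)"
  by (rule additive.intro; simp only: delta_op_def koszul_def hess_con_def mu_con_def additive.add[OF additive_con]
      additive.add[OF additive_eodd[OF additive_lm]] additive.add[OF additive_eodd[OF additive_mu]]
      additive.add[OF additive_scl] sum.distrib)+

lemma scl_sg: "act p (sg s v) = sg s (act p v)"
  by (rule additive_sg[OF additive_act])

lemma scl_eodd: "(\<And>v. f (act p v) = act p (f v)) \<Longrightarrow> eodd f (scl p w) = scl p (eodd f w)"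
  by (rule ext) (simp add: eodd_def scl_def scl_sg)

lemma scl_con: "con i (scl p w) = scl p (con i w)"
  by (rule ext) (simp add: con_def scl_def scl_sg additive.zero[OF additive_act])

lemma scl_wed: "wed i (scl p w) = scl p (wed i w)"
  by (rule ext) (simp add: wed_def scl_def scl_sg additive.zero[OF additive_act])

lemma scl_scl: "scl p (scl q w) = scl (p * q) w"
  by (rule ext) (simp add: scl_def act_act)

lemma scl_commute: "scl p (scl q w) = scl q (scl p w)"
  by (simp add: scl_scl mult.commute)

lemma scl_sum: "scl p (\<Sum>i\<in>S. f i) = (\<Sum>i\<in>S. scl p (f i))"
  by (rule additive.sum[OF additive_scl])

lemma lm_act: "lm i (act p v) = act p (lm i v)" and mu_act: "mu i j (act p v) = act p (mu i j v)"
  by (simp_all add: lm_def mu_def act_rmat)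

lemma dT_act: "dT (act p v) = act p (dT v)"
  by (simp add: act_dT)

lemma scl_d: "eodd dT (scl p w) = scl p (eodd dT w)" and scl_lm: "eodd (lm i) (scl p w) = scl p (eodd (lm i) w)"
  and scl_mu: "eodd (mu i j) (scl p w) = scl p (eodd (mu i j) w)"
  by (rule scl_eodd; rule dT_act lm_act mu_act)+

lemma delta_op_scl: "delta_op (scl p w) = scl p (delta_op w)"
  unfolding delta_op_def scl_sum by (simp only: scl_con scl_lm)

lemma mu_con_scl: "mu_con i (scl p w) = scl p (mu_con i w)"
  unfolding mu_con_def scl_sum by (simp only: scl_con scl_mu)

lemma koszul_scl: "koszul (scl p w) = scl p (koszul w)"
  unfolding koszul_def scl_sum by (simp only: scl_con scl_commute[of p])

lemma hess_con_scl: "hess_con i (scl p w) = scl p (hess_con i w)"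
  unfolding hess_con_def scl_sum by (simp only: scl_con scl_commute[of p])

lemma ES_fsupp: "w \<in> ES \<Longrightarrow> fsupp m w" and ES_TC: "w \<in> ES \<Longrightarrow> w A \<in> TC SM"
  by (simp_all add: ES_def)

lemma ES_zero: "0 \<in> ES"
  by (simp add: ES_def fsupp_def TS_zero)

lemma ES_add: "v \<in> ES \<Longrightarrow> w \<in> ES \<Longrightarrow> v + w \<in> ES"
  by (simp add: ES_def fsupp_def TS_add)

lemma ES_sum: "(\<And>i. i \<in> S \<Longrightarrow> f i \<in> ES) \<Longrightarrow> (\<Sum>i\<in>S. f i) \<in> ES"
  by (induction S rule: infinite_finite_induct)
    (simp_all only: sum.infinite sum.empty sum.insert ES_zero ES_add insertI1 insertI2 not_False_eq_True)

lemma ES_scl: "w \<in> ES \<Longrightarrow> p \<in> carrier PR \<Longrightarrow> scl p w \<in> ES"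
  by (simp add: ES_def fsupp_def scl_def act_closed additive.zero[OF additive_act])

lemma TS_sg: "v \<in> TC SM \<Longrightarrow> sg s v \<in> TC SM"
  by (simp add: sg_def TS_uminus)

lemma ES_con: "w \<in> ES \<Longrightarrow> con i w \<in> ES"
  using fsupp_con[of m w i] by (simp add: ES_def con_def TS_sg TS_zero)

lemma ES_wed: "w \<in> ES \<Longrightarrow> i < m \<Longrightarrow> wed i w \<in> ES"
proof -
  assume w: "w \<in> ES" and i: "i < m"
  have "fsupp m (wed i w)"
    unfolding fsupp_def
  proof (intro allI impI)
    fix A assume A: "\<not> A \<subseteq> {..<m}"
    show "wed i w A = 0"
    proof (cases "i \<in> A")
      case True
      have "\<not> A - {i} \<subseteq> {..<m}" using A i by auto
      from ES_fsupp[OF w, unfolded fsupp_def, rule_format, OF this]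
      show ?thesis by (simp only: wed_def sg_zero if_cancel)
    qed (simp add: wed_def)
  qed
  with w show ?thesis by (simp add: ES_def wed_def TS_sg TS_zero)
qed

lemma ES_eodd: "w \<in> ES \<Longrightarrow> additive f \<Longrightarrow> (\<And>v. v \<in> TC SM \<Longrightarrow> f v \<in> TC SM) \<Longrightarrow> eodd f w \<in> ES"
  using fsupp_eodd[of f m w] by (simp add: ES_def eodd_def TS_sg)

lemma t_PR: "t i \<in> carrier PR" and V2_PR: "V2 i j \<in> carrier PR"
  by (intro KY_PR t_closed poly_ring_pdiff)+

lemma ES_d: "w \<in> ES \<Longrightarrow> eodd dT w \<in> ES" and ES_lm: "w \<in> ES \<Longrightarrow> eodd (lm i) w \<in> ES"
  and ES_mu: "w \<in> ES \<Longrightarrow> eodd (mu i j) w \<in> ES"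
  by (intro ES_eodd additive_dT additive_lm additive_mu dT_closed lm_closed mu_closed; assumption)+

lemma ES_delta_op: "w \<in> ES \<Longrightarrow> delta_op w \<in> ES" and ES_koszul: "w \<in> ES \<Longrightarrow> koszul w \<in> ES" and ES_hess_con: "w \<in> ES \<Longrightarrow> hess_con i w \<in> ES"
  and ES_mu_con: "w \<in> ES \<Longrightarrow> mu_con i w \<in> ES"
  unfolding delta_op_def koszul_def hess_con_def mu_con_def
  by (intro ES_sum ES_lm ES_mu ES_scl t_PR V2_PR ES_con; assumption)+

lemma EI_TI: "w \<in> EI \<Longrightarrow> w A \<in> TI"
  by (simp_all add: EI_def)

lemma EI_zero: "0 \<in> EI"
  by (simp add: EI_def fsupp_def TI_zero)

lemma EI_add: "v \<in> EI \<Longrightarrow> w \<in> EI \<Longrightarrow> v + w \<in> EI"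
  by (simp add: EI_def fsupp_def TI_add)

lemma EI_sum: "(\<And>i. i \<in> S \<Longrightarrow> f i \<in> EI) \<Longrightarrow> (\<Sum>i\<in>S. f i) \<in> EI"
  by (induction S rule: infinite_finite_induct)
    (simp_all only: sum.infinite sum.empty sum.insert EI_zero EI_add insertI1 insertI2 not_False_eq_True)

lemma TI_sg: "v \<in> TI \<Longrightarrow> sg s v \<in> TI"
  by (simp add: sg_def TI_uminus)

lemma EI_scl: "w \<in> EI \<Longrightarrow> p \<in> carrier PR \<Longrightarrow> scl p w \<in> EI"
  by (simp add: EI_def fsupp_def scl_def TI_act additive.zero[OF additive_act])

lemma EI_scl_I: "w \<in> ES \<Longrightarrow> p \<in> I \<Longrightarrow> scl p w \<in> EI"
  by (simp add: EI_def ES_def fsupp_def scl_def TI_act_I additive.zero[OF additive_act])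

lemma EI_con: "w \<in> EI \<Longrightarrow> con i w \<in> EI"
  using fsupp_con[of m w i] by (simp add: EI_def con_def TI_sg TI_zero)

lemma EI_eodd: "w \<in> EI \<Longrightarrow> additive f \<Longrightarrow> (\<And>v. v \<in> TI \<Longrightarrow> f v \<in> TI) \<Longrightarrow> eodd f w \<in> EI"
  using fsupp_eodd[of f m w] by (simp add: EI_def eodd_def TI_sg)

lemma EI_delta_op: "w \<in> EI \<Longrightarrow> delta_op w \<in> EI" and EI_mu_con: "w \<in> EI \<Longrightarrow> mu_con i w \<in> EI"
  unfolding delta_op_def mu_con_def
  by (intro EI_sum EI_eodd EI_con additive_lm additive_mu TI_lm TI_mu; assumption)+

lemma EI_koszul: "w \<in> ES \<Longrightarrow> koszul w \<in> EI"
  unfolding koszul_def by (intro EI_sum EI_scl_I ES_con t_in_I) simp_all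

lemma ES_supported: "w \<in> ES \<Longrightarrow> supported (w A)"
  by (rule TS_supported) (rule ES_TC)

section \<open>Commutation relations on the exterior algebra\<close>

lemma d_lm: "w \<in> ES \<Longrightarrow> eodd dT (eodd (lm i) w) + eodd (lm i) (eodd dT w) = scl (t i) w"
  by (rule ext) (simp add: eodd_eodd additive_dT additive_lm scl_def dT_lm ES_supported)

lemma lm_lm_ext: "w \<in> ES \<Longrightarrow> eodd (lm j) (eodd (lm i) w) + eodd (lm i) (eodd (lm j) w)
    + eodd dT (eodd (mu i j) w) + eodd (mu i j) (eodd dT w) = scl (V2 i j) w"
  by (rule ext) (simp add: eodd_eodd additive_dT additive_lm additive_mu scl_def lm_lm ES_supported)

lemma con_d: "w \<in> ES \<Longrightarrow> con i (eodd dT w) = - eodd dT (con i w)"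
  by (rule con_eodd[OF additive_dT ES_fsupp])

lemma con_lm: "w \<in> ES \<Longrightarrow> con i (eodd (lm j) w) = - eodd (lm j) (con i w)"
  by (rule con_eodd[OF additive_lm ES_fsupp])

text \<open>A contraction changes sign past \<lambda> and again past the contraction in \<delta>, so
  it commutes with \<delta>.\<close>

lemma con_delta_op: "w \<in> ES \<Longrightarrow> con j (delta_op w) = delta_op (con j w)"
proof -
  assume w: "w \<in> ES"
  have "con j (eodd (lm i) (con i w)) = eodd (lm i) (con i (con j w))" for i
  proof -
    have "con j (eodd (lm i) (con i w)) = - eodd (lm i) (con j (con i w))"
      by (rule con_lm[OF ES_con[OF w]])
    also have "con j (con i w) = - con i (con j w)" by (rule con_con)
    finally show ?thesis by (simp only: additive.minus[OF additive_eodd[OF additive_lm]] minus_minus)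
  qed
  then show ?thesis unfolding delta_op_def additive.sum[OF additive_con] by simp
qed

lemma koszul_delta_op: "w \<in> ES \<Longrightarrow> koszul (delta_op w) = delta_op (koszul w)" and hess_con_delta_op: "w \<in> ES \<Longrightarrow> delta_op (hess_con i w) = hess_con i (delta_op w)"
  unfolding koszul_def hess_con_def additive.sum[OF additive_delta_op] delta_op_scl by (simp_all only: con_delta_op)

text \<open>Since d anticommutes with contractions, the commutator with each summand of \<delta> is
  the anticommutator of d and \<lambda>, which is multiplication by \<open>t i\<close>.\<close>

lemma d_delta_op: "w \<in> ES \<Longrightarrow> eodd dT (delta_op w) = delta_op (eodd dT w) + koszul w"
proof -
  assume w: "w \<in> ES"
  have "eodd dT (eodd (lm i) (con i w)) = eodd (lm i) (con i (eodd dT w)) + scl (t i) (con i w)" for i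
    unfolding con_d[OF w] additive.minus[OF additive_eodd[OF additive_lm]] d_lm[OF ES_con[OF w], symmetric]
    by simp
  then show ?thesis
    unfolding delta_op_def koszul_def additive.sum[OF additive_eodd[OF additive_dT]] sum.distrib[symmetric] by simp
qed

text \<open>Only the summand with index i sees the unit in the Clifford relation; in the others
  \<theta> passes two odd operators.\<close>

lemma delta_op_wed: "w \<in> ES \<Longrightarrow> i < m \<Longrightarrow> delta_op (wed i w) = wed i (delta_op w) + eodd (lm i) w"
proof -
  assume w: "w \<in> ES" and i: "i < m"
  have "eodd (lm j) (con j (wed i w)) = wed i (eodd (lm j) (con j w)) + (if j = i then eodd (lm j) w else 0)" for j
  proof -
    have "eodd (lm j) (con j (wed i w)) = eodd (lm j) (if i = j then w else 0) - eodd (lm j) (wed i (con j w))"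
      unfolding con_wed by (rule additive.diff[OF additive_eodd[OF additive_lm]])
    also have "eodd (lm j) (wed i (con j w)) = - wed i (eodd (lm j) (con j w))"
      by (rule eodd_wed[OF additive_lm ES_fsupp[OF ES_con[OF w]]])
    finally have *: "eodd (lm j) (con j (wed i w)) = eodd (lm j) (if i = j then w else 0) + wed i (eodd (lm j) (con j w))"
      by (simp only: diff_minus_eq_add)
    show ?thesis
    proof (cases "i = j")
      case True
      then show ?thesis unfolding * by (simp only: if_True add.commute simp_thms)
    next
      case False
      then have "j \<noteq> i" by simp
      with False show ?thesis
        unfolding * by (simp only: if_False additive.zero[OF additive_eodd[OF additive_lm]] add_0_left add_0_right)
    qed
  qed
  then have "delta_op (wed i w) = (\<Sum>j<m. wed i (eodd (lm j) (con j w)) + (if j = i then eodd (lm j) w else 0))"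
    unfolding delta_op_def by (rule sum.cong[OF refl])
  also have "\<dots> = (\<Sum>j<m. wed i (eodd (lm j) (con j w))) + (\<Sum>j<m. if j = i then eodd (lm j) w else 0)"
    by (rule sum.distrib)
  also have "(\<Sum>j<m. if j = i then eodd (lm j) w else 0) = eodd (lm i) w"
    using i sum.delta[of "{..<m}" i "\<lambda>j. eodd (lm j) w"] by simp
  finally show ?thesis unfolding delta_op_def additive.sum[OF additive_wed] .
qed

text \<open>\<open>lm_lm_ext\<close> applied to each contraction. The products \<open>mu j\<close>
  with a contraction are even, which is why their sum \<open>mu_con\<close> enters through a
  commutator with d.\<close>

lemma delta_op_lm: "w \<in> ES \<Longrightarrow> delta_op (eodd (lm i) w) = eodd (lm i) (delta_op w) - hess_con i w + eodd dT (mu_con i w) - mu_con i (eodd dT w)"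
proof -
  assume w: "w \<in> ES"
  have *: "eodd (lm j) (con j (eodd (lm i) w)) = eodd (lm i) (eodd (lm j) (con j w)) - scl (V2 i j) (con j w)
      + eodd dT (eodd (mu i j) (con j w)) - eodd (mu i j) (con j (eodd dT w))" for j
    unfolding con_d[OF w] con_lm[OF w] additive.minus[OF additive_eodd[OF additive_lm]]
      additive.minus[OF additive_eodd[OF additive_mu]] lm_lm_ext[OF ES_con[OF w], symmetric]
    by (simp add: algebra_simps)
  show ?thesis
    unfolding delta_op_def hess_con_def mu_con_def additive.sum[OF additive_eodd[OF additive_lm]]
      additive.sum[OF additive_eodd[OF additive_dT]] sum.distrib[symmetric] sum_subtractf[symmetric]
    by (rule sum.cong[OF refl]) (rule *)
qed

text \<open>The component at A of the j-th power only sees components of \<theta>-degree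
  \<open>card A + j\<close>, and there are none above m.\<close>

lemma delta_op_degree: "w \<in> ES \<Longrightarrow> m < card A + j \<Longrightarrow> (delta_op ^^ j) w A = 0"
proof (induction j arbitrary: A)
  case 0
  then have "\<not> A \<subseteq> {..<m}" using card_mono[of "{..<m}" A] by auto
  then show ?case using ES_fsupp[OF 0(1)] by (simp add: fsupp_def)
next
  case (Suc j)
  have ES: "(delta_op ^^ j) w \<in> ES" for j using Suc.prems(1) by (induction j) (simp_all add: ES_delta_op)
  have con: "con i ((delta_op ^^ j) w) A = 0" for i
  proof (cases "i \<notin> A \<and> finite A")
    case True
    then have "m < card (insert i A) + j" using Suc.prems(2) by simp
    from Suc.IH[OF Suc.prems(1) this] have "(delta_op ^^ j) w (insert i A) = 0" .
    then show ?thesis by (simp only: con_def sg_zero if_cancel)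
  next
    case False
    show ?thesis
    proof (cases "i \<in> A")
      case True
      then show ?thesis by (simp add: con_def)
    next
      case i: False
      with False have "\<not> A \<subseteq> {..<m}" using finite_subset by blast
      from ES_fsupp[OF ES_con[OF ES, of i j], unfolded fsupp_def, rule_format, OF this] show ?thesis .
    qed
  qed
  have "(delta_op ^^ Suc j) w A = (\<Sum>i<m. sg (odd (card A)) (lm i (con i ((delta_op ^^ j) w) A)))"
    by (simp only: funpow.simps o_apply delta_op_def sum_fun_apply[of _ _ A] eodd_def)
  also have "\<dots> = 0"
    by (simp only: con additive.zero[OF additive_lm] sg_zero sum.neutral_const)
  finally show ?case .
qed

lemma delta_op_nilpotent: "w \<in> ES \<Longrightarrow> m < j \<Longrightarrow> (delta_op ^^ j) w = 0"
  by (rule ext) (simp add: delta_op_degree)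

text \<open>The modulus is \<open>EI\<close>: it absorbs the Koszul differential because each
  \<open>t\<^sub>j\<close> lies in the Jacobi ideal. The bound on i keeps \<open>wed i\<close>
  within the exterior algebra on m generators.\<close>

lemma perturbation:
  assumes i: "i < m"
  shows "perturbation (\<lambda>a. scl (const a)) (eodd dT) delta_op koszul (wed i) (eodd (lm i)) (hess_con i) (mu_con i) ES EI exp_coeff (\<iota> (1 / 2)) m"
proof (rule perturbation.intro)
  let ?ops = "{eodd dT, delta_op, koszul, wed i, eodd (lm i), hess_con i, mu_con i}"
  have ops: "additive f" if "f \<in> ?ops" for f
    using that additive_eodd[OF additive_dT] additive_eodd[OF additive_lm[of i]] additive_delta_op additive_koszul
      additive_wed[of i] additive_hess_con[of i] additive_mu_con[of i] by blast
  show "f (x + y) = f x + f y" if "f \<in> ?ops" for f x y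
    by (rule additive.add[OF ops[OF that]])
  show "scl (const a) (x + y) = scl (const a) x + scl (const a) y" for a x y
    by (rule additive.add[OF additive_scl])
  show "scl (const (a + b)) x = scl (const a) x + scl (const b) x" for a b x
    by (rule ext) (simp add: scl_def const_def single_add act_add_left)
  show "scl (const a) (scl (const b) x) = scl (const (a * b)) x" for a b x
    by (simp add: scl_scl const_def mult_single)
  show "scl (const 1) x = x" for x
    by (rule ext) (simp add: scl_def const_def act_one)
  show "f (scl (const a) x) = scl (const a) (f x)" if "f \<in> ?ops" for f a x
    using that by (auto simp: scl_d scl_lm delta_op_scl koszul_scl scl_wed hess_con_scl mu_con_scl)
  show "f x \<in> ES" if "f \<in> ?ops" "x \<in> ES" for f x
    using that by (auto simp: ES_d ES_delta_op ES_koszul ES_wed[OF _ i] ES_lm ES_hess_con ES_mu_con)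
  show "f x \<in> EI" if "f \<in> {delta_op, mu_con i}" "x \<in> EI" for f x
    using that by (auto simp: EI_delta_op EI_mu_con)
  show "scl (const a) x \<in> ES" if "x \<in> ES" for a x
    by (intro ES_scl that poly_ring_const)
  show "scl (const a) x \<in> EI" if "x \<in> EI" for a x
    by (intro EI_scl that poly_ring_const)
qed (simp_all only: ES_zero ES_add EI_zero EI_add EI_koszul d_delta_op koszul_delta_op delta_op_wed[OF _ i] delta_op_lm hess_con_delta_op delta_op_nilpotent
      exp_coeff_Suc half)

definition exp_delta :: "(nat set \<Rightarrow> 'a \<times> 'b \<Rightarrow> mono \<Rightarrow> 'k pol) \<Rightarrow> nat set \<Rightarrow> 'a \<times> 'b \<Rightarrow> mono \<Rightarrow> 'k pol" where
  "exp_delta w = (\<Sum>j\<le>m. scl (const (exp_coeff j)) ((delta_op ^^ j) w))"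

definition \<phi> where "\<phi> w = exp_delta w {}"

subsection \<open>Parity\<close>

definition hp :: "bool \<Rightarrow> ('a \<times> 'b \<Rightarrow> mono \<Rightarrow> 'k pol) set" where
  "hp s = {v \<in> TC SM. \<forall>a b. v (a, b) \<noteq> 0 \<longrightarrow> (bodd Y a \<noteq> bodd X b) = s}"

lemma hp_TC: "v \<in> hp s \<Longrightarrow> v \<in> TC SM"
  by (simp add: hp_def)

lemma hp_zero: "0 \<in> hp s"
  by (simp add: hp_def TS_zero)

lemma hp_add: "v \<in> hp s \<Longrightarrow> w \<in> hp s \<Longrightarrow> v + w \<in> hp s"
proof -
  assume v: "v \<in> hp s" and w: "w \<in> hp s"
  have "(bodd Y a \<noteq> bodd X b) = s" if "(v + w) (a, b) \<noteq> 0" for a b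
  proof -
    from that have "v (a, b) \<noteq> 0 \<or> w (a, b) \<noteq> 0" by auto
    with v w show ?thesis unfolding hp_def by blast
  qed
  with v w show ?thesis by (simp add: hp_def TS_add)
qed

lemma hp_uminus: "v \<in> hp s \<Longrightarrow> - v \<in> hp s"
  by (simp add: hp_def TS_uminus)

lemma hp_diff: "v \<in> hp s \<Longrightarrow> w \<in> hp s \<Longrightarrow> v - w \<in> hp s"
  using hp_add[of v s "- w"] hp_uminus[of w s] by simp

lemma hp_sg: "v \<in> hp s \<Longrightarrow> sg s' v \<in> hp s"
  by (simp add: sg_def hp_uminus)

lemma hp_sum: "(\<And>i. i \<in> S \<Longrightarrow> f i \<in> hp s) \<Longrightarrow> (\<Sum>i\<in>S. f i) \<in> hp s"
  by (induction S rule: infinite_finite_induct)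
    (simp_all only: sum.infinite sum.empty sum.insert hp_zero hp_add insertI1 insertI2 not_False_eq_True)

lemma hp_act: "v \<in> hp s \<Longrightarrow> p \<in> carrier PR \<Longrightarrow> act p v \<in> hp s"
proof -
  assume v: "v \<in> hp s" and p: "p \<in> carrier PR"
  have "v (a, b) \<noteq> 0" if "act p v (a, b) \<noteq> 0" for a b
    using that by (auto simp: act_apply)
  with v act_closed[OF hp_TC[OF v] p] show ?thesis by (simp add: hp_def)
qed

lemma hp_rmat:
  assumes v: "v \<in> hp s" and A: "Xmat A"
    and odd: "\<And>b c. b \<in> basis X \<Longrightarrow> c \<in> basis X \<Longrightarrow> A b c \<noteq> 0 \<Longrightarrow> bodd X b \<noteq> bodd X c"
  shows "rmat A v \<in> hp (\<not> s)"
proof -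
  have "(bodd Y a \<noteq> bodd X b) = (\<not> s)" if nz: "rmat A v (a, b) \<noteq> 0" for a b
  proof -
    have ab: "a \<in> basis Y" "b \<in> basis X" using nz supported_rmat[of A v] unfolding supported_def by blast+
    from nz[unfolded rmat_apply[OF ab]] obtain c where c: "c \<in> basis X"
      and ne: "mact (sgn_pol (bodd Y a) * A b c) (v (a, c)) \<noteq> 0"
      by (meson sum.neutral)
    from ne have "A b c \<noteq> 0" "v (a, c) \<noteq> 0" by auto
    with odd[OF ab(2) c] v have "bodd X b \<noteq> bodd X c" "(bodd Y a \<noteq> bodd X c) = s" unfolding hp_def by blast+
    then show ?thesis by blast
  qed
  then show ?thesis using rmat_closed[OF hp_TC[OF v] A] by (simp add: hp_def)
qed

lemma hp_lmat:
  assumes v: "v \<in> hp s" and A: "Ymat A"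
    and odd: "\<And>b c. b \<in> basis Y \<Longrightarrow> c \<in> basis Y \<Longrightarrow> A b c \<noteq> 0 \<Longrightarrow> bodd Y b \<noteq> bodd Y c"
  shows "lmat A v \<in> hp (\<not> s)"
proof -
  have "(bodd Y a \<noteq> bodd X b) = (\<not> s)" if nz: "lmat A v (a, b) \<noteq> 0" for a b
  proof -
    have ab: "a \<in> basis Y" "b \<in> basis X" using nz supported_lmat[of A v] unfolding supported_def by blast+
    from nz[unfolded lmat_apply[OF ab]] obtain c where c: "c \<in> basis Y"
      and ne: "mact (A a c) (v (c, b)) \<noteq> 0"
      by (meson sum.neutral)
    from ne have "A a c \<noteq> 0" "v (c, b) \<noteq> 0" by auto
    with odd[OF ab(1) c] v have "bodd Y a \<noteq> bodd Y c" "(bodd Y c \<noteq> bodd X b) = s" unfolding hp_def by blast+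
    then show ?thesis by blast
  qed
  then show ?thesis using lmat_closed[OF hp_TC[OF v] A] by (simp add: hp_def)
qed

lemma X1_odd: "b \<in> basis X \<Longrightarrow> c \<in> basis X \<Longrightarrow> X1 i b c \<noteq> 0 \<Longrightarrow> bodd X b \<noteq> bodd X c"
  by (rule X_odd) auto

lemma X2_odd: "b \<in> basis X \<Longrightarrow> c \<in> basis X \<Longrightarrow> X2 i j b c \<noteq> 0 \<Longrightarrow> bodd X b \<noteq> bodd X c"
  by (rule X_odd) auto

lemma hp_lm: "v \<in> hp s \<Longrightarrow> lm i v \<in> hp (\<not> s)"
  unfolding lm_def by (rule hp_rmat[OF _ Xmat_pdiff[OF Xmat_X] X1_odd])

lemma hp_mu: "v \<in> hp s \<Longrightarrow> mu i j v \<in> hp (\<not> s)"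
  unfolding mu_def by (rule hp_rmat[OF _ Xmat_pdiff[OF Xmat_pdiff[OF Xmat_X]] X2_odd])

lemma hp_dT: "v \<in> hp s \<Longrightarrow> dT v \<in> hp (\<not> s)"
  unfolding dT_def by (intro hp_add hp_lmat hp_rmat Ymat_Y Xmat_X; (assumption | rule Y_odd X_odd)?)

definition hpE :: "bool \<Rightarrow> (nat set \<Rightarrow> 'a \<times> 'b \<Rightarrow> mono \<Rightarrow> 'k pol) set" where
  "hpE s = {w \<in> ES. \<forall>A\<subseteq>{..<m}. w A \<in> hp (odd (card A) \<noteq> s)}"

lemma hpE_ES: "w \<in> hpE s \<Longrightarrow> w \<in> ES"
  by (simp add: hpE_def)

lemma hpE_I: "w \<in> ES \<Longrightarrow> (\<And>A. A \<subseteq> {..<m} \<Longrightarrow> w A \<in> hp (odd (card A) \<noteq> s)) \<Longrightarrow> w \<in> hpE s"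
  by (simp add: hpE_def)

lemma hpE_D: "w \<in> hpE s \<Longrightarrow> A \<subseteq> {..<m} \<Longrightarrow> w A \<in> hp (odd (card A) \<noteq> s)"
  by (simp add: hpE_def)

lemma hpE_zero: "0 \<in> hpE s"
  by (rule hpE_I) (simp_all add: ES_zero hp_zero)

lemma hpE_add: "v \<in> hpE s \<Longrightarrow> w \<in> hpE s \<Longrightarrow> v + w \<in> hpE s"
  by (rule hpE_I) (simp_all only: ES_add hpE_ES plus_fun_apply hp_add hpE_D)

lemma hpE_sum: "(\<And>i. i \<in> S \<Longrightarrow> f i \<in> hpE s) \<Longrightarrow> (\<Sum>i\<in>S. f i) \<in> hpE s"
  by (induction S rule: infinite_finite_induct)
    (simp_all only: sum.infinite sum.empty sum.insert hpE_zero hpE_add insertI1 insertI2 not_False_eq_True)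

lemma hpE_scl: "w \<in> hpE s \<Longrightarrow> p \<in> carrier PR \<Longrightarrow> scl p w \<in> hpE s"
  by (rule hpE_I) (simp_all only: ES_scl hpE_ES scl_def hp_act hpE_D)

lemma hpE_con: "w \<in> hpE s \<Longrightarrow> i < m \<Longrightarrow> con i w \<in> hpE (\<not> s)"
proof (rule hpE_I)
  fix A assume w: "w \<in> hpE s" and i: "i < m" and A: "A \<subseteq> {..<m}"
  have fin: "finite A" using A finite_subset by blast
  show "con i w A \<in> hp (odd (card A) \<noteq> (\<not> s))"
  proof (cases "i \<in> A")
    case True
    then show ?thesis by (simp add: con_def hp_zero)
  next
    case False
    have "w (insert i A) \<in> hp (odd (card (insert i A)) \<noteq> s)" using A i by (intro hpE_D[OF w]) auto
    with False fin show ?thesis by (simp add: con_def hp_sg)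
  qed
qed (simp add: ES_con hpE_ES)

lemma hpE_wed: "w \<in> hpE s \<Longrightarrow> i < m \<Longrightarrow> wed i w \<in> hpE (\<not> s)"
proof (rule hpE_I)
  fix A assume w: "w \<in> hpE s" and i: "i < m" and A: "A \<subseteq> {..<m}"
  have fin: "finite A" using A finite_subset by blast
  show "wed i w A \<in> hp (odd (card A) \<noteq> (\<not> s))"
  proof (cases "i \<in> A")
    case False
    then show ?thesis by (simp add: wed_def hp_zero)
  next
    case True
    have "w (A - {i}) \<in> hp (odd (card (A - {i})) \<noteq> s)" using A by (intro hpE_D[OF w]) auto
    then have "wed i w A \<in> hp (odd (card (A - {i})) \<noteq> s)" using True by (simp only: wed_def if_True hp_sg)
    moreover have "Suc (card (A - {i})) = card A" using True fin by (metis card_Suc_Diff1)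
    then have "(odd (card (A - {i})) \<noteq> s) = (odd (card A) \<noteq> (\<not> s))" by (metis even_Suc)
    ultimately show ?thesis by (simp only:)
  qed
qed (simp add: ES_wed hpE_ES)

lemma hpE_eodd:
  assumes "w \<in> hpE s" "additive f" "\<And>s v. v \<in> hp s \<Longrightarrow> f v \<in> hp (\<not> s)" "\<And>v. v \<in> TC SM \<Longrightarrow> f v \<in> TC SM"
  shows "eodd f w \<in> hpE (\<not> s)"
proof (rule hpE_I)
  fix A assume "A \<subseteq> {..<m}"
  from assms(3)[OF hpE_D[OF assms(1) this]] show "eodd f w A \<in> hp (odd (card A) \<noteq> (\<not> s))"
    by (simp add: eodd_def hp_sg)
qed (intro ES_eodd hpE_ES[OF assms(1)] assms)

lemma hpE_d: "w \<in> hpE s \<Longrightarrow> eodd dT w \<in> hpE (\<not> s)"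
  by (rule hpE_eodd[OF _ additive_dT hp_dT dT_closed])

text \<open>A contraction and an odd operator each reverse the parity, hence the double negation
  below.\<close>

lemma hpE_delta_op: "w \<in> hpE s \<Longrightarrow> delta_op w \<in> hpE s" and hpE_mu_con: "w \<in> hpE s \<Longrightarrow> mu_con i w \<in> hpE s"
proof -
  assume w: "w \<in> hpE s"
  have "eodd (lm j) (con j w) \<in> hpE (\<not> \<not> s)" "eodd (mu i j) (con j w) \<in> hpE (\<not> \<not> s)" if "j < m" for j
    by (rule hpE_eodd[OF hpE_con[OF w that] additive_lm hp_lm lm_closed]
          hpE_eodd[OF hpE_con[OF w that] additive_mu hp_mu mu_closed]; assumption)+
  then show "delta_op w \<in> hpE s" "mu_con i w \<in> hpE s" unfolding delta_op_def mu_con_def by (auto intro: hpE_sum)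
qed

section \<open>Linearity, parity and differential of the lift \<phi>\<close>

lemma pow_ES: "w \<in> ES \<Longrightarrow> (delta_op ^^ j) w \<in> ES"
  by (induction j) (simp_all add: ES_delta_op)

lemma const_PR: "const c \<in> carrier PR"
  by (rule poly_ring_const)

lemma exp_delta_ES: "w \<in> ES \<Longrightarrow> exp_delta w \<in> ES"
  unfolding exp_delta_def by (intro ES_sum ES_scl pow_ES const_PR)

lemma con_exp_delta: "w \<in> ES \<Longrightarrow> con j (exp_delta w) = exp_delta (con j w)"
proof -
  assume w: "w \<in> ES"
  have "con j ((delta_op ^^ k) w) = (delta_op ^^ k) (con j w)" for k
    by (induction k) (simp_all add: con_delta_op pow_ES w)
  then show ?thesis unfolding exp_delta_def additive.sum[OF additive_con] scl_con by simp
qed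

lemma \<phi>_TC: "w \<in> ES \<Longrightarrow> \<phi> w \<in> TC SM"
  unfolding \<phi>_def by (rule ES_TC) (rule exp_delta_ES)

lemma \<phi>_add: "\<phi> (v + w) = \<phi> v + \<phi> w"
proof -
  have "(delta_op ^^ j) (v + w) = (delta_op ^^ j) v + (delta_op ^^ j) w" for j
    by (induction j) (simp_all only: funpow.simps id_apply o_apply additive.add[OF additive_delta_op])
  then have "exp_delta (v + w) = exp_delta v + exp_delta w"
    unfolding exp_delta_def by (simp only: additive.add[OF additive_scl] sum.distrib)
  then show ?thesis by (simp add: \<phi>_def)
qed

lemma \<phi>_scl: "\<phi> (scl p w) = act p (\<phi> w)"
proof -
  have "(delta_op ^^ j) (scl p w) = scl p ((delta_op ^^ j) w)" for j
    by (induction j) (simp_all add: delta_op_scl)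
  then have "exp_delta (scl p w) = scl p (exp_delta w)"
    unfolding exp_delta_def scl_sum by (simp only: scl_commute[of p])
  then show ?thesis by (simp add: \<phi>_def scl_def)
qed

lemma \<phi>_hp: "w \<in> hpE s \<Longrightarrow> \<phi> w \<in> hp s"
proof -
  assume w: "w \<in> hpE s"
  have "(delta_op ^^ j) w \<in> hpE s" for j by (induction j) (simp_all add: w hpE_delta_op)
  then have "exp_delta w \<in> hpE s" unfolding exp_delta_def by (intro hpE_sum hpE_scl const_PR)
  from hpE_D[OF this, of "{}"] show ?thesis by (simp add: \<phi>_def)
qed

lemma eodd_empty: "eodd f w {} = f (w {})"
  by (simp add: eodd_def)

lemma koszul_empty: "koszul w {} = (\<Sum>j<m. act (t j) (con j w {}))"
  by (simp add: koszul_def sum_fun_apply[of _ _ "{}"] scl_def)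

lemma hess_con_empty: "hess_con i w {} = (\<Sum>j<m. act (V2 i j) (con j w {}))"
  by (simp add: hess_con_def sum_fun_apply[of _ _ "{}"] scl_def)

lemma con_exp_delta_empty: "w \<in> ES \<Longrightarrow> con j (exp_delta w) {} = \<phi> (con j w)"
  by (simp add: \<phi>_def con_exp_delta)

text \<open>The component of \<theta>-degree zero of \<open>d_e\<close>; contractions commute with
  the exponential because they commute with \<delta>.\<close>

lemma \<phi>_d:
  assumes w: "w \<in> ES" and m: "0 < m"
  shows "\<phi> (eodd dT w) = dT (\<phi> w) + (\<Sum>j<m. act (t j) (\<phi> (con j w)))"
proof -
  \<comment> \<open>The index 0 only serves to enter the locale: \<open>d_e\<close> speaks of d,
    \<delta> and \<kappa>, which are the same for every i.\<close>
  interpret Pt: perturbation "\<lambda>a. scl (const a)" "eodd dT" delta_op koszul "wed 0" "eodd (lm 0)" "hess_con 0" "mu_con 0" ES EI exp_coeff "\<iota> (1 / 2)" m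
    by (rule perturbation[OF m])
  have e: "Pt.e m x = exp_delta x" for x by (simp add: Pt.e_def exp_delta_def)
  have "eodd dT (exp_delta w) {} = (exp_delta (eodd dT w) - koszul (exp_delta w)) {}"
    using Pt.d_e[OF w] unfolding e by simp
  then have "dT (\<phi> w) = \<phi> (eodd dT w) - (\<Sum>j<m. act (t j) (\<phi> (con j w)))"
    by (simp only: eodd_empty minus_apply koszul_empty con_exp_delta_empty[OF w] \<phi>_def[symmetric])
  then show ?thesis by (simp only: diff_add_cancel)
qed

text \<open>The component of \<theta>-degree zero of \<open>e_\<theta>\<close>, in which the term
  \<theta> e drops out since a wedge product has positive degree. The homotopy is built from
  matrices and contractions, so it is linear exactly and not just modulo t.\<close>

lemma \<phi>_wed:
  assumes i: "i < m"
  obtains H where "\<And>w. w \<in> ES \<Longrightarrow> H w \<in> TC SM" "\<And>s w. w \<in> hpE s \<Longrightarrow> H w \<in> hp s"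
    "\<And>v w. H (v + w) = H v + H w" "\<And>p w. H (scl p w) = act p (H w)"
    "\<And>w. w \<in> ES \<Longrightarrow> \<phi> (wed i w) - (- lm i (\<phi> w) - act (const (\<iota> (1 / 2))) (\<Sum>j<m. act (V2 i j) (\<phi> (con j w)))
      + (dT (H w) - H (eodd dT w))) \<in> TI"
proof -
  interpret Pt: perturbation "\<lambda>a. scl (const a)" "eodd dT" delta_op koszul "wed i" "eodd (lm i)" "hess_con i" "mu_con i" ES EI exp_coeff "\<iota> (1 / 2)" m
    by (rule perturbation[OF i])
  have e: "Pt.e m x = exp_delta x" for x by (simp add: Pt.e_def exp_delta_def)
  define H where "H w = Pt.H w {}" for w
  show ?thesis
  proof
    show "H w \<in> TC SM" if "w \<in> ES" for w
      unfolding H_def by (rule ES_TC) (rule Pt.H_closed; simp add: ES_zero ES_add ES_scl ES_delta_op ES_mu_con const_PR that)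
    show "H w \<in> hp s" if "w \<in> hpE s" for s w
    proof -
      have "Pt.H w \<in> hpE s"
        by (rule Pt.H_closed; simp add: hpE_zero hpE_add hpE_scl hpE_delta_op hpE_mu_con const_PR that)
      from hpE_D[OF this, of "{}"] show ?thesis by (simp add: H_def)
    qed
    show "H (v + w) = H v + H w" for v w
      by (simp add: H_def Pt.H_add)
    show "H (scl p w) = act p (H w)" for p w
    proof -
      have "scl p (Pt.H w) = Pt.H (scl p w)"
        by (rule Pt.H_commute)
          (simp_all only: additive.add[OF additive_scl] scl_commute[of p] delta_op_scl mu_con_scl)
      from fun_cong[OF this, of "{}"] show ?thesis by (simp only: H_def scl_def)
    qed
    show "\<phi> (wed i w) - (- lm i (\<phi> w) - act (const (\<iota> (1 / 2))) (\<Sum>j<m. act (V2 i j) (\<phi> (con j w)))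
      + (dT (H w) - H (eodd dT w))) \<in> TI" if w: "w \<in> ES" for w
    proof -
      from EI_TI[OF Pt.e_\<theta>[OF w], of "{}"]
      have "exp_delta (wed i w) {} - (wed i (exp_delta w) {} - lm i (exp_delta w {}) - act (const (\<iota> (1 / 2))) (hess_con i (exp_delta w) {})
          + (dT (Pt.H w {}) - Pt.H (eodd dT w) {})) \<in> TI"
        unfolding e by (simp only: minus_apply plus_fun_apply eodd_empty scl_def)
      moreover have "wed i (exp_delta w) {} = 0" by (simp add: wed_def)
      ultimately show ?thesis
        unfolding hess_con_empty con_exp_delta_empty[OF w] by (simp only: H_def \<phi>_def diff_0)
    qed
  qed
qed

section \<open>The connection on lifts\<close>

definition conn_lift :: "nat \<Rightarrow> ('a \<times> 'b \<Rightarrow> mono \<Rightarrow> 'k pol) \<Rightarrow> 'a \<times> 'b \<Rightarrow> mono \<Rightarrow> 'k pol" where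
  "conn_lift q v = coeffwise (D q) v"

lemma conn_lift_apply: "conn_lift q v e \<mu> = D q (v e \<mu>)"
  by (simp add: conn_lift_def coeffwise_def)

lemma conn_lift_TC: "v \<in> TC SM \<Longrightarrow> conn_lift q v \<in> TC SM"
  unfolding conn_lift_def by (rule TC_coeffwise[where M = SM]) (simp_all add: D_closed)

lemma conn_lift_hp: "v \<in> hp s \<Longrightarrow> conn_lift q v \<in> hp s"
proof -
  assume v: "v \<in> hp s"
  have "v (a, b) \<noteq> 0" if "conn_lift q v (a, b) \<noteq> 0" for a b
  proof
    assume "v (a, b) = 0"
    then have "conn_lift q v (a, b) = 0" by (intro ext) (simp add: conn_lift_apply)
    with that show False ..
  qed
  with v conn_lift_TC[OF hp_TC[OF v]] show ?thesis by (simp add: hp_def)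
qed

lemma TI_I: "v \<in> TC SM \<Longrightarrow> (\<And>e \<mu>. v e \<mu> \<in> I) \<Longrightarrow> v \<in> TI"
  by (simp add: TI_def)

lemma TI_diff: "v \<in> TI \<Longrightarrow> w \<in> TI \<Longrightarrow> v - w \<in> TI"
  using TI_add[of v "- w"] TI_uminus[of w] by simp

lemma D_sum:
  assumes q: "q < m" and f: "\<And>i. i \<in> S \<Longrightarrow> f i \<in> carrier KY"
  shows "D q (\<Sum>i\<in>S. f i) - (\<Sum>i\<in>S. D q (f i)) \<in> I"
  using f
proof (induction S rule: infinite_finite_induct)
  case (insert i S)
  have "(\<Sum>i\<in>S. f i) \<in> carrier KY" using insert by (intro poly_ring_sum) simp
  from add[OF D_add[OF _ this q, of "f i"] insert.IH] insert show ?case by (simp add: algebra_simps)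
qed (simp_all add: zero)

lemma conn_lift_add:
  assumes q: "q < m" and v: "v \<in> TC SM" "w \<in> TC SM"
  shows "conn_lift q (v + w) - (conn_lift q v + conn_lift q w) \<in> TI"
proof (rule TI_I)
  show "(conn_lift q (v + w) - (conn_lift q v + conn_lift q w)) e \<mu> \<in> I" for e \<mu>
    using D_add[OF TS_closed[OF v(1)] TS_closed[OF v(2)] q, of e \<mu> e \<mu>] by (simp add: conn_lift_apply)
qed (intro TS_diff TS_add conn_lift_TC v)

lemma conn_lift_sum:
  assumes q: "q < m" and f: "\<And>i. i \<in> S \<Longrightarrow> f i \<in> TC SM"
  shows "conn_lift q (\<Sum>i\<in>S. f i) - (\<Sum>i\<in>S. conn_lift q (f i)) \<in> TI"
proof (rule TI_I)
  show "(conn_lift q (\<Sum>i\<in>S. f i) - (\<Sum>i\<in>S. conn_lift q (f i))) e \<mu> \<in> I" for e \<mu>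
    using D_sum[OF q, of S "\<lambda>i. f i e \<mu>"] TS_closed[OF f]
    by (simp add: conn_lift_apply sum_fun_apply[of _ S e] sum_fun_apply[of _ S \<mu>])
qed (intro TS_diff TS_sum conn_lift_TC f)

lemma act_t_apply: "act (t j) v e \<mu> = t j * v e \<mu>"
  unfolding act_apply by (rule mact_ky) (rule t_closed)

text \<open>The product rule modulo I: the term \<open>t j\<close> times a derivative is zero
  there.\<close>

lemma conn_lift_t:
  assumes q: "q < m" "j < m" and v: "v \<in> TC SM"
  shows "conn_lift q (act (t j) v) - (if q = j then v else 0) \<in> TI"
proof (rule TI_I)
  show "(conn_lift q (act (t j) v) - (if q = j then v else 0)) e \<mu> \<in> I" for e \<mu>
    using D_t[OF TS_closed[OF v] q, of e \<mu>] by (cases "q = j") (simp_all add: conn_lift_apply act_t_apply)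
  show "conn_lift q (act (t j) v) - (if q = j then v else 0) \<in> TC SM"
    by (intro TS_diff conn_lift_TC act_closed t_PR v) (simp add: v TS_zero)
qed

text \<open>A polynomial in x and z has constant y-coefficients, so linearity of the derivative over
  k is enough.\<close>

lemma conn_lift_xz:
  assumes q: "q < m" and v: "v \<in> TC SM" and p: "p \<in> carrier (poly_ring (xz_vars n l))"
  shows "conn_lift q (act p v) - act p (conn_lift q v) \<in> TI"
proof (rule TI_I)
  have PR: "p \<in> carrier PR" using p by (rule poly_ring_mono) auto
  show "conn_lift q (act p v) - act p (conn_lift q v) \<in> TC SM" by (intro TS_diff conn_lift_TC act_closed v PR)
  fix e \<mu>
  let ?c = "\<lambda>\<kappa>. Poly_Mapping.lookup p \<kappa>"
  have y: "ypart \<kappa> = 0" if "\<kappa> \<in> Poly_Mapping.keys p" for \<kappa>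
  proof (rule ypart_null)
    have "Poly_Mapping.keys \<kappa> \<subseteq> xz_vars n l" using p that by (auto simp: poly_ring_def)
    then show "Poly_Mapping.keys \<kappa> \<inter> range VY = {}" by (auto simp: xz_vars_def)
  qed
  have eq: "mono_act \<kappa> (?c \<kappa>) f \<mu> = (if \<exists>\<nu>. \<mu> = xzpart \<kappa> + \<nu> then const (?c \<kappa>) * f (\<mu> - xzpart \<kappa>) else 0)"
    if "\<kappa> \<in> Poly_Mapping.keys p" for \<kappa> f
    unfolding mono_act_def y[OF that] const_def ..
  have closed: "mono_act \<kappa> (?c \<kappa>) (v e) \<mu> \<in> carrier KY" if "\<kappa> \<in> Poly_Mapping.keys p" for \<kappa>
    unfolding eq[OF that] by (simp add: poly_ring_mult poly_ring_const poly_ring_zero TS_closed[OF v])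
  have "D q (\<Sum>\<kappa>\<in>Poly_Mapping.keys p. mono_act \<kappa> (?c \<kappa>) (v e) \<mu>)
      - (\<Sum>\<kappa>\<in>Poly_Mapping.keys p. D q (mono_act \<kappa> (?c \<kappa>) (v e) \<mu>)) \<in> I" (is "?a - ?b \<in> I")
    by (rule D_sum[OF q closed])
  moreover have "?b - (\<Sum>\<kappa>\<in>Poly_Mapping.keys p. mono_act \<kappa> (?c \<kappa>) (conn_lift q v e) \<mu>) \<in> I" (is "_ - ?d \<in> I")
    unfolding sum_subtractf[symmetric]
  proof (rule sum)
    fix \<kappa> assume \<kappa>: "\<kappa> \<in> Poly_Mapping.keys p"
    show "D q (mono_act \<kappa> (?c \<kappa>) (v e) \<mu>) - mono_act \<kappa> (?c \<kappa>) (conn_lift q v e) \<mu> \<in> I"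
      unfolding eq[OF \<kappa>] using D_const[OF TS_closed[OF v] q] by (simp add: conn_lift_apply zero)
  qed
  ultimately have "?a - ?d \<in> I" using add[of "?a - ?b" "?b - ?d"] by simp
  then show "(conn_lift q (act p v) - act p (conn_lift q v)) e \<mu> \<in> I"
    by (simp add: act_apply conn_lift_apply mact_def sum_fun_apply)
qed

section \<open>Lifts of the Atiyah operators and their independence of representatives\<close>

definition At_lift where "At_lift q v = dT (conn_lift q v) - conn_lift q (dT v)"

lemma At_lift_TC: "v \<in> TC SM \<Longrightarrow> At_lift q v \<in> TC SM"
  unfolding At_lift_def by (intro TS_diff conn_lift_TC dT_closed)

lemma dT_diff: "dT (v - w) = dT v - dT w"
  by (rule additive.diff[OF additive_dT])

lemma TI_congD: "dT v - dT w \<in> TI" if "v - w \<in> TI"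
  using TI_dT[OF that] by (simp only: dT_diff)

lemma At_lift_add:
  assumes q: "q < m" and v: "v \<in> TC SM" "w \<in> TC SM"
  shows "At_lift q (v + w) - (At_lift q v + At_lift q w) \<in> TI"
proof -
  have id: "a - a' - (b - b' + (c - c')) = (a - (b + c)) - (a' - (b' + c'))"
    for a b c a' b' c' :: "'a \<times> 'b \<Rightarrow> mono \<Rightarrow> 'k pol"
    by (rule ext)+ (simp add: algebra_simps)
  have "dT (conn_lift q (v + w)) - (dT (conn_lift q v) + dT (conn_lift q w)) \<in> TI"
    using TI_congD[OF conn_lift_add[OF q v]] by (simp only: dT_add)
  moreover have "conn_lift q (dT (v + w)) - (conn_lift q (dT v) + conn_lift q (dT w)) \<in> TI"
    unfolding dT_add by (intro conn_lift_add q dT_closed v)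
  ultimately show ?thesis unfolding At_lift_def id by (rule TI_diff)
qed

text \<open>Both halves of the commutator produce the same term d v when q = j, and nothing
  otherwise, so the result vanishes modulo I.\<close>

lemma At_lift_t:
  assumes q: "q < m" "j < m" and v: "v \<in> TC SM"
  shows "At_lift q (act (t j) v) \<in> TI"
proof -
  let ?d = "\<lambda>v. if q = j then v else 0"
  have id: "a - b = (a - c) - (b - c)" for a b c :: "'a \<times> 'b \<Rightarrow> mono \<Rightarrow> 'k pol"
    by (rule ext)+ simp
  have "dT (?d v) = ?d (dT v)" by (simp only: if_distrib[of dT] additive.zero[OF additive_dT] cong: if_cong)
  then have "dT (conn_lift q (act (t j) v)) - ?d (dT v) \<in> TI"
    using TI_congD[OF conn_lift_t[OF q v]] by (simp only:)
  moreover have "conn_lift q (dT (act (t j) v)) - ?d (dT v) \<in> TI"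
    unfolding dT_act by (intro conn_lift_t q dT_closed v)
  ultimately show ?thesis
    unfolding At_lift_def by (subst id[of _ _ "?d (dT v)"]) (rule TI_diff)
qed

lemma TI_decompose:
  assumes v: "v \<in> TI"
  obtains u where "\<And>j. u j \<in> TC SM" "v = (\<Sum>j<m. act (t j) (u j))"
proof -
  have "\<exists>G. \<forall>x\<in>I. (\<forall>j. G x j \<in> carrier KY) \<and> x = (\<Sum>j<m. t j * G x j)"
    by (rule bchoice) (use I_subset_span in blast)
  then obtain G where G: "\<forall>x\<in>I. (\<forall>j. G x j \<in> carrier KY) \<and> x = (\<Sum>j<m. t j * G x j)" ..
  \<comment> \<open>The value 0 at 0 keeps the coordinate families finitely supported.\<close>
  define g where "g j x = (if x \<in> I \<and> x \<noteq> 0 then G x j else 0)" for j x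
  show ?thesis
  proof
    show "coeffwise (g j) v \<in> TC SM" for j
      by (rule TC_coeffwise[OF TI_TC[OF v]]) (use G in \<open>auto simp: g_def poly_ring_zero\<close>)
    show "v = (\<Sum>j<m. act (t j) (coeffwise (g j) v))"
    proof (intro ext)
      fix e \<mu>
      have vI: "v e \<mu> \<in> I" using v unfolding TI_def by blast
      have "v e \<mu> = (\<Sum>j<m. t j * g j (v e \<mu>))"
      proof (cases "v e \<mu> = 0")
        case True
        then show ?thesis by (simp add: g_def)
      next
        case False
        with vI have "g j (v e \<mu>) = G (v e \<mu>) j" for j by (simp add: g_def)
        with G vI show ?thesis by simp
      qed
      then show "v e \<mu> = (\<Sum>j<m. act (t j) (coeffwise (g j) v)) e \<mu>"
        by (simp add: sum_fun_apply[of _ _ e] sum_fun_apply[of _ _ \<mu>] act_t_apply coeffwise_def)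
    qed
  qed
qed

lemma At_lift_sum:
  assumes q: "q < m" and f: "\<And>i. i \<in> S \<Longrightarrow> f i \<in> TC SM"
  shows "At_lift q (\<Sum>i\<in>S. f i) - (\<Sum>i\<in>S. At_lift q (f i)) \<in> TI"
proof -
  have id: "a - a' - (b - b') = (a - b) - (a' - b')" for a b a' b' :: "'a \<times> 'b \<Rightarrow> mono \<Rightarrow> 'k pol"
    by (rule ext)+ simp
  have "dT (conn_lift q (\<Sum>i\<in>S. f i)) - (\<Sum>i\<in>S. dT (conn_lift q (f i))) \<in> TI"
    using TI_congD[OF conn_lift_sum[OF q f]] by (simp only: additive.sum[OF additive_dT])
  moreover have "conn_lift q (dT (\<Sum>i\<in>S. f i)) - (\<Sum>i\<in>S. conn_lift q (dT (f i))) \<in> TI"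
    unfolding additive.sum[OF additive_dT] by (intro conn_lift_sum q dT_closed f)
  ultimately show ?thesis unfolding At_lift_def sum_subtractf by (subst id) (rule TI_diff)
qed

text \<open>An element vanishing modulo I is a sum of multiples of the \<open>t\<^sub>j\<close>, on
  which \<open>At_lift_t\<close> applies. Hence the commutator descends to
  \<open>Y | X\<close>.\<close>

lemma At_lift_TI:
  assumes q: "q < m" and v: "v \<in> TI"
  shows "At_lift q v \<in> TI"
proof -
  obtain u where u: "\<And>j. u j \<in> TC SM" "v = (\<Sum>j<m. act (t j) (u j))" by (rule TI_decompose[OF v]) (rule that)
  have "At_lift q v - (\<Sum>j<m. At_lift q (act (t j) (u j))) \<in> TI"
    unfolding u(2) by (intro At_lift_sum q act_closed u t_PR)
  moreover have "(\<Sum>j<m. At_lift q (act (t j) (u j))) \<in> TI"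
    by (intro TI_sum At_lift_t q u) simp
  ultimately have "At_lift q v - (\<Sum>j<m. At_lift q (act (t j) (u j))) + (\<Sum>j<m. At_lift q (act (t j) (u j))) \<in> TI"
    by (rule TI_add)
  then show ?thesis by (simp only: diff_add_cancel)
qed

lemma At_lift_cong:
  assumes q: "q < m" and v: "v \<in> TC SM" "w \<in> TC SM" "v - w \<in> TI"
  shows "At_lift q v - At_lift q w \<in> TI"
proof -
  have id: "(a - (b + c)) + b = a - c" for a b c :: "'a \<times> 'b \<Rightarrow> mono \<Rightarrow> 'k pol"
    by (rule ext)+ simp
  have "At_lift q (v - w + w) - (At_lift q (v - w) + At_lift q w) \<in> TI"
    by (intro At_lift_add q TS_diff v)
  from TI_add[OF this At_lift_TI[OF q v(3)]] show ?thesis by (simp only: id diff_add_cancel)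
qed

section \<open>Passing to the quotient and to the completion\<close>

abbreviation QM where "QM k \<equiv> quot_module R (pow k)"

lemma module_QM: "module R (QM k)"
  by (rule P.module_quot)

lemma hom_cls: "coeff_hom R SM (QM k) (P.cls k)"
  unfolding coeff_hom_def using module_SM module_QM
  by (simp add: P.cls_closed P.cls_add P.quot_module_smult)

lemma hom_Q: "coeff_hom R SM J cls"
  unfolding coeff_hom_def using module_SM module_J by (simp add: cls_closed cls_add J_smult)

lemma hom_\<epsilon>: "coeff_hom R SM K \<epsilon>"
  unfolding coeff_hom_def using module_SM module_K by (simp add: \<epsilon>_closed \<epsilon>_add \<epsilon>_smult)

lemma hom_comp: "coeff_hom R K (QM k) (\<lambda>h. h k)"
  unfolding coeff_hom_def
proof (intro conjI ballI)
  fix r h assume r: "r \<in> carrier R" and h: "h \<in> carrier K"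
  obtain x where x: "x \<in> carrier R" "x \<in> h k" "\<And>j. j \<le> k \<Longrightarrow> h j = P.cls j x"
    by (rule K_rep[OF h, where n = k]) (rule that)
  show "(r \<odot>\<^bsub>K\<^esub> h) k = r \<odot>\<^bsub>QM k\<^esub> h k"
    using r x by (simp add: K_simps P.quot_module_smult P.cls_mult)
qed (simp_all add: module_K module_QM K_comp, simp_all add: K_simps)

lemma hom_from_completion: "coeff_hom R K J from_completion"
proof -
  have "QM (Suc 0) = J" by (simp only: pow_1 J_eq)
  with hom_comp[of "Suc 0"] show ?thesis by (simp add: from_completion_def[abs_def])
qed

definition cut :: "('a \<times> 'b \<Rightarrow> mono \<Rightarrow> 'k pol) \<Rightarrow> 'a \<times> 'b \<Rightarrow> mono \<Rightarrow> 'k pol set" where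
  "cut v = coeffwise (\<lambda>x. cls x) v"

lemma cut_apply: "cut v e \<mu> = cls (v e \<mu>)"
  by (simp add: cut_def coeffwise_def)

lemma cut_TC: "v \<in> TC SM \<Longrightarrow> cut v \<in> TC J"
  unfolding cut_def by (rule coeffwise_closed[OF hom_Q])

lemma cut_eq:
  assumes v: "v \<in> TC SM" "w \<in> TC SM"
  shows "cut v = cut w \<longleftrightarrow> v - w \<in> TI"
proof
  assume eq: "cut v = cut w"
  show "v - w \<in> TI"
  proof (rule TI_I)
    fix e \<mu>
    have "cls (v e \<mu>) = cls (w e \<mu>)" using fun_cong[OF fun_cong[OF eq, of e], of \<mu>] by (simp only: cut_apply)
    then show "(v - w) e \<mu> \<in> I" using cls_eq[OF TS_closed[OF v(1)] TS_closed[OF v(2)]] by simp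
  qed (intro TS_diff v)
next
  assume TI: "v - w \<in> TI"
  show "cut v = cut w"
  proof (intro ext)
    fix e \<mu>
    have "(v - w) e \<mu> \<in> I" using TI unfolding TI_def by blast
    then show "cut v e \<mu> = cut w e \<mu>" using cls_eq[OF TS_closed[OF v(1)] TS_closed[OF v(2)]] by (simp add: cut_apply)
  qed
qed

lemma cut_add: "v \<in> TC SM \<Longrightarrow> w \<in> TC SM \<Longrightarrow> cut (v + w) = cut v \<oplus>\<^bsub>T J\<^esub> cut w"
  by (intro ext) (simp add: cut_apply cls_add TS_closed)

lemma cut_zero: "cut 0 = \<zero>\<^bsub>T J\<^esub>"
  by (intro ext) (simp add: cut_apply cls_zero)

lemma cut_act: "v \<in> TC SM \<Longrightarrow> p \<in> carrier PR \<Longrightarrow> cut (act p v) = p \<odot>\<^bsub>T J\<^esub> cut v"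
  using coeffwise_smult[OF hom_Q, of v p] by (simp only: smult_self cut_def)

lemma cut_dT: "v \<in> TC SM \<Longrightarrow> cut (dT v) = dif (T J) (cut v)"
  using coeffwise_dif[OF hom_Q, of v] by (simp only: dif_self cut_def)

lemma cut_lm: "v \<in> TC SM \<Longrightarrow> cut (lm i v) = lam J Y X i (cut v)"
  using coeffwise_lam[OF hom_Q, of v i] by (simp only: lam_self cut_def lm_def)

lemma cut_minus:
  assumes v: "v \<in> TC SM" "w \<in> TC SM"
  shows "cut (v - w) = cut v \<ominus>\<^bsub>T J\<^esub> cut w"
proof -
  interpret TJ: abelian_group "T J" by (rule abelian_group_T[OF module_J])
  have c: "cut v \<in> carrier (T J)" "cut w \<in> carrier (T J)" "cut (v - w) \<in> carrier (T J)"
    using v by (simp_all add: cut_TC TS_diff)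
  have "cut (v - w) \<oplus>\<^bsub>T J\<^esub> cut w = cut v"
    using cut_add[OF TS_diff[OF v] v(2)] by (simp only: diff_add_cancel)
  then have "cut v \<ominus>\<^bsub>T J\<^esub> cut w = cut (v - w) \<oplus>\<^bsub>T J\<^esub> (cut w \<ominus>\<^bsub>T J\<^esub> cut w)"
    using c by (simp only: a_minus_def TJ.a_assoc TJ.a_inv_closed flip: \<open>cut (v - w) \<oplus>\<^bsub>T J\<^esub> cut w = cut v\<close>)
  also have "\<dots> = cut (v - w)" using c by (simp only: a_minus_def TJ.r_neg TJ.r_zero)
  finally show ?thesis by (rule sym)
qed

lemma cut_uminus:
  assumes v: "v \<in> TC SM"
  shows "cut (- v) = \<ominus>\<^bsub>T J\<^esub> cut v"
proof -
  interpret TJ: abelian_group "T J" by (rule abelian_group_T[OF module_J])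
  have "cut v \<in> carrier (T J)" using cut_TC[OF v] by simp
  then show ?thesis
    using cut_minus[OF TS_zero v] TJ.l_zero[OF TJ.a_inv_closed] unfolding cut_zero a_minus_def by (simp only: diff_0)
qed

lemma cut_sum:
  assumes f: "\<And>i. i \<in> S \<Longrightarrow> f i \<in> TC SM" and S: "finite S"
  shows "cut (\<Sum>i\<in>S. f i) = (\<Oplus>\<^bsub>T J\<^esub>i\<in>S. cut (f i))"
  using S f
proof (induction S)
  interpret TJ: abelian_group "T J" by (rule abelian_group_T[OF module_J])
  {
    case empty
    show ?case unfolding TJ.finsum_empty sum.empty by (rule cut_zero)
  next
    case (insert i S)
    have "cut (\<Sum>i\<in>insert i S. f i) = cut (f i) \<oplus>\<^bsub>T J\<^esub> cut (\<Sum>i\<in>S. f i)"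
      using insert by (simp only: sum.insert not_False_eq_True) (intro cut_add TS_sum; simp)
    also have "cut (\<Sum>i\<in>S. f i) = (\<Oplus>\<^bsub>T J\<^esub>i\<in>S. cut (f i))" using insert by simp
    also have "cut (f i) \<oplus>\<^bsub>T J\<^esub> (\<Oplus>\<^bsub>T J\<^esub>i\<in>S. cut (f i)) = (\<Oplus>\<^bsub>T J\<^esub>i\<in>insert i S. cut (f i))"
      using insert by (intro TJ.finsum_insert[symmetric]) (auto simp: cut_TC)
    finally show ?case .
  }
qed

lemma T_hpart: "hpart (T M) s = {v \<in> TC M. \<forall>a b \<mu>. v (a, b) \<mu> \<noteq> \<zero>\<^bsub>M\<^esub> \<longrightarrow> (bodd Y a \<noteq> bodd X b) = s}"
  by (simp add: tensor_def)

lemma cut_hp: "v \<in> hp s \<Longrightarrow> cut v \<in> hpart (T J) s"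
proof -
  assume v: "v \<in> hp s"
  have "(bodd Y a \<noteq> bodd X b) = s" if "cut v (a, b) \<mu> \<noteq> \<zero>\<^bsub>J\<^esub>" for a b \<mu>
  proof -
    have "v (a, b) \<noteq> 0" using that by (auto simp: cut_apply cls_zero)
    with v show ?thesis unfolding hp_def by blast
  qed
  then have "\<forall>a b \<mu>. cut v (a, b) \<mu> \<noteq> \<zero>\<^bsub>J\<^esub> \<longrightarrow> (bodd Y a \<noteq> bodd X b) = s" by blast
  with cut_TC[OF hp_TC[OF v]] show ?thesis by (simp only: T_hpart mem_Collect_eq simp_thms)
qed

subsection \<open>The Atiyah classes\<close>

lemma conn_TC: "v \<in> TC K \<Longrightarrow> coeffwise (conn m V \<sigma> q) v \<in> TC K"
  by (rule TC_coeffwise[where M = K]) (simp_all add: conn_closed conn_zero)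

text \<open>As the derivative lowers the adic order by one, the class of \<open>vh\<close> modulo the square of the ideal determines
  the result.\<close>

lemma atiyah_lift:
  assumes q: "q < m" and vh: "vh \<in> TC K" and v: "v \<in> TC SM" and rep: "\<And>e \<mu>. vh e \<mu> 2 = P.cls 2 (v e \<mu>)"
  shows "coeffwise from_completion (dcomm (T K) (T K) False (coeffwise (conn m V \<sigma> q)) vh) = cut (At_lift q v)"
proof -
  have dvh: "dif (T K) vh \<in> TC K" by (rule dif_closed[OF module_K vh])
  have repd: "dif (T K) vh e \<mu> 2 = P.cls 2 (dT v e \<mu>)" for e \<mu>
  proof -
    \<comment> \<open>Projection to level 2 is linear over k[y], so the differential commutes with
      it and v yields a level 2 representative of the differential of \<open>vh\<close>.\<close>
    have "coeffwise (\<lambda>h. h 2) vh = coeffwise (P.cls 2) v"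
      by (intro ext) (simp add: coeffwise_def rep)
    then have "coeffwise (\<lambda>h. h 2) (dif (T K) vh) = coeffwise (P.cls 2) (dif (T SM) v)"
      by (simp only: coeffwise_dif[OF hom_comp vh] coeffwise_dif[OF hom_cls v])
    from fun_cong[OF fun_cong[OF this, of e], of \<mu>] show ?thesis
      by (simp only: dif_self[OF v] coeffwise_def)
  qed
  have 1: "coeffwise from_completion (coeffwise (conn m V \<sigma> q) vh) = cut (conn_lift q v)"
    by (intro ext) (simp add: coeffwise_def cut_apply conn_lift_apply
        from_completion_conn_rep[OF TC_closed[OF vh] TS_closed[OF v] rep q])
  have 2: "coeffwise from_completion (coeffwise (conn m V \<sigma> q) (dif (T K) vh)) = cut (conn_lift q (dT v))"
    by (intro ext) (simp only: coeffwise_def cut_apply conn_lift_apply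
        from_completion_conn_rep[OF TC_closed[OF dvh] TS_closed[OF dT_closed[OF v]] repd q])
  have c: "coeffwise (conn m V \<sigma> q) vh \<in> TC K" "coeffwise (conn m V \<sigma> q) (dif (T K) vh) \<in> TC K"
    by (rule conn_TC; fact)+
  let ?a = "dif (T K) (coeffwise (conn m V \<sigma> q) vh)" and ?b = "coeffwise (conn m V \<sigma> q) (dif (T K) vh)"
  have ac: "?a \<in> TC K" by (rule dif_closed[OF module_K c(1)])
  have "coeffwise from_completion (?a \<ominus>\<^bsub>T K\<^esub> ?b) = coeffwise from_completion ?a \<ominus>\<^bsub>T J\<^esub> coeffwise from_completion ?b"
  proof (rule additive_minus[where \<phi> = "coeffwise from_completion", OF abelian_group_T[OF module_K] abelian_group_T[OF module_J]])
    show "coeffwise from_completion x \<in> carrier (T J)" if "x \<in> carrier (T K)" for x :: "'a \<times> 'b \<Rightarrow> mono \<Rightarrow> nat \<Rightarrow> 'k pol set"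
      using coeffwise_closed[OF hom_from_completion, of x] that by simp
    show "coeffwise from_completion (x \<oplus>\<^bsub>T K\<^esub> y) = coeffwise from_completion x \<oplus>\<^bsub>T J\<^esub> coeffwise from_completion y"
      if "x \<in> carrier (T K)" "y \<in> carrier (T K)" for x y :: "'a \<times> 'b \<Rightarrow> mono \<Rightarrow> nat \<Rightarrow> 'k pol set"
      using coeffwise_add[OF hom_from_completion, of x y] that by simp
  qed (use ac c in simp_all)
  also have "coeffwise from_completion ?a = cut (dT (conn_lift q v))"
    by (simp only: coeffwise_dif[OF hom_from_completion c(1)] 1 cut_dT[OF conn_lift_TC[OF v]])
  also have "cut (dT (conn_lift q v)) \<ominus>\<^bsub>T J\<^esub> coeffwise from_completion ?b = cut (At_lift q v)"
    unfolding 2 At_lift_def by (rule cut_minus[symmetric]) (intro dT_closed conn_lift_TC v)+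
  finally show ?thesis by (simp only: dcomm_def if_False)
qed

lemma lift_2:
  assumes vh: "vh \<in> TC K"
  obtains v where "v \<in> TC SM" "\<And>e \<mu>. vh e \<mu> 2 = P.cls 2 (v e \<mu>)" "coeffwise from_completion vh = cut v"
proof -
  have ex: "\<exists>x. x \<in> carrier R \<and> h 2 = P.cls 2 x \<and> h (Suc 0) = cls x" if h: "h \<in> carrier K" for h
  proof -
    obtain x where x: "x \<in> carrier R" "x \<in> h 2" "\<And>j. j \<le> 2 \<Longrightarrow> h j = P.cls j x"
      by (rule K_rep[OF h, where n = 2]) (rule that)
    with x(3)[of "Suc 0"] x(3)[of 2] show ?thesis by (intro exI[of _ x]) (simp add: pow_1)
  qed
  \<comment> \<open>Representatives modulo the square of the ideal, with 0 chosen at zero to keep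
    the support finite.\<close>
  define s where "s h = (if h = \<zero>\<^bsub>K\<^esub> then 0 else SOME x. x \<in> carrier R \<and> h 2 = P.cls 2 x \<and> h (Suc 0) = cls x)"
    for h :: "nat \<Rightarrow> 'k pol set"
  have s: "s h \<in> carrier R \<and> h 2 = P.cls 2 (s h) \<and> h (Suc 0) = cls (s h)" if h: "h \<in> carrier K" for h
  proof (cases "h = \<zero>\<^bsub>K\<^esub>")
    case True
    then have "s h = 0" by (simp add: s_def)
    moreover have "h 2 = P.cls 2 0" "h (Suc 0) = cls 0"
      unfolding True K_simps P.cls_zero by (simp_all add: pow_1)
    ultimately show ?thesis by (simp add: poly_ring_zero)
  next
    case False
    then show ?thesis using someI_ex[OF ex[OF h]] unfolding s_def if_not_P[OF False] by blast
  qed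
  show ?thesis
  proof
    show "coeffwise s vh \<in> TC SM"
      by (rule TC_coeffwise[OF vh, where N = SM]) (use s in \<open>simp_all add: s_def\<close>)
    show "vh e \<mu> 2 = P.cls 2 (coeffwise s vh e \<mu>)" for e \<mu>
      using s[OF TC_closed[OF vh]] by (simp add: coeffwise_def)
    show "coeffwise from_completion vh = cut (coeffwise s vh)"
      using s[OF TC_closed[OF vh]] by (intro ext) (simp add: coeffwise_def cut_apply from_completion_def)
  qed
qed

text \<open>The definite description is justified here: the image of v in the completion gives a
  value, and any other preimage has a polynomial representative that differs from v by an element of
  \<open>TI\<close>, where \<open>At_lift_cong\<close> applies.\<close>

lemma atiyah_cut:
  assumes q: "q < m" and v: "v \<in> TC SM"
  shows "atiyah n m l V Y X \<sigma> q (cut v) = cut (At_lift q v)"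
  unfolding atiyah_def Let_def
proof (rule the_equality)
  let ?vh = "coeffwise \<epsilon> v"
  have vh: "?vh \<in> TC K" by (rule coeffwise_closed[OF hom_\<epsilon> v])
  have "coeffwise from_completion ?vh = cut v"
    by (intro ext) (simp add: coeffwise_def cut_apply from_completion_def \<epsilon>_comp pow_1)
  moreover have "?vh e \<mu> 2 = P.cls 2 (v e \<mu>)" for e \<mu>
    by (simp add: coeffwise_def \<epsilon>_comp)
  from atiyah_lift[OF q vh v this]
  have "cut (At_lift q v) = coeffwise from_completion (dcomm (T K) (T K) False (coeffwise (conn m V \<sigma> q)) ?vh)"
    by (rule sym)
  ultimately show "\<exists>va\<in>carrier (T K). coeffwise from_completion va = cut v \<and>
      cut (At_lift q v) = coeffwise from_completion (dcomm (T K) (T K) False (coeffwise (conn m V \<sigma> q)) va)"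
    using vh by (intro bexI[of _ ?vh] conjI) (simp_all only: T_simps)
next
  fix r assume "\<exists>va\<in>carrier (T K). coeffwise from_completion va = cut v \<and>
      r = coeffwise from_completion (dcomm (T K) (T K) False (coeffwise (conn m V \<sigma> q)) va)"
  then obtain va where va: "va \<in> carrier (T K)" "coeffwise from_completion va = cut v"
    "r = coeffwise from_completion (dcomm (T K) (T K) False (coeffwise (conn m V \<sigma> q)) va)" by blast
  have vaK: "va \<in> TC K" using va(1) by (simp only: T_simps)
  obtain w where w: "w \<in> TC SM" "\<And>e \<mu>. va e \<mu> 2 = P.cls 2 (w e \<mu>)" "coeffwise from_completion va = cut w"
    by (rule lift_2[OF vaK]) (rule that)
  have "r = cut (At_lift q w)" unfolding va(3) by (rule atiyah_lift[OF q vaK w(1,2)])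
  also have "\<dots> = cut (At_lift q v)"
  proof -
    have "w - v \<in> TI" using w va(2) v by (simp only: cut_eq[symmetric])
    from At_lift_cong[OF q w(1) v this] show ?thesis by (simp only: cut_eq[OF At_lift_TC[OF w(1)] At_lift_TC[OF v]])
  qed
  finally show "r = cut (At_lift q v)" .
qed

section \<open>The map \<open>\<Phi>\<close> on polynomial elements\<close>

abbreviation EXT :: "('k pol, 'e) module \<Rightarrow> ('k pol, nat set \<Rightarrow> 'a \<times> 'b \<Rightarrow> mono \<Rightarrow> 'e) gmodule" where
  "EXT M \<equiv> ext_tensor m (T M)"

lemma abelian_group_ext:
  assumes M: "module R M"
  shows "abelian_group (EXT M)"
proof -
  interpret TM: abelian_group "T M" by (rule abelian_group_T[OF M])
  have closed: "w A \<in> carrier (T M)" if "w \<in> carrier (EXT M)" for w A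
    using that by (simp add: ext_tensor_def ext_carrier_def)
  show ?thesis
  proof (rule abelian_group_by_evaluation[where ev = "\<lambda>A w. w A" and M = "\<lambda>_. T M"])
    show "\<exists>v\<in>carrier (EXT M). \<forall>A. v A = \<ominus>\<^bsub>T M\<^esub> w A" if w: "w \<in> carrier (EXT M)" for w
    proof (rule bexI[of _ "\<lambda>A. \<ominus>\<^bsub>T M\<^esub> w A"], rule allI, rule refl)
      have "w A \<in> carrier (T M)" "\<not> A \<subseteq> {..<m} \<Longrightarrow> w A = \<zero>\<^bsub>T M\<^esub>" for A
        using w by (simp_all add: ext_tensor_def ext_carrier_def)
      moreover have "\<ominus>\<^bsub>T M\<^esub> \<zero>\<^bsub>T M\<^esub> = \<zero>\<^bsub>T M\<^esub>"
        by (rule TM.minus_equality[OF TM.l_zero]) (rule TM.zero_closed)+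
      ultimately show "(\<lambda>A. \<ominus>\<^bsub>T M\<^esub> w A) \<in> carrier (EXT M)"
        unfolding ext_tensor_def ext_carrier_def partial_object.select_convs mem_Collect_eq
        by (intro conjI allI impI) (simp_all only: TM.a_inv_closed simp_thms)
    qed
    show "v \<oplus>\<^bsub>EXT M\<^esub> w \<in> carrier (EXT M)" if "v \<in> carrier (EXT M)" "w \<in> carrier (EXT M)" for v w
    proof -
      have *: "w A \<in> carrier (T M)" "\<not> A \<subseteq> {..<m} \<Longrightarrow> w A = \<zero>\<^bsub>T M\<^esub>" if "w \<in> carrier (EXT M)" for w A
        using that by (simp_all add: ext_tensor_def ext_carrier_def)
      show ?thesis
        using *[OF that(1)] *[OF that(2)]
        unfolding ext_tensor_def ext_carrier_def partial_object.select_convs ring.select_convs mem_Collect_eq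
        by (intro conjI allI impI) (simp_all only: TM.a_closed TM.l_zero TM.zero_closed simp_thms)
    qed
    show "\<zero>\<^bsub>EXT M\<^esub> \<in> carrier (EXT M)"
      unfolding ext_tensor_def ext_carrier_def partial_object.select_convs ring.select_convs mem_Collect_eq
      by (simp only: TM.zero_closed simp_thms)
    show "v = w" if "\<And>A. v A = w A" for v w :: "nat set \<Rightarrow> 'a \<times> 'b \<Rightarrow> mono \<Rightarrow> 'e"
      using that by (rule ext)
  qed (simp only: closed TM.abelian_group_axioms | simp only: ext_tensor_def ring.select_convs)+
qed

lemma act_sgn: "act (sgn_pol s) v = sg s v"
  by (rule ext) (simp add: act_def mact_sgn_pol sg_def)

lemma sgn_PR: "sgn_pol s \<in> carrier PR"
  by (rule poly_ring_sgn_pol)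

section \<open>The canonical map to the completion commutes with the exterior operators\<close>

definition eps :: "('a \<times> 'b \<Rightarrow> mono \<Rightarrow> 'k pol) \<Rightarrow> 'a \<times> 'b \<Rightarrow> mono \<Rightarrow> nat \<Rightarrow> 'k pol set" where
  "eps v = coeffwise (\<lambda>x. \<epsilon> x) v"

lemma eps_TC: "v \<in> TC SM \<Longrightarrow> eps v \<in> TC K"
  unfolding eps_def by (rule coeffwise_closed[OF hom_\<epsilon>])

lemma eps_zero: "eps 0 = \<zero>\<^bsub>T K\<^esub>"
  by (intro ext) (simp add: eps_def coeffwise_def \<epsilon>_zero)

lemma eps_add: "v \<in> TC SM \<Longrightarrow> w \<in> TC SM \<Longrightarrow> eps (v + w) = eps v \<oplus>\<^bsub>T K\<^esub> eps w"
  by (intro ext) (simp add: eps_def coeffwise_def \<epsilon>_add TS_closed)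

lemma eps_act: "v \<in> TC SM \<Longrightarrow> p \<in> carrier PR \<Longrightarrow> eps (act p v) = p \<odot>\<^bsub>T K\<^esub> eps v"
  using coeffwise_smult[OF hom_\<epsilon>, of v p] by (simp only: smult_self eps_def)

lemma eps_sg: "v \<in> TC SM \<Longrightarrow> eps (sg s v) = sgn_pol s \<odot>\<^bsub>T K\<^esub> eps v"
  unfolding act_sgn[symmetric] by (rule eps_act[OF _ sgn_PR])

lemma eps_lm: "v \<in> TC SM \<Longrightarrow> eps (lm i v) = lam K Y X i (eps v)"
  using coeffwise_lam[OF hom_\<epsilon>, of v i] by (simp only: lam_self eps_def lm_def)

lemma epsilon_apply: "epsilon m V w A = eps (w A)"
  by (simp add: epsilon_def eps_def)

lemma epsilon_closed: "w \<in> ES \<Longrightarrow> epsilon m V w \<in> carrier (EXT K)"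
  using ES_TC[of w] ES_fsupp[of w] eps_zero
  by (simp add: ext_tensor_def ext_carrier_def epsilon_apply eps_TC fsupp_def)

lemma epsilon_add: "v \<in> ES \<Longrightarrow> w \<in> ES \<Longrightarrow> epsilon m V (v + w) = epsilon m V v \<oplus>\<^bsub>EXT K\<^esub> epsilon m V w"
  by (rule ext) (simp only: ext_tensor_def ring.select_convs epsilon_apply plus_fun_apply[of v w] eps_add ES_TC)

lemma epsilon_zero: "epsilon m V 0 = \<zero>\<^bsub>EXT K\<^esub>"
  by (rule ext) (simp only: ext_tensor_def ring.select_convs epsilon_apply zero_fun_apply eps_zero)

lemma epsilon_scl: "w \<in> ES \<Longrightarrow> p \<in> carrier PR \<Longrightarrow> epsilon m V (scl p w) = p \<odot>\<^bsub>EXT K\<^esub> epsilon m V w"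
  by (rule ext) (simp only: ext_tensor_def module.select_convs epsilon_apply scl_def eps_act ES_TC)

lemma epsilon_sum:
  assumes f: "\<And>i. i \<in> S \<Longrightarrow> f i \<in> ES" and S: "finite S"
  shows "epsilon m V (\<Sum>i\<in>S. f i) = (\<Oplus>\<^bsub>EXT K\<^esub>i\<in>S. epsilon m V (f i))"
  using S f
proof (induction S)
  interpret E: abelian_group "EXT K" by (rule abelian_group_ext[OF module_K])
  {
    case empty
    show ?case unfolding E.finsum_empty sum.empty by (rule epsilon_zero)
  next
    case (insert i S)
    have "epsilon m V (\<Sum>i\<in>insert i S. f i) = epsilon m V (f i) \<oplus>\<^bsub>EXT K\<^esub> epsilon m V (\<Sum>i\<in>S. f i)"
      using insert by (simp only: sum.insert not_False_eq_True) (intro epsilon_add ES_sum; simp)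
    also have "epsilon m V (\<Sum>i\<in>S. f i) = (\<Oplus>\<^bsub>EXT K\<^esub>i\<in>S. epsilon m V (f i))" using insert by simp
    also have "epsilon m V (f i) \<oplus>\<^bsub>EXT K\<^esub> (\<Oplus>\<^bsub>EXT K\<^esub>i\<in>S. epsilon m V (f i)) = (\<Oplus>\<^bsub>EXT K\<^esub>i\<in>insert i S. epsilon m V (f i))"
      using insert by (intro E.finsum_insert[symmetric]) (auto intro: epsilon_closed)
    finally show ?case .
  }
qed

lemma epsilon_con: "w \<in> ES \<Longrightarrow> contract (T K) i (epsilon m V w) = epsilon m V (con i w)"
  by (rule ext) (simp only: contract_def con_def epsilon_apply below_def[symmetric] eps_sg[OF ES_TC] eps_zero[symmetric]
      if_distrib[of eps])

lemma epsilon_lm: "w \<in> ES \<Longrightarrow> ext_odd (T K) (lam K Y X i) (epsilon m V w) = epsilon m V (eodd (lm i) w)"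
  by (rule ext) (simp only: ext_odd_def eodd_def epsilon_apply eps_lm[OF ES_TC, symmetric] eps_sg[OF lm_closed[OF ES_TC]])

lemma epsilon_delta_op: "w \<in> ES \<Longrightarrow> delta n m l V Y X (epsilon m V w) = epsilon m V (delta_op w)"
  unfolding delta_def Let_def delta_op_def
  by (simp only: epsilon_con epsilon_lm ES_con) (rule epsilon_sum[symmetric], simp_all add: ES_lm ES_con)

text \<open>The canonical map commutes with \<delta> and with constants, so the exponential may be
  formed on polynomials before completing.\<close>

lemma epsilon_exp_delta: "w \<in> ES \<Longrightarrow> exp_minus_delta \<iota> n m l V Y X (epsilon m V w) = epsilon m V (exp_delta w)"
proof -
  assume w: "w \<in> ES"
  have *: "(delta n m l V Y X ^^ j) (epsilon m V w) = epsilon m V ((delta_op ^^ j) w)" for j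
    by (induction j) (simp_all add: epsilon_delta_op pow_ES w)
  have "exp_minus_delta \<iota> n m l V Y X (epsilon m V w)
      = (\<Oplus>\<^bsub>EXT K\<^esub>j\<in>{..m}. epsilon m V (scl (const (exp_coeff j)) ((delta_op ^^ j) w)))"
    unfolding exp_minus_delta_def Let_def * exp_coeff_def by (simp only: epsilon_scl pow_ES w const_PR)
  also have "\<dots> = epsilon m V (exp_delta w)"
    unfolding exp_delta_def by (rule epsilon_sum[symmetric]) (simp_all add: ES_scl pow_ES w const_PR)
  finally show ?thesis .
qed

lemma Phi_cut: "w \<in> ES \<Longrightarrow> Phi \<iota> n m l V Y X w = cut (\<phi> w)"
proof -
  assume "w \<in> ES"
  then have "Phi \<iota> n m l V Y X w = coeffwise from_completion (eps (exp_delta w {}))"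
    by (simp only: Phi_def o_apply epsilon_exp_delta proj_def epsilon_apply)
  also have "\<dots> = cut (\<phi> w)"
    by (intro ext) (simp add: \<phi>_def eps_def coeffwise_def cut_apply from_completion_def \<epsilon>_comp pow_1)
  finally show ?thesis .
qed

section \<open>The complex \<open>S\<^sub>m \<otimes> (Y \<otimes> X)\<close>\<close>

lemma wedge_wed: "w \<in> ES \<Longrightarrow> wedge (T SM) i w = wed i w"
  by (rule ext) (simp only: wedge_def wed_def below_def[symmetric] smult_self[OF ES_TC sgn_PR] act_sgn T_simps(2)
      self_module_simps poly_ring_simps zero_fun_def)

lemma contract_con: "w \<in> ES \<Longrightarrow> contract (T SM) i w = con i w"
  by (rule ext) (simp only: contract_def con_def below_def[symmetric] smult_self[OF ES_TC sgn_PR] act_sgn T_simps(2)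
      self_module_simps poly_ring_simps zero_fun_def)

lemma ES_carrier: "carrier (EXT SM) = ES"
  by (auto simp: ext_tensor_def ext_carrier_def ES_def fsupp_def zero_fun_def)

lemma ES_plus: "v \<oplus>\<^bsub>EXT SM\<^esub> w = v + w"
  by (intro ext) (simp add: ext_tensor_def)

lemma ES_smult: "w \<in> ES \<Longrightarrow> p \<in> carrier PR \<Longrightarrow> p \<odot>\<^bsub>EXT SM\<^esub> w = scl p w"
  by (rule ext) (simp only: ext_tensor_def module.select_convs scl_def smult_self[OF ES_TC])

lemma ES_dif: "w \<in> ES \<Longrightarrow> dif (EXT SM) w = eodd dT w"
  by (rule ext) (simp only: ext_tensor_def gmodule.select_convs ext_odd_def eodd_def dif_self[OF ES_TC]
      smult_self[OF dT_closed[OF ES_TC] sgn_PR] act_sgn)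

lemma hp_SM: "hpart (T SM) s = hp s"
  by (auto simp: T_hpart hp_def fun_eq_iff)

lemma ES_hpart: "hpart (EXT SM) s = hpE s"
  unfolding hpE_def hp_SM[symmetric] ES_carrier[symmetric] by (simp add: ext_tensor_def)

section \<open>Homotopies from lifts\<close>

abbreviation XZ where "XZ \<equiv> (poly_ring (xz_vars n l) :: 'k pol ring)"

lemma XZ_PR: "p \<in> carrier XZ \<Longrightarrow> p \<in> carrier PR"
  by (erule poly_ring_mono) auto

text \<open>The data needed for a lift F to induce a k[x,z]-linear map to \<open>Y | X\<close> of
  parity s. Additivity and linearity are asked for modulo \<open>TI\<close> only, which is all that
  the coefficientwise derivative provides.\<close>

definition lift_linear :: "bool \<Rightarrow> ((nat set \<Rightarrow> 'a \<times> 'b \<Rightarrow> mono \<Rightarrow> 'k pol) \<Rightarrow> 'a \<times> 'b \<Rightarrow> mono \<Rightarrow> 'k pol) \<Rightarrow> bool" where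
  "lift_linear s F \<longleftrightarrow> (\<forall>w\<in>ES. F w \<in> TC SM) \<and> (\<forall>v\<in>ES. \<forall>w\<in>ES. F (v + w) - (F v + F w) \<in> TI) \<and>
     (\<forall>p\<in>carrier XZ. \<forall>w\<in>ES. F (scl p w) - act p (F w) \<in> TI) \<and> (\<forall>r. \<forall>w\<in>hpE r. F w \<in> hp (r \<noteq> s))"

lemma lift_linearD:
  assumes "lift_linear s F"
  shows "\<And>w. w \<in> ES \<Longrightarrow> F w \<in> TC SM" "\<And>v w. v \<in> ES \<Longrightarrow> w \<in> ES \<Longrightarrow> F (v + w) - (F v + F w) \<in> TI"
    "\<And>p w. p \<in> carrier XZ \<Longrightarrow> w \<in> ES \<Longrightarrow> F (scl p w) - act p (F w) \<in> TI" "\<And>r w. w \<in> hpE r \<Longrightarrow> F w \<in> hp (r \<noteq> s)"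
  using assms unfolding lift_linear_def by blast+

lemma graded_linear_lift:
  assumes F: "lift_linear s F" and f: "\<And>w. w \<in> ES \<Longrightarrow> f w = cut (F w)"
  shows "graded_linear XZ (EXT SM) (T J) s f"
  unfolding graded_linear_def ES_carrier
proof (intro conjI ballI allI funcsetI)
  note F = lift_linearD[OF F]
  show "f w \<in> carrier (T J)" if "w \<in> ES" for w
    using cut_TC[OF F(1)[OF that]] by (simp only: f[OF that] T_simps)
  show "f (v \<oplus>\<^bsub>EXT SM\<^esub> w) = f v \<oplus>\<^bsub>T J\<^esub> f w" if "v \<in> ES" "w \<in> ES" for v w
    unfolding ES_plus f[OF that(1)] f[OF that(2)] f[OF ES_add[OF that]] cut_add[OF F(1)[OF that(1)] F(1)[OF that(2)], symmetric]
    using F(2)[OF that] by (subst cut_eq) (intro TS_add F(1) ES_add that)+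
  show "f (p \<odot>\<^bsub>EXT SM\<^esub> w) = p \<odot>\<^bsub>T J\<^esub> f w" if "p \<in> carrier XZ" "w \<in> ES" for p w
    unfolding ES_smult[OF that(2) XZ_PR[OF that(1)]] f[OF that(2)] f[OF ES_scl[OF that(2) XZ_PR[OF that(1)]]]
      cut_act[OF F(1)[OF that(2)] XZ_PR[OF that(1)], symmetric]
    using F(3)[OF that] by (subst cut_eq) (intro act_closed F(1) ES_scl XZ_PR that)+
  show "f w \<in> hpart (T J) (r \<noteq> s)" if "w \<in> hpart (EXT SM) r" for r w
  proof -
    have w: "w \<in> hpE r" using that by (simp only: ES_hpart)
    show ?thesis unfolding f[OF hpE_ES[OF w]] by (rule cut_hp[OF F(4)[OF w]])
  qed
qed

lemma cut_zeroI: "v \<in> TI \<Longrightarrow> cut v = \<zero>\<^bsub>T J\<^esub>"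
  unfolding cut_zero[symmetric] by (subst cut_eq) (simp_all only: TI_TC TS_zero diff_zero)

lemma closed_linear_lift:
  assumes F: "lift_linear True F" and f: "\<And>w. w \<in> ES \<Longrightarrow> f w = cut (F w)"
    and d: "\<And>w. w \<in> ES \<Longrightarrow> dT (F w) + F (eodd dT w) \<in> TI"
  shows "closed_linear XZ (EXT SM) (T J) True f"
  unfolding closed_linear_def ES_carrier
proof (intro conjI ballI graded_linear_lift[OF F] f)
  fix w assume w: "w \<in> ES"
  have F1: "F w \<in> TC SM" "F (eodd dT w) \<in> TC SM" by (intro lift_linearD(1)[OF F] ES_d w)+
  show "dcomm (EXT SM) (T J) True f w = \<zero>\<^bsub>T J\<^esub>"
    unfolding dcomm_def if_P[OF TrueI] ES_dif[OF w] f[OF w] f[OF ES_d[OF w]]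
      cut_dT[OF F1(1), symmetric] cut_add[OF dT_closed[OF F1(1)] F1(2), symmetric]
    by (rule cut_zeroI[OF d[OF w]])
qed

lemma UW_XZ: "U - W \<in> carrier XZ"
proof -
  have "U \<in> carrier XZ" "W \<in> carrier XZ"
    by (rule poly_ring_mono[OF U] poly_ring_mono[OF W]; auto simp: xz_vars_def)+
  then show ?thesis by (intro poly_ring_diff)
qed

lemma d_d: "w \<in> ES \<Longrightarrow> eodd dT (eodd dT w) = scl (U - W) w"
  by (rule ext) (simp add: eodd_eodd additive_dT scl_def dT_dT ES_supported)

text \<open>Nothing is asked of F but its values: modulo \<open>TI\<close> it equals G + [d,H],
  which inherits linearity, parity and closedness from G and H.\<close>

lemma homotopicI:
  assumes G: "lift_linear True G" and H: "lift_linear False H"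
    and f: "\<And>w. w \<in> ES \<Longrightarrow> f w = cut (F w)" and g: "\<And>w. w \<in> ES \<Longrightarrow> g w = cut (G w)"
    and F: "\<And>w. w \<in> ES \<Longrightarrow> F w \<in> TC SM" and d: "\<And>w. w \<in> ES \<Longrightarrow> dT (G w) + G (eodd dT w) \<in> TI"
    and eq: "\<And>w. w \<in> ES \<Longrightarrow> F w - G w - (dT (H w) - H (eodd dT w)) \<in> TI"
  shows "homotopic XZ (EXT SM) (T J) True f g"
proof -
  note G' = lift_linearD[OF G] and H' = lift_linearD[OF H]
  define c where "c w = G w + (dT (H w) - H (eodd dT w))" for w
  have cTC: "c w \<in> TC SM" if "w \<in> ES" for w
    unfolding c_def by (intro TS_add TS_diff dT_closed G' H' ES_d that)
  have fc: "f w = cut (c w)" if w: "w \<in> ES" for w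
    unfolding f[OF w] using eq[OF w] by (subst cut_eq[OF F[OF w] cTC[OF w]]) (simp only: c_def diff_diff_eq)
  have c: "lift_linear True c"
    unfolding lift_linear_def
  proof (intro conjI ballI allI cTC)
    fix v w assume vw: "v \<in> ES" "w \<in> ES"
    have id: "(g + (a - b)) - ((g1 + (a1 - b1)) + (g2 + (a2 - b2))) = (g - (g1 + g2)) + ((a - (a1 + a2)) - (b - (b1 + b2)))"
      for g a b g1 a1 b1 g2 a2 b2 :: "'a \<times> 'b \<Rightarrow> mono \<Rightarrow> 'k pol"
      by (rule ext)+ (simp add: algebra_simps)
    have "dT (H (v + w)) - (dT (H v) + dT (H w)) \<in> TI"
      using TI_dT[OF H'(2)[OF vw]] by (simp only: dT_diff dT_add)
    moreover have "H (eodd dT (v + w)) - (H (eodd dT v) + H (eodd dT w)) \<in> TI"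
      unfolding additive.add[OF additive_eodd[OF additive_dT]] by (intro H' ES_d vw)
    ultimately show "c (v + w) - (c v + c w) \<in> TI"
      unfolding c_def id by (rule TI_add[OF G'(2)[OF vw] TI_diff])
  next
    fix p w assume p: "p \<in> carrier XZ" and w: "w \<in> ES"
    have id: "(g + (a - b)) - (g1 + (a1 - b1)) = (g - g1) + ((a - a1) - (b - b1))"
      for g a b g1 a1 b1 :: "'a \<times> 'b \<Rightarrow> mono \<Rightarrow> 'k pol"
      by (rule ext)+ (simp add: algebra_simps)
    have "dT (H (scl p w)) - act p (dT (H w)) \<in> TI"
      using TI_dT[OF H'(3)[OF p w]] by (simp only: dT_diff dT_act)
    moreover have "H (eodd dT (scl p w)) - act p (H (eodd dT w)) \<in> TI"
      unfolding scl_d by (intro H' ES_d p w)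
    ultimately show "c (scl p w) - act p (c w) \<in> TI"
      unfolding c_def additive.add[OF additive_act] additive.diff[OF additive_act] id by (rule TI_add[OF G'(3)[OF p w] TI_diff])
  next
    fix r w assume w: "w \<in> hpE r"
    have "H w \<in> hp r" using H'(4)[OF w] by simp
    moreover have "H (eodd dT w) \<in> hp (\<not> r)" using H'(4)[OF hpE_d[OF w]] by simp
    moreover have "G w \<in> hp (\<not> r)" using G'(4)[OF w] by simp
    ultimately show "c w \<in> hp (r \<noteq> True)" unfolding c_def simp_thms by (intro hp_add hp_diff hp_dT)
  qed
  have dc: "dT (c w) + c (eodd dT w) \<in> TI" if w: "w \<in> ES" for w
  proof -
    have id: "(g + (a - b)) + (g' + (b - e)) = (g + g') - (e - a)"
      for g a b g' e :: "'a \<times> 'b \<Rightarrow> mono \<Rightarrow> 'k pol"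
      by (rule ext)+ (simp add: algebra_simps)
    \<comment> \<open>Both squares of d are multiplication by U - W, an element of k[x,z], over
      which H is linear modulo \<open>TI\<close>.\<close>
    have "H (eodd dT (eodd dT w)) - dT (dT (H w)) \<in> TI"
      unfolding d_d[OF w] dT_dT[OF TS_supported[OF H'(1)[OF w]]] by (rule H'(3)[OF UW_XZ w])
    then show ?thesis
      unfolding c_def dT_add dT_diff id by (rule TI_diff[OF d[OF w]])
  qed
  have h: "graded_linear XZ (EXT SM) (T J) (\<not> True) (\<lambda>w. cut (H w))"
    unfolding simp_thms by (rule graded_linear_lift[OF H refl])
  have "f w \<ominus>\<^bsub>T J\<^esub> g w = dcomm (EXT SM) (T J) (\<not> True) (\<lambda>w. cut (H w)) w" if w: "w \<in> ES" for w
  proof -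
    have "f w \<ominus>\<^bsub>T J\<^esub> g w = cut (c w - G w)"
      unfolding fc[OF w] g[OF w] by (rule cut_minus[OF cTC[OF w] G'(1)[OF w], symmetric])
    also have "c w - G w = dT (H w) - H (eodd dT w)" unfolding c_def by (rule add_diff_cancel_left')
    also have "cut \<dots> = cut (dT (H w)) \<ominus>\<^bsub>T J\<^esub> cut (H (eodd dT w))"
      by (intro cut_minus dT_closed H' ES_d w)
    also have "\<dots> = dcomm (EXT SM) (T J) (\<not> True) (\<lambda>w. cut (H w)) w"
      unfolding dcomm_def simp_thms if_False ES_dif[OF w] cut_dT[OF H'(1)[OF w]] ..
    finally show ?thesis .
  qed
  with h show ?thesis
    unfolding homotopic_def ES_carrier
    by (intro conjI closed_linear_lift[OF c fc dc] closed_linear_lift[OF G g d] exI[of _ "\<lambda>w. cut (H w)"] ballI)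
qed

section \<open>The two homotopies\<close>

text \<open>The derivative along \<open>t\<^sub>q\<close> is applied to the equation of
  \<open>\<phi>_d\<close>; in the Koszul sum it selects the summand with index q and replaces its
  factor \<open>t\<^sub>q\<close> by 1.\<close>

lemma conn_lift_\<phi>_d:
  assumes q: "q < m" and w: "w \<in> ES"
  shows "conn_lift q (\<phi> (eodd dT w)) - (conn_lift q (dT (\<phi> w)) + \<phi> (con q w)) \<in> TI"
proof -
  let ?S = "\<Sum>j<m. act (t j) (\<phi> (con j w))"
  have \<phi>: "\<phi> (con j w) \<in> TC SM" for j by (intro \<phi>_TC ES_con w)
  have S: "?S \<in> TC SM" by (intro TS_sum act_closed \<phi> t_PR)
  have 1: "conn_lift q (dT (\<phi> w) + ?S) - (conn_lift q (dT (\<phi> w)) + conn_lift q ?S) \<in> TI"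
    by (intro conn_lift_add q dT_closed \<phi>_TC w S)
  have 2: "conn_lift q ?S - (\<Sum>j<m. conn_lift q (act (t j) (\<phi> (con j w)))) \<in> TI"
    by (intro conn_lift_sum q act_closed \<phi> t_PR)
  have 3: "(\<Sum>j<m. conn_lift q (act (t j) (\<phi> (con j w)))) - (\<Sum>j<m. if q = j then \<phi> (con j w) else 0) \<in> TI"
    unfolding sum_subtractf[symmetric] by (intro TI_sum conn_lift_t q \<phi>) simp
  have 4: "(\<Sum>j<m. if q = j then \<phi> (con j w) else 0) = \<phi> (con q w)"
    using q sum.delta'[of "{..<m}" q "\<lambda>j. \<phi> (con j w)"] by simp
  have id: "(a - (b + c)) + ((c - e) + (e - f)) = a - (b + f)" for a b c e f :: "'a \<times> 'b \<Rightarrow> mono \<Rightarrow> 'k pol"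
    by (rule ext)+ simp
  have "0 < m" using q by simp
  from \<phi>_d[OF w this] TI_add[OF 1 TI_add[OF 2 3]] show ?thesis
    unfolding id 4 by (simp only:)
qed

text \<open>\<phi> fails to commute with d only by multiples of the \<open>t\<^sub>j\<close>, so
  composing it with an operator that anticommutes with d gives an odd map that is closed modulo
  t.\<close>

lemma \<phi>_anticommute:
  assumes f: "\<And>w. w \<in> ES \<Longrightarrow> f w \<in> ES" "\<And>w. w \<in> ES \<Longrightarrow> f (eodd dT w) = - eodd dT (f w)" and w: "w \<in> ES" and m: "0 < m"
  shows "dT (\<phi> (f w)) + \<phi> (f (eodd dT w)) \<in> TI"
proof -
  have \<phi>_minus: "\<phi> (- v) = - \<phi> v" for v
    by (rule additive.minus[where f = \<phi>]) (rule additive.intro, rule \<phi>_add)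
  have "(\<Sum>j<m. act (t j) (\<phi> (con j (f w)))) \<in> TI"
    by (intro TI_sum TI_act_I \<phi>_TC ES_con f w t_in_I) simp
  then show ?thesis
    unfolding f(2)[OF w] \<phi>_minus \<phi>_d[OF f(1)[OF w] m] minus_add_distrib
    using TI_uminus by (simp only: add.assoc[symmetric] add.right_inverse add_0_left)
qed

lemma lift_linear_\<phi>:
  assumes "\<And>w. w \<in> ES \<Longrightarrow> f w \<in> ES" "\<And>v w. f (v + w) = f v + f w" "\<And>p w. f (scl p w) = scl p (f w)"
    "\<And>r w. w \<in> hpE r \<Longrightarrow> f w \<in> hpE (\<not> r)"
  shows "lift_linear True (\<lambda>w. \<phi> (f w))"
  unfolding lift_linear_def assms(2,3) \<phi>_add \<phi>_scl diff_self simp_thms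
  by (intro conjI ballI allI \<phi>_TC \<phi>_hp assms(1,4) TI_zero)

lemma lift_linear_conn_lift:
  assumes q: "q < m"
  shows "lift_linear False (\<lambda>w. conn_lift q (\<phi> w))"
  unfolding lift_linear_def \<phi>_add \<phi>_scl simp_thms
  by (intro conjI ballI allI conn_lift_TC conn_lift_add conn_lift_xz conn_lift_hp \<phi>_TC \<phi>_hp q; assumption)

lemma homotopic_gam:
  assumes i: "i < m"
  shows "homotopic XZ (EXT SM) (T J) True (gam n m l V Y X \<sigma> i \<circ> Phi \<iota> n m l V Y X)
    (Phi \<iota> n m l V Y X \<circ> contract (T SM) i)"
proof (rule homotopicI[where G = "\<lambda>w. \<phi> (con i w)" and H = "\<lambda>w. conn_lift i (\<phi> w)" and F = "\<lambda>w. At_lift i (\<phi> w)"])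
  show "lift_linear True (\<lambda>w. \<phi> (con i w))"
    by (intro lift_linear_\<phi> ES_con additive.add[OF additive_con] scl_con hpE_con i)
  show "lift_linear False (\<lambda>w. conn_lift i (\<phi> w))" by (rule lift_linear_conn_lift[OF i])
  fix w assume w: "w \<in> ES"
  show "(gam n m l V Y X \<sigma> i \<circ> Phi \<iota> n m l V Y X) w = cut (At_lift i (\<phi> w))"
    unfolding o_apply gam_def Phi_cut[OF w] by (rule atiyah_cut[OF i \<phi>_TC[OF w]])
  show "(Phi \<iota> n m l V Y X \<circ> contract (T SM) i) w = cut (\<phi> (con i w))"
    unfolding o_apply contract_con[OF w] by (rule Phi_cut[OF ES_con[OF w]])
  show "At_lift i (\<phi> w) \<in> TC SM" by (intro At_lift_TC \<phi>_TC w)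
  show "dT (\<phi> (con i w)) + \<phi> (con i (eodd dT w)) \<in> TI"
    by (rule \<phi>_anticommute[where f = "con i", OF ES_con con_d w le_less_trans[OF le0 i]])
  \<comment> \<open>The terms with d applied after the derivative occur both in
    \<open>At_lift\<close> and in the homotopy and cancel; what remains is the congruence of
    \<open>conn_lift_\<phi>_d\<close>.\<close>
  have id: "(a - b) - c - (a - d) = d - (b + c)" for a b c d :: "'a \<times> 'b \<Rightarrow> mono \<Rightarrow> 'k pol"
    by (rule ext)+ (simp add: algebra_simps)
  show "At_lift i (\<phi> w) - \<phi> (con i w) - (dT (conn_lift i (\<phi> w)) - conn_lift i (\<phi> (eodd dT w))) \<in> TI"
    unfolding At_lift_def id by (rule conn_lift_\<phi>_d[OF i w])
qed

text \<open>The Hessian sum in the formula for \<open>\<gamma>\<^sub>i\<^sup>\<dagger>\<close>, as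
  an operation on families. It is additive and commutes with d, so homotopies indexed by q can be
  summed through it.\<close>

definition hess :: "nat \<Rightarrow> (nat \<Rightarrow> 'a \<times> 'b \<Rightarrow> mono \<Rightarrow> 'k pol) \<Rightarrow> 'a \<times> 'b \<Rightarrow> mono \<Rightarrow> 'k pol" where
  "hess i f = act (const (\<iota> (1 / 2))) (\<Sum>q<m. act (V2 i q) (f q))"

lemma hess_diff: "hess i f - hess i g = hess i (\<lambda>q. f q - g q)"
  unfolding hess_def additive.diff[OF additive_act] sum_subtractf ..

lemma hess_add: "hess i f + hess i g = hess i (\<lambda>q. f q + g q)"
  unfolding hess_def additive.add[OF additive_act] sum.distrib ..

lemma hess_act: "act p (hess i f) = hess i (\<lambda>q. act p (f q))"
  unfolding hess_def additive.sum[OF additive_act] act_act by (simp only: mult.left_commute mult.commute)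

lemma hess_dT: "dT (hess i f) = hess i (\<lambda>q. dT (f q))"
  unfolding hess_def dT_act additive.sum[OF additive_dT] ..

lemma hess_TC: "(\<And>q. q < m \<Longrightarrow> f q \<in> TC SM) \<Longrightarrow> hess i f \<in> TC SM"
  unfolding hess_def by (intro act_closed const_PR TS_sum V2_PR) simp

lemma hess_TI: "(\<And>q. q < m \<Longrightarrow> f q \<in> TI) \<Longrightarrow> hess i f \<in> TI"
  unfolding hess_def by (intro TI_act const_PR TI_sum V2_PR) simp

lemma hess_hp: "(\<And>q. q < m \<Longrightarrow> f q \<in> hp s) \<Longrightarrow> hess i f \<in> hp s"
  unfolding hess_def by (intro hp_act const_PR hp_sum V2_PR) simp

lemma gam_dag_cut:
  assumes v: "v \<in> TC SM"
  shows "gam_dag \<iota> n m l V Y X \<sigma> i (cut v) = cut (- lm i v - hess i (\<lambda>q. At_lift q v))"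
proof -
  interpret TJ: abelian_group "T J" by (rule abelian_group_T[OF module_J])
  have At: "At_lift q v \<in> TC SM" for q by (rule At_lift_TC[OF v])
  have "(\<Oplus>\<^bsub>T J\<^esub>q\<in>{..<m}. V2 i q \<odot>\<^bsub>T J\<^esub> atiyah n m l V Y X \<sigma> q (cut v)) = (\<Oplus>\<^bsub>T J\<^esub>q\<in>{..<m}. cut (act (V2 i q) (At_lift q v)))"
  proof (rule TJ.finsum_cong')
    show "V2 i q \<odot>\<^bsub>T J\<^esub> atiyah n m l V Y X \<sigma> q (cut v) = cut (act (V2 i q) (At_lift q v))" if "q \<in> {..<m}" for q
      using that by (simp only: lessThan_iff atiyah_cut[OF _ v] cut_act[OF At V2_PR])
    show "(\<lambda>q. cut (act (V2 i q) (At_lift q v))) \<in> {..<m} \<rightarrow> carrier (T J)"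
      unfolding T_simps by (intro funcsetI cut_TC act_closed At V2_PR)
  qed (rule refl)
  also have "\<dots> = cut (\<Sum>q<m. act (V2 i q) (At_lift q v))"
    by (rule cut_sum[symmetric]) (intro act_closed At V2_PR, rule finite_lessThan)
  finally have *: "(\<Oplus>\<^bsub>T J\<^esub>q\<in>{..<m}. V2 i q \<odot>\<^bsub>T J\<^esub> atiyah n m l V Y X \<sigma> q (cut v)) = cut (\<Sum>q<m. act (V2 i q) (At_lift q v))" .
  have S: "(\<Sum>q<m. act (V2 i q) (At_lift q v)) \<in> TC SM" by (intro TS_sum act_closed At V2_PR)
  show ?thesis
    unfolding gam_dag_def Let_def * cut_lm[OF v, symmetric] cut_uminus[OF lm_closed[OF v], symmetric]
      cut_act[OF S const_PR, symmetric] hess_def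
    by (intro cut_minus[symmetric] TS_uminus lm_closed v act_closed S const_PR)
qed

text \<open>\<open>\<phi>_wed\<close> already has the shape of \<open>gam_dag\<close>, with
  contractions in place of Atiyah operators. The exchange costs the homotopies of
  \<open>homotopic_gam\<close>, combined by the Hessian.\<close>

lemma homotopic_gam_dag:
  assumes i: "i < m"
  shows "homotopic XZ (EXT SM) (T J) True (gam_dag \<iota> n m l V Y X \<sigma> i \<circ> Phi \<iota> n m l V Y X)
    (Phi \<iota> n m l V Y X \<circ> wedge (T SM) i)"
proof -
  obtain H where H: "\<And>w. w \<in> ES \<Longrightarrow> H w \<in> TC SM" "\<And>s w. w \<in> hpE s \<Longrightarrow> H w \<in> hp s"
    "\<And>v w. H (v + w) = H v + H w" "\<And>p w. H (scl p w) = act p (H w)"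
    "\<And>w. w \<in> ES \<Longrightarrow> \<phi> (wed i w) - (- lm i (\<phi> w) - act (const (\<iota> (1 / 2))) (\<Sum>j<m. act (V2 i j) (\<phi> (con j w)))
      + (dT (H w) - H (eodd dT w))) \<in> TI"
    by (rule \<phi>_wed[OF i]) (rule that)
  let ?h = "\<lambda>w. hess i (\<lambda>q. conn_lift q (\<phi> w))"
  \<comment> \<open>The first summand is the homotopy of \<open>\<phi>_wed\<close>, negated because
    the composite with the wedge is the map subtracted; the second trades each contraction for an
    Atiyah operator.\<close>
  have linear: "lift_linear False (\<lambda>w. - H w - ?h w)"
    unfolding lift_linear_def
  proof (intro conjI ballI allI)
    show "- H w - ?h w \<in> TC SM" if "w \<in> ES" for w
      by (intro TS_diff TS_uminus H hess_TC conn_lift_TC \<phi>_TC that)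
  next
    fix v w assume vw: "v \<in> ES" "w \<in> ES"
    have id: "- (a + b) - x - ((- a - y) + (- b - z)) = - (x - (y + z))" for a b x y z :: "'a \<times> 'b \<Rightarrow> mono \<Rightarrow> 'k pol"
      by (rule ext)+ (simp add: algebra_simps)
    show "- H (v + w) - ?h (v + w) - (- H v - ?h v + (- H w - ?h w)) \<in> TI"
      unfolding H(3) id hess_add hess_diff \<phi>_add by (intro TI_uminus hess_TI conn_lift_add \<phi>_TC vw)
  next
    fix p w assume p: "p \<in> carrier XZ" and w: "w \<in> ES"
    have id: "- a - x - (- a - y) = - (x - y)" for a x y :: "'a \<times> 'b \<Rightarrow> mono \<Rightarrow> 'k pol"
      by (rule ext)+ (simp add: algebra_simps)
    show "- H (scl p w) - ?h (scl p w) - act p (- H w - ?h w) \<in> TI"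
      unfolding H(4) \<phi>_scl additive.diff[OF additive_act] additive.minus[OF additive_act] id hess_act hess_diff
      by (intro TI_uminus hess_TI conn_lift_xz \<phi>_TC p w)
  next
    show "- H w - ?h w \<in> hp (r \<noteq> False)" if "w \<in> hpE r" for r w
      unfolding simp_thms by (intro hp_diff hp_uminus H hess_hp conn_lift_hp \<phi>_hp that)
  qed
  show ?thesis
  proof (rule homotopicI[where G = "\<lambda>w. \<phi> (wed i w)" and H = "\<lambda>w. - H w - ?h w"
        and F = "\<lambda>w. - lm i (\<phi> w) - hess i (\<lambda>q. At_lift q (\<phi> w))"])
    show "lift_linear True (\<lambda>w. \<phi> (wed i w))"
      by (intro lift_linear_\<phi> ES_wed additive.add[OF additive_wed] scl_wed hpE_wed i)
    fix w assume w: "w \<in> ES"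
    show "(gam_dag \<iota> n m l V Y X \<sigma> i \<circ> Phi \<iota> n m l V Y X) w = cut (- lm i (\<phi> w) - hess i (\<lambda>q. At_lift q (\<phi> w)))"
      unfolding o_apply Phi_cut[OF w] by (rule gam_dag_cut[OF \<phi>_TC[OF w]])
    show "(Phi \<iota> n m l V Y X \<circ> wedge (T SM) i) w = cut (\<phi> (wed i w))"
      unfolding o_apply wedge_wed[OF w] by (rule Phi_cut[OF ES_wed[OF w i]])
    show "- lm i (\<phi> w) - hess i (\<lambda>q. At_lift q (\<phi> w)) \<in> TC SM"
      by (intro TS_diff TS_uminus lm_closed hess_TC At_lift_TC \<phi>_TC w)
    show "dT (\<phi> (wed i w)) + \<phi> (wed i (eodd dT w)) \<in> TI"
    proof (rule \<phi>_anticommute[where f = "wed i", OF ES_wed[OF _ i] _ w le_less_trans[OF le0 i]])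
      show "wed i (eodd dT w) = - eodd dT (wed i w)" if "w \<in> ES" for w
        unfolding eodd_wed[OF additive_dT ES_fsupp[OF that]] by (rule minus_minus[symmetric])
    qed
    let ?c = "hess i (\<lambda>q. \<phi> (con q w))"
    \<comment> \<open>Splits the difference into the error of \<open>\<phi>_wed\<close> and the
      Hessian combination of the errors of \<open>conn_lift_\<phi>_d\<close>; the contraction terms
      cancel between the two.\<close>
    have id: "- x - (a - b) - g - ((- h - a) - (- h' - e)) = - (g - (- x - ?c + (h - h'))) - (e - (b + ?c))"
      for x a b g h h' e :: "'a \<times> 'b \<Rightarrow> mono \<Rightarrow> 'k pol"
      by (rule ext)+ (simp add: algebra_simps)
    have "hess i (\<lambda>q. conn_lift q (\<phi> (eodd dT w))) - (hess i (\<lambda>q. conn_lift q (dT (\<phi> w))) + hess i (\<lambda>q. \<phi> (con q w))) \<in> TI"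
      unfolding hess_add hess_diff by (intro hess_TI conn_lift_\<phi>_d w)
    with H(5)[OF w]
    show "- lm i (\<phi> w) - hess i (\<lambda>q. At_lift q (\<phi> w)) - \<phi> (wed i w)
        - (dT (- H w - ?h w) - (- H (eodd dT w) - ?h (eodd dT w))) \<in> TI"
      unfolding hess_def[of _ "\<lambda>q. \<phi> (con q w)", symmetric] At_lift_def hess_diff[symmetric] dT_diff
        additive.minus[OF additive_dT] hess_dT id
      by (rule TI_diff[OF TI_uminus])
  qed (rule linear)
qed

end

theorem proposition4p35:
  fixes \<iota> :: "rat \<Rightarrow> 'k::comm_ring_1"
    and n m l :: nat
    and W V U :: "'k pol"
    and X :: "('k pol, 'b) mfact" and Y :: "('k pol, 'a) mfact"
    and \<sigma> :: "'k pol set \<Rightarrow> nat \<Rightarrow> 'k pol set"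
  assumes "noetherian_ring (type_ring :: 'k ring)" and "rat_algebra \<iota>"
    and "potential VX n W" and "potential VY m V" and "potential VZ l U"
    and "matrix_factorisation (poly_ring (VX ` {..<n} \<union> VY ` {..<m})) (V - W) X"
    and "matrix_factorisation (poly_ring (VY ` {..<m} \<union> VZ ` {..<l})) (U - V) Y"
    and "linear_section m V \<sigma>"
  shows "\<forall>i<m.
    homotopic (poly_ring (xz_vars n l)) (ext_tensor m (tensor_YX n m l Y X)) (cut_module n m l V Y X) True
      (gam_dag \<iota> n m l V Y X \<sigma> i \<circ> Phi \<iota> n m l V Y X)
      (Phi \<iota> n m l V Y X \<circ> wedge (tensor_YX n m l Y X) i) \<and>
    homotopic (poly_ring (xz_vars n l)) (ext_tensor m (tensor_YX n m l Y X)) (cut_module n m l V Y X) True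
      (gam n m l V Y X \<sigma> i \<circ> Phi \<iota> n m l V Y X)
      (Phi \<iota> n m l V Y X \<circ> contract (tensor_YX n m l Y X) i)"
proof -
  interpret cut_system n m l X Y V \<sigma> W U \<iota>
    by unfold_locales (use assms in \<open>simp_all add: matrix_factorisation_def potential_def\<close>)
  show ?thesis
    by (intro allI impI conjI homotopic_gam_dag homotopic_gam)
qed

end
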